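(* Let $\nu>0$, let $\omega_0\in H^2$ be periodic with zero mean, and let $\omega^n$ ($n\ge 1$) be the discrete solution of the fully discrete IMEX BDF3 Fourier pseudo-spectral scheme (described in the context) with initial value $\omega^0$ determined by $\omega_0$ and initial guess data $\omega^{-1},\omega^{-2}$ bounded in $H^2$ norm. Let $\boldsymbol{\omega}^n$ denote the continuous extension of $\omega^n$ in space. Let $\boldsymbol f\in L^\infty(0,T;L^2)$, with $\|\boldsymbol f\|_\infty:=\|\boldsymbol f\|_{L^\infty(0,T;L^2)}$ (the bound holding for all times, so that $T$ may be taken to be $+\infty$). Then there exist a constant $C_w>0$ depending only on $\Omega$, a constant $M_0=M_0(\|\omega_0\|_{H^2},\nu,\|\boldsymbol f\|_\infty)$, a positive constant $\alpha_0$ associated with the numerical temporal stencil, a positive constant $\beta_0$ associated with the temporal stencil and with elliptic regularity on $\Omega$, and constants $R^{(0)},R^{(1)}$, uniform in time and depending only on $\|\boldsymbol\omega^0\|_{H^2}$, $\|\boldsymbol f\|_\infty$, $\Omega$ and $\nu$ (where $M_0,R^{(0)},R^{(1)}$ may also depend on the assumed $H^2$ bound of $\omega^{-1},\omega^{-2}$), such that if $$\Delta t\le \frac{\nu}{C_w M_0^2},$$ then $$\|\boldsymbol\omega^n\|\le \alpha_0^{-1}(1+\beta_0\nu\Delta t)^{-n/2}(F^0)^{1/2}+R^{(0)},\qquad \forall\, n\ge 0,$$ $$\|\nabla\boldsymbol\omega^n\|\le \alpha_0^{-1}(1+\beta_0\nu\Delta t)^{-n/2}(G_1^0)^{1/2}+R^{(1)},\qquad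 \forall\, n\ge 0,$$ where $$\begin{aligned}F^0=&\|\alpha_1\omega^0\|_2^2+\|\alpha_2\omega^0+\alpha_3\omega^{-1}\|_2^2+\|\alpha_4\omega^0+\alpha_5\omega^{-1}+\alpha_6\omega^{-2}\|_2^2+\tfrac{7\nu\Delta t}{4}\|\nabla_N\omega^0\|_2^2\\&+\tfrac{15\nu\Delta t}{32}\|\nabla_N\omega^{-1}\|_2^2+\tfrac{13\nu\Delta t}{64}\|\nabla_N\omega^{-2}\|_2^2+\tfrac78\|\omega^0-\omega^{-1}\|_2^2+\tfrac{5}{24}\|\omega^{-1}-\omega^{-2}\|_2^2,\end{aligned}$$ $$\begin{aligned}G_1^0=&\|\alpha_1\nabla_N\omega^0\|_2^2+\|\nabla_N(\alpha_2\omega^0+\alpha_3\omega^{-1})\|_2^2+\|\nabla_N(\alpha_4\omega^0+\alpha_5\omega^{-1}+\alpha_6\omega^{-2})\|_2^2+\tfrac{37\nu\Delta t}{24}\|\Delta_N\omega^0\|_2^2\\&+\tfrac{17\nu\Delta t}{48}\|\Delta_N\omega^{-1}\|_2^2+\tfrac{17\nu\Delta t}{96}\|\Delta_N\omega^{-2}\|_2^2+\tfrac56\|\nabla_N(\omega^0-\omega^{-1})\|_2^2+\tfrac16\|\nabla_N(\omega^{-1}-\omega^{-2})\|_2^2.\end{aligned}$$ In particular none of $C_w,M_0,\alpha_0,\beta_0,R^{(0)},R^{(1)}$ depends on the mesh size $h$, on $\Delta t$ or on $n$.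
   Context: Domain and grid: $\Omega=[0,1]^2$ with periodic boundary conditions; $N=2K+1$ is a positive odd integer, $h=1/N$, grid points $x_i=ih$, $y_j=jh$. All functions on the grid are periodic grid functions. $\mathcal B^K$ is the space of trigonometric polynomials in $(x,y)$ of degree up to $K$ in each variable. Fourier differentiation: a grid function has the discrete expansion $f_{i,j}=\sum_{k,l=-K}^{K}\hat f_{k,l}\,e^{2\pi \mathrm i(kx_i+ly_j)}$; then $(\mathcal D_{Nx}f)_{i,j}=\sum_{k,l}(2\pi\mathrm i k)\hat f_{k,l}e^{2\pi\mathrm i(kx_i+ly_j)}$, similarly $\mathcal D_{Ny}$, and $\nabla_N f=(\mathcal D_{Nx}f,\mathcal D_{Ny}f)^T$, $\nabla_N\cdot(f_1,f_2)^T=\mathcal D_{Nx}f_1+\mathcal D_{Ny}f_2$, $\Delta_N=\mathcal D_{Nx}^2+\mathcal D_{Ny}^2$, $\nabla_N^\perp\psi=(\mathcal D_{Ny}\psi,-\mathcal D_{Nx}\psi)$. Products of grid functions are pointwise. The continuous extension of the grid function $f$ is $\sum_{k,l=-K}^K\hat f_{k,l}e^{2\pi\mathrm i(kx+ly)}\in\mathcal B^K$. Discrete inner product and norm: $\langle f,g\rangle=h^2\sum_{i,j=0}^{N-1}f_{i,j}g_{i,j}$, $\|f\|_2=\langle f,f\rangle^{1/2}$ (componentwise sum for vectors); discrete average $\overline f=\langle f,1\rangle$. $\|\cdot\|$ is the $L^2(\Omega)$ norm. The $H^k$ norm of a grid function means the $H^k$ norm of its continuous extension. Problem: 2-D Navier-Stokes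 in vorticity form, $\partial_t\omega+\boldsymbol u\cdot\nabla\omega=\nu\Delta\omega+\boldsymbol f$, $-\Delta\psi=\omega$, $\boldsymbol u=\nabla^\perp\psi=(\partial_y\psi,-\partial_x\psi)$, with $\nu>0$ the kinematic viscosity and scalar external force $\boldsymbol f$ having $\int_\Omega\boldsymbol f(\cdot,t)\,d\mathbf x=0$ and uniformly bounded $L^2$ norm for all $t>0$. IMEX BDF3 scheme: with time step $\Delta t$, $t^n=n\Delta t$, given zero-average grid functions $\omega^0,\omega^{-1},\omega^{-2}$ (where $\omega^0$ is the grid restriction of the Fourier projection of $\omega_0$ onto $\mathcal B^K$), find for $n\ge0$ the grid functions $\omega^{n+1},\psi^{n+1},\boldsymbol u^{n+1}$ with $$\frac{\frac{11}{6}\omega^{n+1}-3\omega^n+\frac32\omega^{n-1}-\frac13\omega^{n-2}}{\Delta t}+\frac32\mathcal N^n-\frac32\mathcal N^{n-1}+\frac12\mathcal N^{n-2}=\nu\Delta_N\omega^{n+1}+\boldsymbol f_N^{n+1},$$ $$\mathcal N^\ell:=\boldsymbol u^\ell\cdot\nabla_N\omega^\ell+\nabla_N\cdot(\boldsymbol u^\ell\omega^\ell)-\overline{\boldsymbol u^\ell\cdot\nabla_N\omega^\ell},$$ $$-\Delta_N\psi^{n+1}=\omega^{n+1},\quad \overline{\psi^{n+1}}=0,\qquad \boldsymbol u^{n+1}=\nabla_N^\perp\psi^{n+1},$$ where $\boldsymbol f_N^{n+1}$ is (the grid restriction of) the Fourier projection of $\boldsymbol f(\cdot,t^{n+1})$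 onto $\mathcal B^K$, and $\psi^\ell,\boldsymbol u^\ell$ for $\ell=0,-1,-2$ are obtained from $\omega^\ell$ by the same two kinematic relations. Stencil constants: $\alpha_1,\dots,\alpha_{10}$ are fixed real constants with $\alpha_1\ne0$ such that for all grid functions $f^{n+1},f^n,f^{n-1},f^{n-2}$, $$\begin{aligned}&\langle\tfrac{11}{6}f^{n+1}-3f^n+\tfrac32f^{n-1}-\tfrac13f^{n-2},\,2f^{n+1}-f^n\rangle\\=\;&\|\alpha_1f^{n+1}\|_2^2-\|\alpha_1f^n\|_2^2+\|\alpha_2f^{n+1}+\alpha_3f^n\|_2^2-\|\alpha_2f^n+\alpha_3f^{n-1}\|_2^2\\&+\|\alpha_4f^{n+1}+\alpha_5f^n+\alpha_6f^{n-1}\|_2^2-\|\alpha_4f^n+\alpha_5f^{n-1}+\alpha_6f^{n-2}\|_2^2+\|\alpha_7f^{n+1}+\alpha_8f^n+\alpha_9f^{n-1}+\alpha_{10}f^{n-2}\|_2^2.\end{aligned}$$ *)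

theory Defs
  imports "HOL-Analysis.Analysis" "HOL-Probability.Essential_Supremum"
begin

section \<open>Function spaces on the periodic unit square\<close>

definition Om :: "(real \<times> real) set" where
  "Om = {0..1} \<times> {0..1}"

definition in_L2 :: "(real \<times> real \<Rightarrow> real) \<Rightarrow> bool" where
  "in_L2 f \<longleftrightarrow> f \<in> borel_measurable (lebesgue_on Om) \<and>
     integrable (lebesgue_on Om) (\<lambda>p. (f p)\<^sup>2)"

definition L2norm :: "(real \<times> real \<Rightarrow> real) \<Rightarrow> real" where
  "L2norm f = sqrt (LINT p|lebesgue_on Om. (f p)\<^sup>2)"

definition mean :: "(real \<times> real \<Rightarrow> real) \<Rightarrow> real" where
  "mean f = (LINT p|lebesgue_on Om. f p)"

definition periodic :: "(real \<times> real \<Rightarrow> real) \<Rightarrow> bool" where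
  "periodic f \<longleftrightarrow> (\<forall>x y. f (x + 1, y) = f (x, y) \<and> f (x, y + 1) = f (x, y))"

text \<open>A smooth periodic function is given together with all its partial derivatives:
  \<open>\<phi> a b\<close> is the derivative of \<open>\<phi> 0 0\<close> of order \<open>a\<close> in \<open>x\<close> and \<open>b\<close> in \<open>y\<close>.\<close>

definition smooth_periodic_jet :: "(nat \<Rightarrow> nat \<Rightarrow> real \<times> real \<Rightarrow> real) \<Rightarrow> bool" where
  "smooth_periodic_jet \<phi> \<longleftrightarrow> periodic (\<phi> 0 0) \<and>
     (\<forall>a b. continuous_on UNIV (\<phi> a b)) \<and>
     (\<forall>a b x y. ((\<lambda>s. \<phi> a b (s, y)) has_real_derivative \<phi> (Suc a) b (x, y)) (at x) \<and>
                ((\<lambda>s. \<phi> a b (x, s)) has_real_derivative \<phi> a (Suc b) (x, y)) (at y))"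

text \<open>Square-integrable weak derivatives on the torus: the test functions are periodic and
  need not vanish on the boundary of the square, so that no boundary jumps are allowed.\<close>

definition weak_deriv ::
  "nat \<Rightarrow> nat \<Rightarrow> (real \<times> real \<Rightarrow> real) \<Rightarrow> (real \<times> real \<Rightarrow> real) \<Rightarrow> bool" where
  "weak_deriv a b f g \<longleftrightarrow> in_L2 g \<and>
     (\<forall>\<phi>. smooth_periodic_jet \<phi> \<longrightarrow>
        (LINT p|lebesgue_on Om. f p * \<phi> a b p) =
        (-1) ^ (a + b) * (LINT p|lebesgue_on Om. g p * \<phi> 0 0 p))"

definition in_H :: "nat \<Rightarrow> (real \<times> real \<Rightarrow> real) \<Rightarrow> bool" where
  "in_H m f \<longleftrightarrow> periodic f \<and> in_L2 f \<and> (\<forall>a b. a + b \<le> m \<longrightarrow> (\<exists>g. weak_deriv a b f g))"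

text \<open>The weak derivative is unique almost everywhere, so the choice does not affect the norm.\<close>

definition Hnorm :: "nat \<Rightarrow> (real \<times> real \<Rightarrow> real) \<Rightarrow> real" where
  "Hnorm m f = sqrt (\<Sum>(a, b) \<in> {(a, b). a + b \<le> m}. (L2norm (SOME g. weak_deriv a b f g))\<^sup>2)"

definition L2norm_grad :: "(real \<times> real \<Rightarrow> real) \<Rightarrow> real" where
  "L2norm_grad f = sqrt (LINT (x, y)|lebesgue_on Om.
     (deriv (\<lambda>s. f (s, y)) x)\<^sup>2 + (deriv (\<lambda>s. f (x, s)) y)\<^sup>2)"

text \<open>Bochner measurability of an \<open>L\<^sup>2\<close>-valued function on the half line of positive times.\<close>

definition bochner_measurable_L2 :: "(real \<Rightarrow> real \<times> real \<Rightarrow> real) \<Rightarrow> bool" where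
  "bochner_measurable_L2 f \<longleftrightarrow>
     (\<exists>s :: nat \<Rightarrow> real \<Rightarrow> real \<times> real \<Rightarrow> real.
        (\<forall>n. finite (s n ` {0<..}) \<and> (\<forall>t>0. in_L2 (s n t)) \<and>
             (\<forall>g. {t. t > 0 \<and> s n t = g} \<in> sets lebesgue)) \<and>
        (AE t in lebesgue_on {0<..}. (\<lambda>n. L2norm (\<lambda>p. s n t p - f t p)) \<longlonglongrightarrow> 0))"

definition esssup_L2 :: "(real \<Rightarrow> real \<times> real \<Rightarrow> real) \<Rightarrow> ereal" where
  "esssup_L2 f = esssup (lebesgue_on {0<..}) (\<lambda>t. ereal (L2norm (f t)))"

definition in_Linf_L2 :: "(real \<Rightarrow> real \<times> real \<Rightarrow> real) \<Rightarrow> bool" where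
  "in_Linf_L2 f \<longleftrightarrow> (\<forall>t>0. in_L2 (f t)) \<and> bochner_measurable_L2 f \<and> esssup_L2 f < \<infinity>"

definition Linf_L2_norm :: "(real \<Rightarrow> real \<times> real \<Rightarrow> real) \<Rightarrow> real" where
  "Linf_L2_norm f = real_of_ereal (esssup_L2 f)"

definition fmode :: "int \<Rightarrow> int \<Rightarrow> real \<times> real \<Rightarrow> complex" where
  "fmode k l p = cis (2 * pi * (of_int k * fst p + of_int l * snd p))"

definition trigsum :: "nat \<Rightarrow> (int \<Rightarrow> int \<Rightarrow> complex) \<Rightarrow> real \<times> real \<Rightarrow> complex" where
  "trigsum K c p = (\<Sum>k = - int K..int K. \<Sum>l = - int K..int K. c k l * fmode k l p)"

definition fourier_coeff :: "(real \<times> real \<Rightarrow> real) \<Rightarrow> int \<Rightarrow> int \<Rightarrow> complex" where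
  "fourier_coeff f k l = (LINT p|lebesgue_on Om. complex_of_real (f p) * cnj (fmode k l p))"

text \<open>Here and below, \<open>Re\<close> only changes the type: the sums it is applied to are real
  (lemmas \<open>fourier_proj_complex\<close>, \<open>DNx_complex\<close>, \<open>DNy_complex\<close>, \<open>ext_complex\<close>).\<close>

definition fourier_proj :: "nat \<Rightarrow> (real \<times> real \<Rightarrow> real) \<Rightarrow> real \<times> real \<Rightarrow> real" where
  "fourier_proj K f p = Re (trigsum K (fourier_coeff f) p)"


section \<open>Grid functions and Fourier differentiation\<close>

text \<open>A grid function on the mesh with \<open>N = 2 K + 1\<close> points per direction is an \<open>N\<close>-periodic
  function of two integer indices.\<close>

type_synonym grid = "int \<Rightarrow> int \<Rightarrow> real"

definition mesh_N :: "nat \<Rightarrow> int" where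
  "mesh_N K = 2 * int K + 1"

definition mesh_h :: "nat \<Rightarrow> real" where
  "mesh_h K = 1 / of_int (mesh_N K)"

definition grid_pt :: "nat \<Rightarrow> int \<Rightarrow> int \<Rightarrow> real \<times> real" where
  "grid_pt K i j = (of_int i * mesh_h K, of_int j * mesh_h K)"

definition is_grid :: "nat \<Rightarrow> grid \<Rightarrow> bool" where
  "is_grid K f \<longleftrightarrow> (\<forall>i j. f (i + mesh_N K) j = f i j \<and> f i (j + mesh_N K) = f i j)"

definition restrict_grid :: "nat \<Rightarrow> (real \<times> real \<Rightarrow> real) \<Rightarrow> grid" where
  "restrict_grid K f = (\<lambda>i j. f (grid_pt K i j))"

definition ginner :: "nat \<Rightarrow> grid \<Rightarrow> grid \<Rightarrow> real" where
  "ginner K f g = (mesh_h K)\<^sup>2 * (\<Sum>i\<in>{0..<mesh_N K}. \<Sum>j\<in>{0..<mesh_N K}. f i j * g i j)"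

definition gnorm :: "nat \<Rightarrow> grid \<Rightarrow> real" where
  "gnorm K f = sqrt (ginner K f f)"

definition vgnorm :: "nat \<Rightarrow> grid \<times> grid \<Rightarrow> real" where
  "vgnorm K v = sqrt (ginner K (fst v) (fst v) + ginner K (snd v) (snd v))"

definition gavg :: "nat \<Rightarrow> grid \<Rightarrow> real" where
  "gavg K f = ginner K f (\<lambda>i j. 1)"

text \<open>The coefficients of the discrete expansion, cf. lemma \<open>discrete_expansion\<close>.\<close>

definition dft :: "nat \<Rightarrow> grid \<Rightarrow> int \<Rightarrow> int \<Rightarrow> complex" where
  "dft K f k l = of_real ((mesh_h K)\<^sup>2) *
     (\<Sum>i\<in>{0..<mesh_N K}. \<Sum>j\<in>{0..<mesh_N K}. of_real (f i j) * cnj (fmode k l (grid_pt K i j)))"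

definition ext :: "nat \<Rightarrow> grid \<Rightarrow> real \<times> real \<Rightarrow> real" where
  "ext K f p = Re (trigsum K (dft K f) p)"

definition DNx :: "nat \<Rightarrow> grid \<Rightarrow> grid" where
  "DNx K f = (\<lambda>i j. Re (trigsum K (\<lambda>k l. 2 * pi * \<i> * of_int k * dft K f k l) (grid_pt K i j)))"

definition DNy :: "nat \<Rightarrow> grid \<Rightarrow> grid" where
  "DNy K f = (\<lambda>i j. Re (trigsum K (\<lambda>k l. 2 * pi * \<i> * of_int l * dft K f k l) (grid_pt K i j)))"

definition gradN :: "nat \<Rightarrow> grid \<Rightarrow> grid \<times> grid" where
  "gradN K f = (DNx K f, DNy K f)"

definition divN :: "nat \<Rightarrow> grid \<times> grid \<Rightarrow> grid" where
  "divN K v = (\<lambda>i j. DNx K (fst v) i j + DNy K (snd v) i j)"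

definition lapN :: "nat \<Rightarrow> grid \<Rightarrow> grid" where
  "lapN K f = (\<lambda>i j. DNx K (DNx K f) i j + DNy K (DNy K f) i j)"

definition perp_gradN :: "nat \<Rightarrow> grid \<Rightarrow> grid \<times> grid" where
  "perp_gradN K \<psi> = (DNy K \<psi>, \<lambda>i j. - DNx K \<psi> i j)"


section \<open>The IMEX BDF3 scheme\<close>

definition advN :: "nat \<Rightarrow> grid \<times> grid \<Rightarrow> grid \<Rightarrow> grid" where
  "advN K u w = (\<lambda>i j. fst u i j * DNx K w i j + snd u i j * DNy K w i j)"

definition nonlinN :: "nat \<Rightarrow> grid \<times> grid \<Rightarrow> grid \<Rightarrow> grid" where
  "nonlinN K u w = (\<lambda>i j. advN K u w i j
      + divN K (\<lambda>i j. fst u i j * w i j, \<lambda>i j. snd u i j * w i j) i j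
      - gavg K (advN K u w))"

definition kinematic :: "nat \<Rightarrow> grid \<Rightarrow> grid \<Rightarrow> grid \<times> grid \<Rightarrow> bool" where
  "kinematic K w \<psi> u \<longleftrightarrow> is_grid K \<psi> \<and> gavg K \<psi> = 0 \<and>
     (\<forall>i j. - lapN K \<psi> i j = w i j) \<and> u = perp_gradN K \<psi>"

definition bdf3_step ::
  "nat \<Rightarrow> real \<Rightarrow> real \<Rightarrow> (real \<Rightarrow> real \<times> real \<Rightarrow> real) \<Rightarrow>
   (int \<Rightarrow> grid) \<Rightarrow> (int \<Rightarrow> grid \<times> grid) \<Rightarrow> int \<Rightarrow> bool" where
  "bdf3_step K \<nu> dt f w u n \<longleftrightarrow>
     (\<forall>i j. (11/6 * w (n+1) i j - 3 * w n i j + 3/2 * w (n-1) i j - 1/3 * w (n-2) i j) / dt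
        + 3/2 * nonlinN K (u n) (w n) i j
        - 3/2 * nonlinN K (u (n-1)) (w (n-1)) i j
        + 1/2 * nonlinN K (u (n-2)) (w (n-2)) i j
      = \<nu> * lapN K (w (n+1)) i j
        + restrict_grid K (fourier_proj K (f (of_int (n+1) * dt))) i j)"

text \<open>The time index runs over the integers \<open>\<ge> -2\<close>; the values at \<open>-1\<close> and \<open>-2\<close> are the
  initial guess data.\<close>

definition bdf3_solution ::
  "nat \<Rightarrow> real \<Rightarrow> real \<Rightarrow> (real \<Rightarrow> real \<times> real \<Rightarrow> real) \<Rightarrow> (real \<times> real \<Rightarrow> real) \<Rightarrow>
   (int \<Rightarrow> grid) \<Rightarrow> (int \<Rightarrow> grid) \<Rightarrow> (int \<Rightarrow> grid \<times> grid) \<Rightarrow> bool" where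
  "bdf3_solution K \<nu> dt f \<omega>\<^sub>0 w \<psi> u \<longleftrightarrow>
     w 0 = restrict_grid K (fourier_proj K \<omega>\<^sub>0) \<and>
     gavg K (w 0) = 0 \<and> gavg K (w (-1)) = 0 \<and> gavg K (w (-2)) = 0 \<and>
     (\<forall>n\<ge>-2. is_grid K (w n) \<and> kinematic K (w n) (\<psi> n) (u n)) \<and>
     (\<forall>n\<ge>0. bdf3_step K \<nu> dt f w u n)"

definition stencil_constants :: "(nat \<Rightarrow> real) \<Rightarrow> bool" where
  "stencil_constants \<alpha> \<longleftrightarrow> \<alpha> 1 \<noteq> 0 \<and>
     (\<forall>K f3 f2 f1 f0. is_grid K f3 \<and> is_grid K f2 \<and> is_grid K f1 \<and> is_grid K f0 \<longrightarrow>
        ginner K (\<lambda>i j. 11/6 * f3 i j - 3 * f2 i j + 3/2 * f1 i j - 1/3 * f0 i j)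
                 (\<lambda>i j. 2 * f3 i j - f2 i j)
        = (gnorm K (\<lambda>i j. \<alpha> 1 * f3 i j))\<^sup>2 - (gnorm K (\<lambda>i j. \<alpha> 1 * f2 i j))\<^sup>2
        + (gnorm K (\<lambda>i j. \<alpha> 2 * f3 i j + \<alpha> 3 * f2 i j))\<^sup>2
        - (gnorm K (\<lambda>i j. \<alpha> 2 * f2 i j + \<alpha> 3 * f1 i j))\<^sup>2
        + (gnorm K (\<lambda>i j. \<alpha> 4 * f3 i j + \<alpha> 5 * f2 i j + \<alpha> 6 * f1 i j))\<^sup>2
        - (gnorm K (\<lambda>i j. \<alpha> 4 * f2 i j + \<alpha> 5 * f1 i j + \<alpha> 6 * f0 i j))\<^sup>2
        + (gnorm K (\<lambda>i j. \<alpha> 7 * f3 i j + \<alpha> 8 * f2 i j + \<alpha> 9 * f1 i j + \<alpha> 10 * f0 i j))\<^sup>2)"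

text \<open>In the two functionals below, \<open>w0\<close>, \<open>w1\<close>, \<open>w2\<close> are the data at time levels
  \<open>0\<close>, \<open>-1\<close>, \<open>-2\<close>.\<close>

definition F_init :: "(nat \<Rightarrow> real) \<Rightarrow> nat \<Rightarrow> real \<Rightarrow> real \<Rightarrow> grid \<Rightarrow> grid \<Rightarrow> grid \<Rightarrow> real" where
  "F_init \<alpha> K \<nu> dt w0 w1 w2 =
     (gnorm K (\<lambda>i j. \<alpha> 1 * w0 i j))\<^sup>2
   + (gnorm K (\<lambda>i j. \<alpha> 2 * w0 i j + \<alpha> 3 * w1 i j))\<^sup>2
   + (gnorm K (\<lambda>i j. \<alpha> 4 * w0 i j + \<alpha> 5 * w1 i j + \<alpha> 6 * w2 i j))\<^sup>2
   + 7 * \<nu> * dt / 4 * (vgnorm K (gradN K w0))\<^sup>2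
   + 15 * \<nu> * dt / 32 * (vgnorm K (gradN K w1))\<^sup>2
   + 13 * \<nu> * dt / 64 * (vgnorm K (gradN K w2))\<^sup>2
   + 7/8 * (gnorm K (\<lambda>i j. w0 i j - w1 i j))\<^sup>2
   + 5/24 * (gnorm K (\<lambda>i j. w1 i j - w2 i j))\<^sup>2"

definition G_init :: "(nat \<Rightarrow> real) \<Rightarrow> nat \<Rightarrow> real \<Rightarrow> real \<Rightarrow> grid \<Rightarrow> grid \<Rightarrow> grid \<Rightarrow> real" where
  "G_init \<alpha> K \<nu> dt w0 w1 w2 =
     (vgnorm K (\<lambda>i j. \<alpha> 1 * DNx K w0 i j, \<lambda>i j. \<alpha> 1 * DNy K w0 i j))\<^sup>2
   + (vgnorm K (gradN K (\<lambda>i j. \<alpha> 2 * w0 i j + \<alpha> 3 * w1 i j)))\<^sup>2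
   + (vgnorm K (gradN K (\<lambda>i j. \<alpha> 4 * w0 i j + \<alpha> 5 * w1 i j + \<alpha> 6 * w2 i j)))\<^sup>2
   + 37 * \<nu> * dt / 24 * (gnorm K (lapN K w0))\<^sup>2
   + 17 * \<nu> * dt / 48 * (gnorm K (lapN K w1))\<^sup>2
   + 17 * \<nu> * dt / 96 * (gnorm K (lapN K w2))\<^sup>2
   + 5/6 * (vgnorm K (gradN K (\<lambda>i j. w0 i j - w1 i j)))\<^sup>2
   + 1/6 * (vgnorm K (gradN K (\<lambda>i j. w1 i j - w2 i j)))\<^sup>2"


section \<open>Consistency of the Fourier definitions\<close>

lemma fmode_uminus: "fmode (- k) (- l) p = cnj (fmode k l p)"
  by (simp add: fmode_def cis_cnj algebra_simps)

lemma trigsum_real: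
  assumes "\<And>k l. c (- k) (- l) = cnj (c k l)"
  shows "of_real (Re (trigsum K c p)) = trigsum K c p"
proof -
  let ?A = "{- int K..int K}"
  have reflect: "(\<Sum>k\<in>?A. h (- k)) = (\<Sum>k\<in>?A. h k)" for h :: "int \<Rightarrow> complex"
    by (rule sum.reindex_bij_witness[of _ uminus uminus]) auto
  have "cnj (trigsum K c p) = (\<Sum>k\<in>?A. \<Sum>l\<in>?A. c (- k) (- l) * fmode (- k) (- l) p)"
    by (simp add: trigsum_def assms fmode_uminus)
  also have "\<dots> = (\<Sum>k\<in>?A. \<Sum>l\<in>?A. c (- k) l * fmode (- k) l p)"
  proof (rule sum.cong)
    fix k
    show "(\<Sum>l\<in>?A. c (- k) (- l) * fmode (- k) (- l) p) = (\<Sum>l\<in>?A. c (- k) l * fmode (- k) l p)"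
      by (rule reflect)
  qed simp
  also have "\<dots> = trigsum K c p"
    unfolding trigsum_def by (rule reflect)
  finally show ?thesis
    by (metis Reals_cnj_iff of_real_Re)
qed

lemma dft_uminus: "dft K f (- k) (- l) = cnj (dft K f k l)"
  by (simp add: dft_def fmode_uminus)

lemma fourier_coeff_uminus: "fourier_coeff f (- k) (- l) = cnj (fourier_coeff f k l)"
proof -
  have "cnj (fourier_coeff f k l) =
      (LINT p|lebesgue_on Om. cnj (complex_of_real (f p) * cnj (fmode k l p)))"
    unfolding fourier_coeff_def by (simp only: Bochner_Integration.integral_cnj)
  then show ?thesis
    by (simp add: fourier_coeff_def fmode_uminus)
qed

lemma fourier_proj_complex: "of_real (fourier_proj K f p) = trigsum K (fourier_coeff f) p"
  unfolding fourier_proj_def by (rule trigsum_real) (rule fourier_coeff_uminus)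

lemma ext_complex: "of_real (ext K f p) = trigsum K (dft K f) p"
  unfolding ext_def by (rule trigsum_real) (rule dft_uminus)

lemma DNx_complex:
  "of_real (DNx K f i j) = trigsum K (\<lambda>k l. 2 * pi * \<i> * of_int k * dft K f k l) (grid_pt K i j)"
  unfolding DNx_def by (rule trigsum_real) (simp add: dft_uminus)

lemma DNy_complex:
  "of_real (DNy K f i j) = trigsum K (\<lambda>k l. 2 * pi * \<i> * of_int l * dft K f k l) (grid_pt K i j)"
  unfolding DNy_def by (rule trigsum_real) (simp add: dft_uminus)

lemma mesh_N_pos: "mesh_N K > 0"
  by (simp add: mesh_N_def)

lemma sum_cis_symmetric:
  assumes "m \<in> {0..<mesh_N K}" "i \<in> {0..<mesh_N K}"
  shows "(\<Sum>k = - int K..int K. cis (2 * pi * (of_int k * (of_int (m - i) * mesh_h K)))) =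
         (if m = i then of_int (mesh_N K) else 0)"
proof -
  let ?N = "nat (mesh_N K)"
  define z where "z = cis (2 * pi * (of_int (m - i) * mesh_h K))"
  have N: "mesh_N K = 2 * int K + 1" "?N = 2 * K + 1" "?N > 0"
    by (auto simp: mesh_N_def)
  have "(\<Sum>k = - int K..int K. cis (2 * pi * (of_int k * (of_int (m - i) * mesh_h K)))) =
        (\<Sum>q<?N. cis (2 * pi * (of_int (int q - int K) * (of_int (m - i) * mesh_h K))))"
    by (rule sum.reindex_bij_witness[of _ "\<lambda>q. int q - int K" "\<lambda>k. nat (k + int K)"])
       (auto simp: N)
  also have "\<dots> = (\<Sum>q<?N. cis (- (2 * pi * (real K * (of_int (m - i) * mesh_h K)))) * z ^ q)"
    unfolding z_def Complex.DeMoivre cis_mult by (intro sum.cong refl arg_cong[of _ _ cis])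
      (simp add: algebra_simps)
  also have "\<dots> = cis (- (2 * pi * (real K * (of_int (m - i) * mesh_h K)))) * (\<Sum>q<?N. z ^ q)"
    by (simp add: sum_distrib_left)
  finally have *: "(\<Sum>k = - int K..int K. cis (2 * pi * (of_int k * (of_int (m - i) * mesh_h K)))) =
        cis (- (2 * pi * (real K * (of_int (m - i) * mesh_h K)))) * (\<Sum>q<?N. z ^ q)" .
  show ?thesis
  proof (cases "m = i")
    case True
    then show ?thesis
      by (simp add: mesh_N_def)
  next
    case False
    have "z ^ ?N = cis (2 * pi * of_int (m - i))"
      unfolding z_def Complex.DeMoivre using mesh_N_pos[of K]
      by (intro arg_cong[of _ _ cis]) (simp add: mesh_h_def)
    also have "\<dots> = 1"
      by (rule cis_multiple_2pi) auto
    finally have zN: "z ^ ?N = 1" .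
    have "z \<noteq> 1"
    proof
      assume "z = 1"
      then have "cos (2 * pi * (of_int (m - i) * mesh_h K)) = 1"
        by (simp add: z_def complex_eq_iff)
      then obtain n :: int where "2 * pi * (of_int (m - i) * mesh_h K) = of_int n * 2 * pi"
        using cos_one_2pi_int by auto
      then have "of_int (m - i) * mesh_h K = of_int n"
        by simp
      then have "real_of_int (m - i) = of_int (n * mesh_N K)"
        using mesh_N_pos[of K] by (simp add: mesh_h_def field_simps)
      then have "m - i = n * mesh_N K"
        by linarith
      then have "mesh_N K dvd m - i"
        by simp
      then have "m mod mesh_N K = i mod mesh_N K"
        by (simp add: mod_eq_dvd_iff)
      with assms False show False
        by simp
    qed
    then have "(\<Sum>q<?N. z ^ q) = 0"
      by (simp add: geometric_sum zN)
    with * False show ?thesis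
      by simp
  qed
qed

lemma swap4:
  fixes g :: "'a \<Rightarrow> 'b \<Rightarrow> 'c \<Rightarrow> 'd \<Rightarrow> complex"
  shows "(\<Sum>k\<in>A. \<Sum>l\<in>B. \<Sum>i\<in>C. \<Sum>j\<in>D. g k l i j) =
         (\<Sum>i\<in>C. \<Sum>j\<in>D. \<Sum>k\<in>A. \<Sum>l\<in>B. g k l i j)"
proof -
  have "(\<Sum>k\<in>A. \<Sum>l\<in>B. \<Sum>i\<in>C. \<Sum>j\<in>D. g k l i j) =
        (\<Sum>k\<in>A. \<Sum>i\<in>C. \<Sum>j\<in>D. \<Sum>l\<in>B. g k l i j)"
    by (rule sum.cong[OF refl]) (subst sum.swap, intro sum.cong refl sum.swap)
  also have "\<dots> = (\<Sum>i\<in>C. \<Sum>j\<in>D. \<Sum>k\<in>A. \<Sum>l\<in>B. g k l i j)"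
    by (subst sum.swap) (intro sum.cong refl sum.swap)
  finally show ?thesis .
qed

lemma discrete_expansion:
  assumes "m \<in> {0..<mesh_N K}" "n \<in> {0..<mesh_N K}"
  shows "trigsum K (dft K f) (grid_pt K m n) = of_real (f m n)"
proof -
  let ?A = "{- int K..int K}" and ?I = "{0..<mesh_N K}"
  let ?e = "\<lambda>k d. cis (2 * pi * (of_int k * (of_int d * mesh_h K)))"
  have split: "cnj (fmode k l (grid_pt K i j)) * fmode k l (grid_pt K m n) =
      ?e k (m - i) * ?e l (n - j)" for k l i j
    unfolding fmode_def cis_cnj cis_mult grid_pt_def
    by (intro arg_cong[of _ _ cis]) (simp add: algebra_simps)
  have "trigsum K (dft K f) (grid_pt K m n) =
      (\<Sum>k\<in>?A. \<Sum>l\<in>?A. \<Sum>i\<in>?I. \<Sum>j\<in>?I.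
         of_real ((mesh_h K)\<^sup>2) * of_real (f i j) * (?e k (m - i) * ?e l (n - j)))"
    unfolding trigsum_def dft_def
    by (simp only: sum_distrib_left sum_distrib_right mult.assoc split)
  also have "\<dots> = (\<Sum>i\<in>?I. \<Sum>j\<in>?I. \<Sum>k\<in>?A. \<Sum>l\<in>?A.
         of_real ((mesh_h K)\<^sup>2) * of_real (f i j) * (?e k (m - i) * ?e l (n - j)))"
    by (rule swap4)
  also have "\<dots> = (\<Sum>i\<in>?I. \<Sum>j\<in>?I. of_real ((mesh_h K)\<^sup>2) * of_real (f i j) *
         ((\<Sum>k\<in>?A. ?e k (m - i)) * (\<Sum>l\<in>?A. ?e l (n - j))))"
    by (simp only: sum_product) (simp only: sum_distrib_left)
  also have "\<dots> = (\<Sum>i\<in>?I. \<Sum>j\<in>?I. if i = m then if j = n then of_real (f m n) else 0 else 0)"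
  proof (intro sum.cong refl)
    fix i j
    assume "i \<in> ?I" "j \<in> ?I"
    then have sums: "(\<Sum>k\<in>?A. ?e k (m - i)) = (if m = i then of_int (mesh_N K) else 0)"
      "(\<Sum>l\<in>?A. ?e l (n - j)) = (if n = j then of_int (mesh_N K) else 0)"
      using assms by (simp_all only: sum_cis_symmetric)
    have "complex_of_real (mesh_h K) = 1 / of_int (mesh_N K)" "complex_of_int (mesh_N K) \<noteq> 0"
      using mesh_N_pos[of K] by (auto simp add: mesh_h_def)
    then show "of_real ((mesh_h K)\<^sup>2) * of_real (f i j) *
        ((\<Sum>k\<in>?A. ?e k (m - i)) * (\<Sum>l\<in>?A. ?e l (n - j))) =
        (if i = m then if j = n then complex_of_real (f m n) else 0 else 0)"
      unfolding sums by (simp add: power2_eq_square)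
  qed
  also have "\<dots> = (\<Sum>i\<in>?I. if i = m then (\<Sum>j\<in>?I. if j = n then of_real (f m n) else 0) else 0)"
    by (intro sum.cong refl) auto
  also have "\<dots> = of_real (f m n)"
    using assms by (simp only: sum.delta finite_atLeastLessThan_int if_True)
  finally show ?thesis .
qed

end

theory Submission
  imports Defs
begin

text \<open>The proof is a discrete energy method on two levels. For a grid function \<open>w\<close> write \<open>W\<close>, \<open>Y\<close>, \<open>Z\<close>
for the discrete norms of \<open>w\<close>, its gradient and its Laplacian. By Parseval these are
\<open>\<ell>\<^sup>2\<close> norms of the discrete Fourier coefficients, hence \<open>W\<close> and \<open>Y\<close> are the two norms of the
continuous extension in the theorem (\<open>L2norm_ext\<close>, \<open>L2norm_grad_ext\<close>).

\<^bold>\<open>Nonlinear term.\<close> The skew-symmetric form of \<open>N(w)\<close> gives \<open>\<langle>N(w), w\<rangle> = 0\<close>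
(\<open>nonlinN_orthogonal\<close>), and \<open>\<parallel>N(w)\<parallel>\<^sup>2 \<le> C Y\<^sup>3 W\<close> with \<open>C\<close> independent of the mesh
(\<open>nonlinN_le\<close>). For the latter, a pointwise product of grid functions is a cyclic convolution of
coefficients (\<open>dft_mult\<close>). Folding a frequency back into the resolved range does not increase
its size, so the size of the folded frequency is subadditive, and aliasing does not
damage the product rule. What remains are convolution inequalities whose constants come from the
convergent lattice sum of \<open>|p|\<^sup>-\<^sup>3\<close>.

\<^bold>\<open>Vorticity.\<close> The step is tested with
\<open>3 w\<^sup>n\<^sup>+\<^sup>1 - 2 w\<^sup>n = (2 w\<^sup>n\<^sup>+\<^sup>1 - w\<^sup>n) + (w\<^sup>n\<^sup>+\<^sup>1 - w\<^sup>n)\<close>. The first summand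
produces the stencil energy, the second one a dissipation of the increments. By orthogonality the explicit
term \<open>N(w\<^sup>l)\<close> only sees the test function minus \<open>w\<^sup>l\<close>, a combination of increments; if the gradients are
bounded by \<open>M\<close> and \<open>dt M\<^sup>2\<close> is small compared with \<open>\<nu>\<close>, viscosity and the dissipation of the increments
absorb it (\<open>vorticity_step\<close>). The functional \<open>F_init\<close> then decays geometrically up to a term
from the force, which does not involve \<open>M\<close>.

\<^bold>\<open>Gradient.\<close> The step is tested with minus the Laplacian of \<open>2 w\<^sup>n\<^sup>+\<^sup>1 - w\<^sup>n\<close>. Since
\<open>Y\<^sup>2 \<le> W Z\<close>, the bound \<open>C Y\<^sup>3 W\<close> is of lower order than \<open>Z\<^sup>2\<close> once \<open>W\<close> is bounded, so that viscosity
absorbs the nonlinear term up to a constant (\<open>nonlinN_le_sublinear\<close>, \<open>gradient_step\<close>).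

\<^bold>\<open>Closing the loop.\<close> The vorticity level asks for a gradient bound \<open>M\<close>, while the gradient level asks
for a vorticity bound that does not depend on \<open>M\<close>. Hence a value of \<open>M\<close> computed from the data
reproduces itself in an induction over the time steps (\<open>gradient_bounded\<close>). The data enter
through their \<open>H\<^sup>2\<close> norms: the Fourier coefficients of a weak derivative are the
expected multiples of those of the function, and Bessel's inequality bounds all discrete norms
of the initial grid functions (\<open>grid_norms_le_Hnorm\<close>).\<close>

section \<open>Grid averages and the discrete inner product\<close>

lemma gavg_sum: "gavg K f = (mesh_h K)\<^sup>2 * (\<Sum>i\<in>{0..<mesh_N K}. \<Sum>j\<in>{0..<mesh_N K}. f i j)"
  by (simp add: gavg_def ginner_def)

lemma ginner_gavg: "ginner K f g = gavg K (\<lambda>i j. f i j * g i j)"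
  by (simp add: gavg_sum ginner_def)

lemma gavg_add: "gavg K (\<lambda>i j. f i j + g i j) = gavg K f + gavg K g"
  by (simp add: gavg_sum sum.distrib algebra_simps)

lemma gavg_diff: "gavg K (\<lambda>i j. f i j - g i j) = gavg K f - gavg K g"
  by (simp add: gavg_sum sum_subtractf algebra_simps)

lemma gavg_cmult: "gavg K (\<lambda>i j. c * f i j) = c * gavg K f"
  by (simp add: gavg_sum sum_distrib_left algebra_simps)

lemmas gavg_linear = gavg_add gavg_diff gavg_cmult

lemma gavg_mono:
  assumes "\<And>i j. i \<in> {0..<mesh_N K} \<Longrightarrow> j \<in> {0..<mesh_N K} \<Longrightarrow> f i j \<le> g i j"
  shows "gavg K f \<le> gavg K g"
  using assms
  unfolding gavg_sum by (intro mult_left_mono sum_mono) auto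

lemma gavg_const: "gavg K (\<lambda>i j. c) = c"
  using mesh_N_pos[of K] by (simp add: gavg_sum mesh_h_def field_simps power2_eq_square)

lemma gnorm_sq: "(gnorm K f)\<^sup>2 = gavg K (\<lambda>i j. (f i j)\<^sup>2)"
proof -
  have "0 \<le> gavg K (\<lambda>i j. (f i j)\<^sup>2)"
    using gavg_mono[of K "\<lambda>i j. 0" "\<lambda>i j. (f i j)\<^sup>2"] by (simp add: gavg_const)
  then show ?thesis
    by (simp add: gnorm_def ginner_gavg power2_eq_square)
qed

lemma gnorm_nonneg: "0 \<le> gnorm K f"
proof -
  have "0 \<le> ginner K f f"
    using gavg_mono[of K "\<lambda>i j. 0" "\<lambda>i j. f i j * f i j"] by (simp add: gavg_const ginner_gavg)
  then show ?thesis
    by (simp add: gnorm_def)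
qed

lemma ginner_self: "ginner K f f = (gnorm K f)\<^sup>2"
  unfolding gnorm_sq ginner_gavg by (simp add: power2_eq_square)

lemma vgnorm_sq: "(vgnorm K v)\<^sup>2 = (gnorm K (fst v))\<^sup>2 + (gnorm K (snd v))\<^sup>2"
  by (simp add: vgnorm_def ginner_self)

lemma vgnorm_nonneg: "0 \<le> vgnorm K v"
  by (simp add: vgnorm_def ginner_self)

lemma ginner_commute: "ginner K f g = ginner K g f"
  by (simp add: ginner_gavg mult.commute)

lemma ginner_le: "\<bar>ginner K f g\<bar> \<le> gnorm K f * gnorm K g"
proof -
  let ?I = "{0..<mesh_N K} \<times> {0..<mesh_N K}"
  have S: "gavg K f = (mesh_h K)\<^sup>2 * (\<Sum>p\<in>?I. f (fst p) (snd p))" for f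
    by (simp add: gavg_sum sum.cartesian_product case_prod_unfold)
  have "(ginner K f g)\<^sup>2 = (mesh_h K)^4 * (\<Sum>p\<in>?I. f (fst p) (snd p) * g (fst p) (snd p))\<^sup>2"
    by (simp add: ginner_gavg S power_mult_distrib flip: power_mult)
  also have "\<dots> \<le> (mesh_h K)^4 * ((\<Sum>p\<in>?I. (f (fst p) (snd p))\<^sup>2) * (\<Sum>p\<in>?I. (g (fst p) (snd p))\<^sup>2))"
    by (intro mult_left_mono Cauchy_Schwarz_ineq_sum) auto
  also have "\<dots> = (gnorm K f * gnorm K g)\<^sup>2"
    unfolding power_mult_distrib gnorm_sq S by (simp add: power2_eq_square power4_eq_xxxx)
  finally have "\<bar>ginner K f g\<bar>\<^sup>2 \<le> (gnorm K f * gnorm K g)\<^sup>2"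
    by simp
  then show ?thesis
    by (rule power2_le_imp_le) (simp add: gnorm_nonneg)
qed

lemma gnorm_cmult: "gnorm K (\<lambda>i j. c * f i j) = \<bar>c\<bar> * gnorm K f"
proof -
  have "(gnorm K (\<lambda>i j. c * f i j))\<^sup>2 = (\<bar>c\<bar> * gnorm K f)\<^sup>2"
    by (simp add: gnorm_sq power_mult_distrib gavg_cmult)
  then show ?thesis
    using gnorm_nonneg by (simp add: power2_eq_iff_nonneg)
qed

lemma gnorm_add_le: "gnorm K (\<lambda>i j. f i j + g i j) \<le> gnorm K f + gnorm K g"
proof -
  have "(gnorm K (\<lambda>i j. f i j + g i j))\<^sup>2 = (gnorm K f)\<^sup>2 + 2 * ginner K f g + (gnorm K g)\<^sup>2"
    by (simp add: gnorm_sq ginner_gavg power2_sum gavg_linear mult.assoc)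
  also have "\<dots> \<le> (gnorm K f + gnorm K g)\<^sup>2"
    using ginner_le[of K f g] by (simp add: power2_sum)
  finally show ?thesis
    by (rule power2_le_imp_le) (simp add: gnorm_nonneg)
qed

lemma gnorm_diff_le: "gnorm K (\<lambda>i j. f i j - g i j) \<le> gnorm K f + gnorm K g"
  using gnorm_add_le[of K f "\<lambda>i j. -1 * g i j"] by (simp only: gnorm_cmult) simp

lemma gavg_le_gnorm: "\<bar>gavg K f\<bar> \<le> gnorm K f"
proof -
  have "gnorm K (\<lambda>i j. 1) = 1"
    using gnorm_sq[of K "\<lambda>i j. 1"] gnorm_nonneg[of K "\<lambda>i j. 1"]
    by (simp add: gavg_const power2_eq_1_iff)
  then show ?thesis
    using ginner_le[of K f "\<lambda>i j. 1"] by (simp add: gavg_def)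
qed

section \<open>The discrete Fourier transform\<close>

abbreviation freqs :: "nat \<Rightarrow> int set" where
  "freqs K \<equiv> {- int K..int K}"

text \<open>The lemma \<open>sum_cis_symmetric\<close> sums over frequencies; orthogonality on the grid needs the sum over grid
points instead. The shift by \<open>K\<close> turns one into the other at the price of a unimodular factor.\<close>

lemma sum_cis_grid:
  assumes "k \<in> freqs K" "k' \<in> freqs K"
  shows "(\<Sum>i\<in>{0..<mesh_N K}. cis (2 * pi * (of_int (k - k') * (of_int i * mesh_h K)))) =
    (if k = k' then of_int (mesh_N K) else 0)"
proof -
  have "(\<Sum>i\<in>{0..<mesh_N K}. cis (2 * pi * (of_int (k - k') * (of_int i * mesh_h K)))) =
    (\<Sum>q\<in>freqs K. cis (2 * pi * (of_int (k - k') * (of_int (q + int K) * mesh_h K))))"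
    by (rule sum.reindex_bij_witness[of _ "\<lambda>q. q + int K" "\<lambda>i. i - int K"]) (auto simp: mesh_N_def)
  also have "\<dots> = (\<Sum>q\<in>freqs K. cis (2 * pi * (of_int (k - k') * (of_int (int K) * mesh_h K))) *
      cis (2 * pi * (of_int q * (of_int ((k + int K) - (k' + int K)) * mesh_h K))))"
    unfolding cis_mult by (intro sum.cong refl arg_cong[of _ _ cis]) (simp add: algebra_simps)
  also have "\<dots> = cis (2 * pi * (of_int (k - k') * (of_int (int K) * mesh_h K))) *
      (if k + int K = k' + int K then of_int (mesh_N K) else 0)"
    unfolding sum_distrib_left[symmetric]
    by (subst sum_cis_symmetric) (use assms in \<open>auto simp: mesh_N_def\<close>)
  also have "\<dots> = (if k = k' then of_int (mesh_N K) else 0)"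
    by simp
  finally show ?thesis .
qed

lemma fmode_grid_orthonormal:
  assumes "k \<in> freqs K" "k' \<in> freqs K" "l \<in> freqs K" "l' \<in> freqs K"
  shows "of_real ((mesh_h K)\<^sup>2) * (\<Sum>i\<in>{0..<mesh_N K}. \<Sum>j\<in>{0..<mesh_N K}.
      fmode k l (grid_pt K i j) * cnj (fmode k' l' (grid_pt K i j))) =
    (if k = k' \<and> l = l' then 1 else 0)"
proof -
  have "fmode k l (grid_pt K i j) * cnj (fmode k' l' (grid_pt K i j)) =
      cis (2 * pi * (of_int (k - k') * (of_int i * mesh_h K))) *
      cis (2 * pi * (of_int (l - l') * (of_int j * mesh_h K)))" for i j
    unfolding fmode_def cis_cnj cis_mult grid_pt_def
    by (intro arg_cong[of _ _ cis]) (simp add: algebra_simps)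
  then have "(\<Sum>i\<in>{0..<mesh_N K}. \<Sum>j\<in>{0..<mesh_N K}.
      fmode k l (grid_pt K i j) * cnj (fmode k' l' (grid_pt K i j))) =
    (if k = k' then of_int (mesh_N K) else 0) * (if l = l' then of_int (mesh_N K) else 0)"
    by (simp only: sum_product[symmetric] sum_cis_grid assms)
  then show ?thesis
    using mesh_N_pos[of K] by (auto simp: mesh_h_def power2_eq_square)
qed

text \<open>A trigonometric polynomial within the resolved range is recovered exactly from its grid values. Hence the
Fourier derivatives act on the coefficients as multipliers.\<close>

lemma dft_trigsum:
  assumes "\<And>i j. of_real (g i j) = trigsum K c (grid_pt K i j)"
    and "k \<in> freqs K" "l \<in> freqs K"
  shows "dft K g k l = c k l"
proof -
  let ?I = "{0..<mesh_N K}"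
  have "dft K g k l = (\<Sum>i\<in>?I. \<Sum>j\<in>?I. \<Sum>p\<in>freqs K. \<Sum>q\<in>freqs K. of_real ((mesh_h K)\<^sup>2) *
      (c p q * (fmode p q (grid_pt K i j) * cnj (fmode k l (grid_pt K i j)))))"
    unfolding dft_def assms(1) trigsum_def by (simp add: sum_distrib_left sum_distrib_right mult_ac)
  also have "\<dots> = (\<Sum>p\<in>freqs K. \<Sum>q\<in>freqs K. \<Sum>i\<in>?I. \<Sum>j\<in>?I. of_real ((mesh_h K)\<^sup>2) *
      (c p q * (fmode p q (grid_pt K i j) * cnj (fmode k l (grid_pt K i j)))))"
    by (rule swap4)
  also have "\<dots> = (\<Sum>p\<in>freqs K. \<Sum>q\<in>freqs K. c p q * (of_real ((mesh_h K)\<^sup>2) * (\<Sum>i\<in>?I. \<Sum>j\<in>?I.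
      fmode p q (grid_pt K i j) * cnj (fmode k l (grid_pt K i j)))))"
    by (simp add: sum_distrib_left mult_ac)
  also have "\<dots> = (\<Sum>p\<in>freqs K. \<Sum>q\<in>freqs K. c p q * (if p = k \<and> q = l then 1 else 0))"
    by (intro sum.cong refl arg_cong2[of _ _ _ _ "(*)"] fmode_grid_orthonormal) (use assms in auto)
  also have "\<dots> = (\<Sum>p\<in>freqs K. \<Sum>q\<in>freqs K. if p = k then if q = l then c k l else 0 else 0)"
    by (intro sum.cong refl) auto
  also have "\<dots> = (\<Sum>p\<in>freqs K. if p = k then (\<Sum>q\<in>freqs K. if q = l then c k l else 0) else 0)"
    by (intro sum.cong refl) auto
  also have "\<dots> = c k l"
    using assms by (simp only: sum.delta finite_atLeastAtMost_int if_True)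
  finally show ?thesis .
qed

lemma dft_DNx:
  "k \<in> freqs K \<Longrightarrow> l \<in> freqs K \<Longrightarrow> dft K (DNx K f) k l = 2 * pi * \<i> * of_int k * dft K f k l"
  by (subst dft_trigsum[OF DNx_complex]) auto

lemma dft_DNy:
  "k \<in> freqs K \<Longrightarrow> l \<in> freqs K \<Longrightarrow> dft K (DNy K f) k l = 2 * pi * \<i> * of_int l * dft K f k l"
  by (subst dft_trigsum[OF DNy_complex]) auto

lemma dft_add: "dft K (\<lambda>i j. f i j + g i j) k l = dft K f k l + dft K g k l"
  by (simp add: dft_def sum.distrib algebra_simps)

lemma dft_cmult: "dft K (\<lambda>i j. c * f i j) k l = of_real c * dft K f k l"
  by (simp add: dft_def sum_distrib_left algebra_simps)

lemma dft_uminus_grid: "dft K (\<lambda>i j. - f i j) k l = - dft K f k l"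
  by (simp add: dft_def sum_negf)

lemma trigsum_add: "trigsum K (\<lambda>k l. c k l + d k l) p = trigsum K c p + trigsum K d p"
  by (simp add: trigsum_def sum.distrib algebra_simps)

lemma trigsum_cmult: "trigsum K (\<lambda>k l. a * c k l) p = a * trigsum K c p"
  by (simp add: trigsum_def sum_distrib_left mult.assoc)

lemma DNx_add: "DNx K (\<lambda>i j. f i j + g i j) i j = DNx K f i j + DNx K g i j"
  by (simp add: DNx_def dft_add distrib_left trigsum_add)

lemma DNy_add: "DNy K (\<lambda>i j. f i j + g i j) i j = DNy K f i j + DNy K g i j"
  by (simp add: DNy_def dft_add distrib_left trigsum_add)

lemma DNx_cmult: "DNx K (\<lambda>i j. c * f i j) i j = c * DNx K f i j"
proof -
  have "trigsum K (\<lambda>k l. 2 * pi * \<i> * of_int k * dft K (\<lambda>i j. c * f i j) k l) (grid_pt K i j) =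
    of_real c * trigsum K (\<lambda>k l. 2 * pi * \<i> * of_int k * dft K f k l) (grid_pt K i j)"
    unfolding trigsum_cmult[symmetric] dft_cmult by (simp add: mult_ac)
  then show ?thesis
    by (simp add: DNx_def)
qed

lemma DNy_cmult: "DNy K (\<lambda>i j. c * f i j) i j = c * DNy K f i j"
proof -
  have "trigsum K (\<lambda>k l. 2 * pi * \<i> * of_int l * dft K (\<lambda>i j. c * f i j) k l) (grid_pt K i j) =
    of_real c * trigsum K (\<lambda>k l. 2 * pi * \<i> * of_int l * dft K f k l) (grid_pt K i j)"
    unfolding trigsum_cmult[symmetric] dft_cmult by (simp add: mult_ac)
  then show ?thesis
    by (simp add: DNy_def)
qed

lemma DNx_diff: "DNx K (\<lambda>i j. f i j - g i j) i j = DNx K f i j - DNx K g i j"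
  using DNx_add[of K f "\<lambda>i j. -1 * g i j" i j] by (simp only: DNx_cmult) simp

lemma DNy_diff: "DNy K (\<lambda>i j. f i j - g i j) i j = DNy K f i j - DNy K g i j"
  using DNy_add[of K f "\<lambda>i j. -1 * g i j" i j] by (simp only: DNy_cmult) simp

lemmas DN_linear = DNx_add DNy_add DNx_diff DNy_diff DNx_cmult DNy_cmult

theorem ginner_parseval:
  "complex_of_real (ginner K f g) = (\<Sum>k\<in>freqs K. \<Sum>l\<in>freqs K. dft K f k l * cnj (dft K g k l))"
proof -
  let ?I = "{0..<mesh_N K}"
  have "complex_of_real (ginner K f g) =
      of_real ((mesh_h K)\<^sup>2) * (\<Sum>i\<in>?I. \<Sum>j\<in>?I. trigsum K (dft K f) (grid_pt K i j) * of_real (g i j))"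
    unfolding ginner_def by (simp add: discrete_expansion)
  also have "\<dots> = (\<Sum>i\<in>?I. \<Sum>j\<in>?I. \<Sum>k\<in>freqs K. \<Sum>l\<in>freqs K.
      dft K f k l * (of_real ((mesh_h K)\<^sup>2) * (of_real (g i j) * fmode k l (grid_pt K i j))))"
    unfolding trigsum_def by (simp add: sum_distrib_left sum_distrib_right mult_ac)
  also have "\<dots> = (\<Sum>k\<in>freqs K. \<Sum>l\<in>freqs K. \<Sum>i\<in>?I. \<Sum>j\<in>?I.
      dft K f k l * (of_real ((mesh_h K)\<^sup>2) * (of_real (g i j) * fmode k l (grid_pt K i j))))"
    by (rule swap4[symmetric])
  also have "\<dots> = (\<Sum>k\<in>freqs K. \<Sum>l\<in>freqs K. dft K f k l * cnj (dft K g k l))"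
    by (simp add: dft_def[of K g] sum_distrib_left mult_ac)
  finally show ?thesis .
qed

corollary gnorm_parseval:
  "(gnorm K f)\<^sup>2 = (\<Sum>k\<in>freqs K. \<Sum>l\<in>freqs K. (cmod (dft K f k l))\<^sup>2)"
proof -
  have "complex_of_real ((gnorm K f)\<^sup>2) =
      of_real (\<Sum>k\<in>freqs K. \<Sum>l\<in>freqs K. (cmod (dft K f k l))\<^sup>2)"
    unfolding ginner_self[symmetric] ginner_parseval by (simp only: of_real_sum complex_norm_square)
  then show ?thesis
    by (simp only: of_real_eq_iff)
qed

lemma gavg_dft: "complex_of_real (gavg K f) = dft K f 0 0"
  by (simp add: gavg_sum dft_def fmode_def)

lemma ginner_DNx: "ginner K (DNx K f) g = - ginner K f (DNx K g)"
proof -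
  have "complex_of_real (ginner K (DNx K f) g) = - of_real (ginner K f (DNx K g))"
    unfolding ginner_parseval sum_negf[symmetric] by (intro sum.cong refl) (simp add: dft_DNx)
  then show ?thesis
    by (metis of_real_eq_iff of_real_minus)
qed

lemma ginner_DNy: "ginner K (DNy K f) g = - ginner K f (DNy K g)"
proof -
  have "complex_of_real (ginner K (DNy K f) g) = - of_real (ginner K f (DNy K g))"
    unfolding ginner_parseval sum_negf[symmetric] by (intro sum.cong refl) (simp add: dft_DNy)
  then show ?thesis
    by (metis of_real_eq_iff of_real_minus)
qed

lemma ginner_add_left: "ginner K (\<lambda>i j. f i j + g i j) h = ginner K f h + ginner K g h"
  by (simp add: ginner_gavg distrib_right gavg_linear)

section \<open>The discrete Laplacian and Poincare inequalities\<close>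

lemma ginner_lapN:
  "ginner K (lapN K f) g = - (ginner K (DNx K f) (DNx K g) + ginner K (DNy K f) (DNy K g))"
  by (simp add: lapN_def ginner_add_left ginner_DNx ginner_DNy)

lemma dft_lapN:
  assumes "k \<in> freqs K" "l \<in> freqs K"
  shows "dft K (lapN K f) k l = - of_real (4 * pi\<^sup>2 * ((of_int k)\<^sup>2 + (of_int l)\<^sup>2)) * dft K f k l"
proof -
  have "dft K (lapN K f) k l = (2 * pi * \<i> * of_int k)\<^sup>2 * dft K f k l + (2 * pi * \<i> * of_int l)\<^sup>2 * dft K f k l"
    using assms by (simp add: lapN_def dft_add dft_DNx dft_DNy power2_eq_square mult_ac)
  then show ?thesis
    by (simp add: power_mult_distrib algebra_simps)
qed

lemma grad_parseval:
  "(vgnorm K (gradN K f))\<^sup>2 =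
    (\<Sum>k\<in>freqs K. \<Sum>l\<in>freqs K. 4 * pi\<^sup>2 * ((of_int k)\<^sup>2 + (of_int l)\<^sup>2) * (cmod (dft K f k l))\<^sup>2)"
  unfolding vgnorm_sq gradN_def fst_conv snd_conv gnorm_parseval sum.distrib[symmetric]
  by (intro sum.cong refl) (simp add: dft_DNx dft_DNy norm_mult power_mult_distrib algebra_simps)

lemma lap_parseval:
  "(gnorm K (lapN K f))\<^sup>2 =
    (\<Sum>k\<in>freqs K. \<Sum>l\<in>freqs K. (4 * pi\<^sup>2 * ((of_int k)\<^sup>2 + (of_int l)\<^sup>2))\<^sup>2 * (cmod (dft K f k l))\<^sup>2)"
  unfolding gnorm_parseval
  by (intro sum.cong refl) (simp only: dft_lapN norm_mult norm_minus_cancel norm_of_real power_mult_distrib power2_abs)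

text \<open>This exchange of one derivative is what makes the nonlinear term subcritical at the gradient level.\<close>

lemma grad_interpolation: "(vgnorm K (gradN K f))\<^sup>2 \<le> gnorm K f * gnorm K (lapN K f)"
proof -
  have "(vgnorm K (gradN K f))\<^sup>2 = - ginner K (lapN K f) f"
    by (simp add: ginner_lapN vgnorm_sq gradN_def ginner_self)
  then show ?thesis
    using ginner_le[of K "lapN K f" f] by (simp add: mult.commute)
qed

lemma int_sq_sum_ge_1: "k \<noteq> 0 \<or> l \<noteq> 0 \<Longrightarrow> (of_int k)\<^sup>2 + (of_int l)\<^sup>2 \<ge> (1::real)"
proof -
  assume "k \<noteq> 0 \<or> l \<noteq> 0"
  then have "k\<^sup>2 + l\<^sup>2 > 0"
    by (simp add: sum_power2_gt_zero_iff)
  then have "real_of_int (k\<^sup>2 + l\<^sup>2) \<ge> 1"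
    by linarith
  then show ?thesis
    by simp
qed

lemma gnorm_poincare:
  assumes "gavg K f = 0"
  shows "4 * pi\<^sup>2 * (gnorm K f)\<^sup>2 \<le> (vgnorm K (gradN K f))\<^sup>2"
  unfolding gnorm_parseval grad_parseval sum_distrib_left
proof (intro sum_mono)
  fix k l
  show "4 * pi\<^sup>2 * (cmod (dft K f k l))\<^sup>2
      \<le> 4 * pi\<^sup>2 * ((of_int k)\<^sup>2 + (of_int l)\<^sup>2) * (cmod (dft K f k l))\<^sup>2"
  proof (cases "k = 0 \<and> l = 0")
    case True
    then show ?thesis
      using gavg_dft[of K f] assms by simp
  next
    case False
    then show ?thesis
      using int_sq_sum_ge_1[of k l] by (intro mult_right_mono) auto
  qed
qed

lemma grad_poincare: "4 * pi\<^sup>2 * (vgnorm K (gradN K f))\<^sup>2 \<le> (gnorm K (lapN K f))\<^sup>2"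
  unfolding grad_parseval lap_parseval sum_distrib_left
proof (intro sum_mono)
  fix k l
  have "(of_int k)\<^sup>2 + (of_int l)\<^sup>2 \<le> ((of_int k)\<^sup>2 + (of_int l)\<^sup>2 :: real)\<^sup>2" for k l :: int
  proof (cases "k = 0 \<and> l = 0")
    case False
    then show ?thesis
      using int_sq_sum_ge_1[of k l] by (intro self_le_power) auto
  qed auto
  then have "4 * pi\<^sup>2 * (4 * pi\<^sup>2 * ((of_int k)\<^sup>2 + (of_int l)\<^sup>2)) \<le> (4 * pi\<^sup>2 * ((of_int k)\<^sup>2 + (of_int l)\<^sup>2))\<^sup>2"
    by (simp add: power_mult_distrib power2_eq_square)
  then have "4 * pi\<^sup>2 * (4 * pi\<^sup>2 * ((of_int k)\<^sup>2 + (of_int l)\<^sup>2)) * (cmod (dft K f k l))\<^sup>2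
      \<le> (4 * pi\<^sup>2 * ((of_int k)\<^sup>2 + (of_int l)\<^sup>2))\<^sup>2 * (cmod (dft K f k l))\<^sup>2"
    by (rule mult_right_mono) simp
  then show "4 * pi\<^sup>2 * (4 * pi\<^sup>2 * ((of_int k)\<^sup>2 + (of_int l)\<^sup>2) * (cmod (dft K f k l))\<^sup>2)
      \<le> (4 * pi\<^sup>2 * ((of_int k)\<^sup>2 + (of_int l)\<^sup>2))\<^sup>2 * (cmod (dft K f k l))\<^sup>2"
    by (simp only: mult.assoc)
qed

section \<open>Products of grid functions and the size of the nonlinear term\<close>

text \<open>Coefficients of products involve frequencies outside the resolved range; on the grid such a frequency
is indistinguishable from its representative in \<open>{- K..K}\<close> modulo \<open>N\<close>.\<close>

definition wrap :: "nat \<Rightarrow> int \<Rightarrow> int" where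
  "wrap K k = (k + int K) mod mesh_N K - int K"

lemma wrap_freqs: "wrap K k \<in> freqs K"
  using mesh_N_pos[of K] pos_mod_bound[of "mesh_N K" "k + int K"] pos_mod_sign[of "mesh_N K" "k + int K"]
  by (simp add: wrap_def mesh_N_def)

lemma wrap_ident: "k \<in> freqs K \<Longrightarrow> wrap K k = k"
  by (simp add: wrap_def mesh_N_def)

lemma wrap_eqI: "k mod mesh_N K = l mod mesh_N K \<Longrightarrow> wrap K k = wrap K l"
  unfolding wrap_def by (metis mod_add_left_eq)

lemma wrap_mod: "wrap K k mod mesh_N K = k mod mesh_N K"
  unfolding wrap_def by (simp add: mod_diff_left_eq)

lemma wrap_wrap_add: "wrap K (wrap K k + wrap K l) = wrap K (k + l)"
  by (rule wrap_eqI) (metis wrap_mod mod_add_eq)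

lemma wrap_add_left: "wrap K (wrap K k + l) = wrap K (k + l)"
  by (rule wrap_eqI) (metis wrap_mod mod_add_left_eq)

lemma wrap_diff_right: "wrap K (l - wrap K k) = wrap K (l - k)"
  by (rule wrap_eqI) (metis wrap_mod mod_diff_right_eq)

text \<open>The representative in \<open>{- K..K}\<close> is the residue of least absolute value. This is the reason why aliasing
cannot create large frequencies.\<close>

lemma wrap_abs_le: "\<bar>wrap K k\<bar> \<le> \<bar>k\<bar>"
proof (cases "k \<in> freqs K")
  case True
  then show ?thesis
    by (simp add: wrap_ident)
next
  case False
  then show ?thesis
    using wrap_freqs[of K k] by auto
qed

lemma wrap_abs_triangle: "\<bar>wrap K (k + l)\<bar> \<le> \<bar>wrap K k\<bar> + \<bar>wrap K l\<bar>"
  using wrap_abs_le[of K "wrap K k + wrap K l"] by (simp add: wrap_wrap_add)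

definition wrap2 :: "nat \<Rightarrow> int \<times> int \<Rightarrow> int \<times> int" where
  "wrap2 K p = (wrap K (fst p), wrap K (snd p))"

text \<open>The Euclidean length of the folded frequency, so that it is \<open>N\<close>-periodic like the coefficients themselves.\<close>

definition freq_norm :: "nat \<Rightarrow> int \<times> int \<Rightarrow> real" where
  "freq_norm K p = sqrt ((of_int (wrap K (fst p)))\<^sup>2 + (of_int (wrap K (snd p)))\<^sup>2)"

abbreviation freqs2 :: "nat \<Rightarrow> (int \<times> int) set" where
  "freqs2 K \<equiv> freqs K \<times> freqs K"

lemma wrap2_freqs: "wrap2 K p \<in> freqs2 K"
  by (simp add: wrap2_def wrap_freqs del: atLeastAtMost_iff)

lemma freq_norm_wrap2: "freq_norm K (wrap2 K p) = freq_norm K p"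
  by (simp add: freq_norm_def wrap2_def wrap_ident[OF wrap_freqs])

lemma freq_norm_nonneg: "0 \<le> freq_norm K p"
  by (simp add: freq_norm_def)

lemma freq_norm_triangle: "freq_norm K (p + q) \<le> freq_norm K p + freq_norm K q"
proof -
  let ?x = "\<lambda>p. real_of_int \<bar>wrap K (fst p)\<bar>" and ?y = "\<lambda>p. real_of_int \<bar>wrap K (snd p)\<bar>"
  have lam: "freq_norm K p = sqrt ((?x p)\<^sup>2 + (?y p)\<^sup>2)" for p
    by (simp add: freq_norm_def)
  have "?x (p + q) \<le> ?x p + ?x q" "?y (p + q) \<le> ?y p + ?y q"
    using wrap_abs_triangle[of K "fst p" "fst q"] wrap_abs_triangle[of K "snd p" "snd q"]
    unfolding of_int_add[symmetric] of_int_le_iff by simp_all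
  then have "freq_norm K (p + q) \<le> sqrt ((?x p + ?x q)\<^sup>2 + (?y p + ?y q)\<^sup>2)"
    unfolding lam by (intro real_sqrt_le_mono add_mono power_mono) auto
  also have "\<dots> \<le> freq_norm K p + freq_norm K q"
    unfolding lam by (rule real_sqrt_sum_squares_triangle_ineq)
  finally show ?thesis .
qed

lemma wrap2_add_diff: "k \<in> freqs2 K \<Longrightarrow> wrap2 K (wrap2 K (k - p) + p) = k"
  by (cases k; cases p) (auto simp: wrap2_def wrap_add_left wrap_ident)

lemma wrap2_diff_add: "k \<in> freqs2 K \<Longrightarrow> wrap2 K (wrap2 K (k + p) - p) = k"
  using wrap2_add_diff[of k K "- p"] by simp

lemma wrap2_diff_diff: "k \<in> freqs2 K \<Longrightarrow> wrap2 K (p - wrap2 K (p - k)) = k"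
  by (cases k; cases p) (auto simp: wrap2_def wrap_diff_right wrap_ident)

lemma sum_freqs_shift:
  assumes "\<And>k. c (wrap2 K k) = c k"
  shows "(\<Sum>k\<in>freqs2 K. c (k - p)) = (\<Sum>k\<in>freqs2 K. c k)"
  by (rule sum.reindex_bij_witness[of _ "\<lambda>k. wrap2 K (k + p)" "\<lambda>k. wrap2 K (k - p)"])
    (simp_all add: wrap2_freqs wrap2_add_diff wrap2_diff_add assms del: mem_Sigma_iff)

lemma sum_freqs_reflect:
  assumes "\<And>k. c (wrap2 K k) = c k"
  shows "(\<Sum>k\<in>freqs2 K. c (p - k)) = (\<Sum>k\<in>freqs2 K. c k)"
  by (rule sum.reindex_bij_witness[of _ "\<lambda>k. wrap2 K (p - k)" "\<lambda>k. wrap2 K (p - k)"])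
    (simp_all add: wrap2_freqs wrap2_diff_diff assms del: mem_Sigma_iff)

lemma sum_freqs_le:
  "(\<Sum>k\<in>freqs K. (max 1 \<bar>of_int k\<bar>) powr (-3/2)) \<le> 1 + 2 * (\<Sum>n. real n powr (-3/2))"
proof -
  have "(\<Sum>k\<in>freqs K. (max 1 \<bar>of_int k\<bar>) powr (-3/2)) = 1 + 2 * (\<Sum>n\<in>{1..K}. real n powr (-3/2))"
  proof (induction K)
    case (Suc K)
    have "freqs (Suc K) = insert (int K + 1) (insert (- int K - 1) (freqs K))"
      by auto
    then show ?case
      using Suc by (simp add: add.commute)
  qed simp
  moreover have "(\<Sum>n\<in>{1..K}. real n powr (-3/2)) \<le> (\<Sum>n. real n powr (-3/2))"
    by (intro sum_le_suminf) (auto simp: summable_real_powr_iff)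
  ultimately show ?thesis
    by simp
qed

text \<open>Splitting the cube as \<open>3/2 + 3/2\<close> reduces the lattice sum to the square of a one-dimensional
convergent series. At \<open>p = 0\<close> the left side is \<open>1 / 0 = 0\<close>, so the zero frequency may stay in
all sums.\<close>

lemma inverse_freq_norm_cube_le:
  assumes "p \<in> freqs2 K"
  shows "1 / freq_norm K p ^ 3 \<le>
    (max 1 \<bar>of_int (fst p)\<bar>) powr (-3/2) * (max 1 \<bar>of_int (snd p)\<bar>) powr (-3/2)"
proof (cases "p = (0, 0)")
  case True
  then show ?thesis
    by (simp add: freq_norm_def wrap_ident)
next
  case False
  obtain k l where p: "p = (k, l)"
    by (cases p)
  have lam: "freq_norm K p = sqrt ((of_int k)\<^sup>2 + (of_int l)\<^sup>2)"
    using assms by (simp add: freq_norm_def p wrap_ident)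
  have "1 \<le> freq_norm K p"
    unfolding lam using int_sq_sum_ge_1[of k l] False p by auto
  then have m: "max 1 \<bar>of_int k\<bar> \<le> freq_norm K p" "max 1 \<bar>of_int l\<bar> \<le> freq_norm K p"
    unfolding lam using real_sqrt_sum_squares_ge1[of "of_int k"] by (auto intro!: real_le_rsqrt)
  have "1 / freq_norm K p ^ 3 = freq_norm K p powr (-3/2) * freq_norm K p powr (-3/2)"
    using \<open>1 \<le> freq_norm K p\<close> by (simp add: powr_add[symmetric] powr_minus_divide powr_numeral)
  also have "\<dots> \<le> (max 1 \<bar>of_int k\<bar>) powr (-3/2) * (max 1 \<bar>of_int l\<bar>) powr (-3/2)"
    using m by (intro mult_mono powr_mono2') auto
  finally show ?thesis
    by (simp add: p)
qed

definition lattice_const :: real where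
  "lattice_const = (1 + 2 * (\<Sum>n. real n powr (-3/2)))\<^sup>2"

lemma sum_inverse_freq_norm_cube: "(\<Sum>p\<in>freqs2 K. 1 / freq_norm K p ^ 3) \<le> lattice_const"
proof -
  let ?g = "\<lambda>k :: int. (max 1 \<bar>real_of_int k\<bar>) powr (-3/2)"
  have "(\<Sum>p\<in>freqs2 K. 1 / freq_norm K p ^ 3) \<le> (\<Sum>p\<in>freqs2 K. ?g (fst p) * ?g (snd p))"
    by (intro sum_mono inverse_freq_norm_cube_le)
  also have "\<dots> = (\<Sum>k\<in>freqs K. ?g k)\<^sup>2"
    by (simp add: power2_eq_square sum_product sum.cartesian_product case_prod_unfold)
  also have "\<dots> \<le> lattice_const"
    unfolding lattice_const_def using sum_freqs_le by (intro power_mono sum_nonneg) auto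
  finally show ?thesis .
qed

lemma lattice_const_pos: "lattice_const > 0"
proof -
  have "(\<Sum>n. real n powr (-3/2)) \<ge> 0"
    by (intro suminf_nonneg) (auto simp: summable_real_powr_iff)
  then show ?thesis
    by (simp add: lattice_const_def)
qed

text \<open>Young's inequality for a convolution of \<open>\<ell>\<^sup>1\<close> with \<open>\<ell>\<^sup>2\<close>, by the Cauchy-Schwarz inequality with weight \<open>a\<close>.\<close>

lemma conv_l1_l2:
  fixes a c :: "int \<times> int \<Rightarrow> real"
  assumes a: "\<And>p. a p \<ge> 0" and c: "\<And>p. c (wrap2 K p) = c p"
  shows "(\<Sum>k\<in>freqs2 K. (\<Sum>p\<in>freqs2 K. a p * c (k - p))\<^sup>2)
    \<le> (\<Sum>p\<in>freqs2 K. a p)\<^sup>2 * (\<Sum>p\<in>freqs2 K. (c p)\<^sup>2)"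
proof -
  let ?Z = "freqs2 K"
  have "(\<Sum>k\<in>?Z. (\<Sum>p\<in>?Z. a p * c (k - p))\<^sup>2)
      = (\<Sum>k\<in>?Z. (\<Sum>p\<in>?Z. sqrt (a p) * (sqrt (a p) * c (k - p)))\<^sup>2)"
    using a by (simp flip: mult.assoc)
  also have "\<dots> \<le> (\<Sum>k\<in>?Z. (\<Sum>p\<in>?Z. (sqrt (a p))\<^sup>2) * (\<Sum>p\<in>?Z. (sqrt (a p) * c (k - p))\<^sup>2))"
    by (intro sum_mono Cauchy_Schwarz_ineq_sum)
  also have "\<dots> = (\<Sum>p\<in>?Z. a p) * (\<Sum>k\<in>?Z. \<Sum>p\<in>?Z. a p * (c (k - p))\<^sup>2)"
    using a by (simp add: power_mult_distrib sum_distrib_left)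
  also have "(\<Sum>k\<in>?Z. \<Sum>p\<in>?Z. a p * (c (k - p))\<^sup>2) = (\<Sum>p\<in>?Z. a p * (\<Sum>k\<in>?Z. (c (k - p))\<^sup>2))"
    by (subst sum.swap) (simp add: sum_distrib_left)
  also have "\<dots> = (\<Sum>p\<in>?Z. a p) * (\<Sum>p\<in>?Z. (c p)\<^sup>2)"
    using sum_freqs_shift[of "\<lambda>p. (c p)\<^sup>2"] c by (simp add: sum_distrib_right)
  finally show ?thesis
    by (simp add: power2_eq_square mult.assoc)
qed

text \<open>A discrete counterpart of the embedding of \<open>H\<^sup>1\<close> and \<open>H\<^sup>1\<^sup>/\<^sup>2\<close> into spaces whose product lies in \<open>L\<^sup>2\<close>. The
Cauchy-Schwarz inequality leaves the weight \<open>1 / (|p|\<^sup>2 |k - p|)\<close>, whose sum over \<open>p\<close> is bounded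
uniformly in \<open>k\<close> by twice the lattice sum of \<open>|p|\<^sup>-\<^sup>3\<close>.\<close>

lemma conv_weighted:
  fixes b :: "int \<times> int \<Rightarrow> real"
  assumes b: "\<And>p. b (wrap2 K p) = b p" and b0: "\<And>p. freq_norm K p = 0 \<Longrightarrow> b p = 0"
  shows "(\<Sum>k\<in>freqs2 K. (\<Sum>p\<in>freqs2 K. b p * b (k - p))\<^sup>2)
    \<le> 2 * lattice_const * ((\<Sum>p\<in>freqs2 K. (freq_norm K p)\<^sup>2 * (b p)\<^sup>2) * (\<Sum>p\<in>freqs2 K. freq_norm K p * (b p)\<^sup>2))"
proof -
  let ?Z = "freqs2 K"
  let ?x = "\<lambda>k p. freq_norm K p * sqrt (freq_norm K (k - p)) * (b p * b (k - p))"
  let ?y = "\<lambda>k p. 1 / (freq_norm K p * sqrt (freq_norm K (k - p)))"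
  have y: "(\<Sum>p\<in>?Z. (?y k p)\<^sup>2) \<le> 2 * lattice_const" for k
  proof -
    have young: "x\<^sup>2 * y \<le> x ^ 3 + y ^ 3" if "x \<ge> 0" "y \<ge> 0" for x y :: real
    proof (cases "x \<le> y")
      case True
      then have "x\<^sup>2 * y \<le> y\<^sup>2 * y"
        using that by (intro mult_right_mono power_mono)
      then show ?thesis
        using that by (simp add: power2_eq_square power3_eq_cube add_increasing)
    next
      case False
      then have "x\<^sup>2 * y \<le> x\<^sup>2 * x"
        using that by (intro mult_left_mono) auto
      then show ?thesis
        using that by (simp add: power2_eq_square power3_eq_cube add_increasing2)
    qed
    have "(?y k p)\<^sup>2 \<le> 1 / freq_norm K p ^ 3 + 1 / freq_norm K (k - p) ^ 3" for p
      using young[of "1 / freq_norm K p" "1 / freq_norm K (k - p)"]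
      by (simp add: power_divide power_mult_distrib freq_norm_nonneg)
    then have "(\<Sum>p\<in>?Z. (?y k p)\<^sup>2) \<le> (\<Sum>p\<in>?Z. 1 / freq_norm K p ^ 3 + 1 / freq_norm K (k - p) ^ 3)"
      by (intro sum_mono)
    also have "\<dots> = (\<Sum>p\<in>?Z. 1 / freq_norm K p ^ 3) + (\<Sum>p\<in>?Z. 1 / freq_norm K p ^ 3)"
      using sum_freqs_reflect[of "\<lambda>p. 1 / freq_norm K p ^ 3"] by (simp add: sum.distrib freq_norm_wrap2)
    finally show ?thesis
      using sum_inverse_freq_norm_cube[of K] by simp
  qed
  have "(\<Sum>k\<in>?Z. (\<Sum>p\<in>?Z. b p * b (k - p))\<^sup>2) = (\<Sum>k\<in>?Z. (\<Sum>p\<in>?Z. ?x k p * ?y k p)\<^sup>2)"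
    by (intro sum.cong refl arg_cong[of _ _ "\<lambda>x. x\<^sup>2"]) (use b0 in auto)
  also have "\<dots> \<le> (\<Sum>k\<in>?Z. (\<Sum>p\<in>?Z. (?x k p)\<^sup>2) * (\<Sum>p\<in>?Z. (?y k p)\<^sup>2))"
    by (intro sum_mono Cauchy_Schwarz_ineq_sum)
  also have "\<dots> \<le> (\<Sum>k\<in>?Z. (\<Sum>p\<in>?Z. (?x k p)\<^sup>2) * (2 * lattice_const))"
    by (intro sum_mono mult_left_mono y sum_nonneg) auto
  also have "\<dots> = 2 * lattice_const * (\<Sum>k\<in>?Z. \<Sum>p\<in>?Z. (freq_norm K p)\<^sup>2 * (b p)\<^sup>2 * (freq_norm K (k - p) * (b (k - p))\<^sup>2))"
    by (simp add: power_mult_distrib freq_norm_nonneg sum_distrib_left mult_ac)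
  also have "(\<Sum>k\<in>?Z. \<Sum>p\<in>?Z. (freq_norm K p)\<^sup>2 * (b p)\<^sup>2 * (freq_norm K (k - p) * (b (k - p))\<^sup>2))
      = (\<Sum>p\<in>?Z. (freq_norm K p)\<^sup>2 * (b p)\<^sup>2 * (\<Sum>k\<in>?Z. freq_norm K (k - p) * (b (k - p))\<^sup>2))"
    by (subst sum.swap) (simp add: sum_distrib_left)
  also have "\<dots> = (\<Sum>p\<in>?Z. (freq_norm K p)\<^sup>2 * (b p)\<^sup>2) * (\<Sum>p\<in>?Z. freq_norm K p * (b p)\<^sup>2)"
    using sum_freqs_shift[of "\<lambda>p. freq_norm K p * (b p)\<^sup>2"] b by (simp add: sum_distrib_right freq_norm_wrap2)
  finally show ?thesis .
qed

lemma fmode_grid_mod: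
  assumes "k mod mesh_N K = k' mod mesh_N K" "l mod mesh_N K = l' mod mesh_N K"
  shows "fmode k l (grid_pt K i j) = fmode k' l' (grid_pt K i j)"
proof -
  obtain a where a: "k - k' = mesh_N K * a"
    using assms(1) by (metis mod_eq_dvd_iff dvdE)
  obtain b where b: "l - l' = mesh_N K * b"
    using assms(2) by (metis mod_eq_dvd_iff dvdE)
  have "fmode k l (grid_pt K i j) = fmode k' l' (grid_pt K i j) *
      cis (2 * pi * (of_int (k - k') * (of_int i * mesh_h K) + of_int (l - l') * (of_int j * mesh_h K)))"
    unfolding fmode_def cis_mult grid_pt_def
    by (intro arg_cong[of _ _ cis]) (simp add: algebra_simps)
  also have "of_int (k - k') * (of_int i * mesh_h K) + of_int (l - l') * (of_int j * mesh_h K)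
      = real_of_int (a * i + b * j)"
    unfolding a b using mesh_N_pos[of K] by (simp add: mesh_h_def)
  finally show ?thesis
    by (simp add: cis_multiple_2pi)
qed

abbreviation dft2 :: "nat \<Rightarrow> grid \<Rightarrow> int \<times> int \<Rightarrow> complex" where
  "dft2 K f p \<equiv> dft K f (fst p) (snd p)"

lemma dft2_wrap2: "dft2 K f (wrap2 K p) = dft2 K f p"
  unfolding dft_def wrap2_def fst_conv snd_conv
  by (intro arg_cong2[of _ _ _ _ "(*)"] sum.cong refl arg_cong[of _ _ cnj] fmode_grid_mod wrap_mod)

lemma fmode_diff: "cnj (fmode (k - p) (l - q) x) = fmode p q x * cnj (fmode k l x)"
  unfolding fmode_def cis_cnj cis_mult by (intro arg_cong[of _ _ cis]) (simp add: algebra_simps)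

text \<open>The convolution runs over the resolved frequencies \<open>p\<close> only, while \<open>k - p\<close> may lie outside: there \<open>dft\<close>
is the periodic continuation, which carries the aliasing.\<close>

theorem dft_mult:
  "dft2 K (\<lambda>i j. f i j * g i j) k = (\<Sum>p\<in>freqs2 K. dft2 K f p * dft2 K g (k - p))"
proof -
  let ?I = "{0..<mesh_N K}"
  have "dft2 K (\<lambda>i j. f i j * g i j) k = of_real ((mesh_h K)\<^sup>2) * (\<Sum>i\<in>?I. \<Sum>j\<in>?I.
      trigsum K (dft K f) (grid_pt K i j) * of_real (g i j) * cnj (fmode (fst k) (snd k) (grid_pt K i j)))"
    unfolding dft_def[of K "\<lambda>i j. f i j * g i j"] by (simp add: discrete_expansion)
  also have "\<dots> = (\<Sum>i\<in>?I. \<Sum>j\<in>?I. \<Sum>p\<in>freqs K. \<Sum>q\<in>freqs K. of_real ((mesh_h K)\<^sup>2) *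
      (dft K f p q * (of_real (g i j) * cnj (fmode (fst k - p) (snd k - q) (grid_pt K i j)))))"
    unfolding trigsum_def by (simp add: sum_distrib_left sum_distrib_right mult_ac fmode_diff)
  also have "\<dots> = (\<Sum>p\<in>freqs K. \<Sum>q\<in>freqs K. \<Sum>i\<in>?I. \<Sum>j\<in>?I. of_real ((mesh_h K)\<^sup>2) *
      (dft K f p q * (of_real (g i j) * cnj (fmode (fst k - p) (snd k - q) (grid_pt K i j)))))"
    by (rule swap4[symmetric])
  also have "\<dots> = (\<Sum>p\<in>freqs K. \<Sum>q\<in>freqs K. dft K f p q * dft K g (fst k - p) (snd k - q))"
    by (simp add: dft_def[of K g] sum_distrib_left mult_ac)
  finally show ?thesis
    by (simp add: sum.cartesian_product case_prod_unfold)
qed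

lemma parseval2: "(gnorm K f)\<^sup>2 = (\<Sum>p\<in>freqs2 K. (cmod (dft2 K f p))\<^sup>2)"
  by (simp add: gnorm_parseval sum.cartesian_product case_prod_unfold)

lemma freq_norm_sq: "p \<in> freqs2 K \<Longrightarrow> (freq_norm K p)\<^sup>2 = (of_int (fst p))\<^sup>2 + (of_int (snd p))\<^sup>2"
  by (cases p) (simp add: freq_norm_def wrap_ident)

lemma grad_parseval2:
  "(vgnorm K (gradN K f))\<^sup>2 = 4 * pi\<^sup>2 * (\<Sum>p\<in>freqs2 K. (freq_norm K p)\<^sup>2 * (cmod (dft2 K f p))\<^sup>2)"
  by (simp add: grad_parseval sum.cartesian_product case_prod_unfold sum_distrib_left freq_norm_sq
      mult.assoc del: mem_Sigma_iff)

lemma abs_freq_le: "p \<in> freqs2 K \<Longrightarrow> \<bar>of_int (fst p)\<bar> \<le> freq_norm K p"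
  "p \<in> freqs2 K \<Longrightarrow> \<bar>of_int (snd p)\<bar> \<le> freq_norm K p"
  using freq_norm_sq[of p K] by (auto intro!: power2_le_imp_le[OF _ freq_norm_nonneg])

lemma dft2_D_le:
  assumes "p \<in> freqs2 K"
  shows "cmod (dft2 K (DNx K f) p) \<le> 2 * pi * (freq_norm K p * cmod (dft2 K f p))"
    and "cmod (dft2 K (DNy K f) p) \<le> 2 * pi * (freq_norm K p * cmod (dft2 K f p))"
  using assms abs_freq_le[OF assms]
  by (auto simp: dft_DNx dft_DNy norm_mult mem_Times_iff intro!: mult_right_mono mult_left_mono)

lemma gnorm_mult_le:
  assumes "\<And>i j. i \<in> {0..<mesh_N K} \<Longrightarrow> j \<in> {0..<mesh_N K} \<Longrightarrow> \<bar>f i j\<bar> \<le> A" and "A \<ge> 0"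
  shows "gnorm K (\<lambda>i j. f i j * g i j) \<le> A * gnorm K g"
proof (rule power2_le_imp_le)
  have "(gnorm K (\<lambda>i j. f i j * g i j))\<^sup>2 \<le> gavg K (\<lambda>i j. A\<^sup>2 * (g i j)\<^sup>2)"
    unfolding gnorm_sq power_mult_distrib
  proof (intro gavg_mono mult_right_mono)
    fix i j
    assume "i \<in> {0..<mesh_N K}" "j \<in> {0..<mesh_N K}"
    then have "\<bar>f i j\<bar>\<^sup>2 \<le> A\<^sup>2"
      by (intro power_mono assms) auto
    then show "(f i j)\<^sup>2 \<le> A\<^sup>2"
      by simp
  qed simp
  then show "(gnorm K (\<lambda>i j. f i j * g i j))\<^sup>2 \<le> (A * gnorm K g)\<^sup>2"
    by (simp add: gavg_linear power_mult_distrib gnorm_sq)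
qed (use assms gnorm_nonneg in auto)

text \<open>The sum of the moduli of the coefficients bounds the maximum on the grid; it replaces the Sobolev
embedding for the velocity.\<close>

lemma grid_sup_le_wiener:
  assumes "i \<in> {0..<mesh_N K}" "j \<in> {0..<mesh_N K}"
  shows "\<bar>f i j\<bar> \<le> (\<Sum>p\<in>freqs2 K. cmod (dft2 K f p))"
proof -
  have "\<bar>f i j\<bar> = cmod (trigsum K (dft K f) (grid_pt K i j))"
    using assms by (simp add: discrete_expansion)
  also have "\<dots> \<le> (\<Sum>p\<in>freqs2 K. cmod (dft2 K f p * fmode (fst p) (snd p) (grid_pt K i j)))"
    unfolding trigsum_def by (simp add: sum.cartesian_product case_prod_unfold norm_sum)
  also have "\<dots> = (\<Sum>p\<in>freqs2 K. cmod (dft2 K f p))"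
    by (simp add: norm_mult fmode_def)
  finally show ?thesis .
qed

text \<open>The product rule as an estimate: subadditivity of the folded frequency distributes the derivative over
the two factors, with all coefficients replaced by their moduli.\<close>

lemma gnorm_D_mult_le:
  assumes D: "D = DNx K \<or> D = DNy K"
  shows "(gnorm K (D (\<lambda>i j. f i j * g i j)))\<^sup>2 \<le> 8 * pi\<^sup>2 *
    ((\<Sum>k\<in>freqs2 K. (\<Sum>p\<in>freqs2 K. cmod (dft2 K f p) * (freq_norm K (k - p) * cmod (dft2 K g (k - p))))\<^sup>2) +
     (\<Sum>k\<in>freqs2 K. (\<Sum>p\<in>freqs2 K. freq_norm K p * cmod (dft2 K f p) * cmod (dft2 K g (k - p)))\<^sup>2))"
proof -
  let ?Z = "freqs2 K"
  let ?s = "\<lambda>k. \<Sum>p\<in>?Z. cmod (dft2 K f p) * (freq_norm K (k - p) * cmod (dft2 K g (k - p)))"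
  let ?t = "\<lambda>k. \<Sum>p\<in>?Z. freq_norm K p * cmod (dft2 K f p) * cmod (dft2 K g (k - p))"
  let ?h = "\<lambda>i j. f i j * g i j"
  have "(cmod (dft2 K (D ?h) k))\<^sup>2 \<le> 8 * pi\<^sup>2 * ((?s k)\<^sup>2 + (?t k)\<^sup>2)" if k: "k \<in> ?Z" for k
  proof -
    have "freq_norm K k * cmod (dft2 K ?h k) \<le> freq_norm K k * (\<Sum>p\<in>?Z. cmod (dft2 K f p) * cmod (dft2 K g (k - p)))"
      unfolding dft_mult by (intro mult_left_mono sum_norm_le freq_norm_nonneg) (simp add: norm_mult)
    also have "\<dots> \<le> (\<Sum>p\<in>?Z. (freq_norm K p + freq_norm K (k - p)) * (cmod (dft2 K f p) * cmod (dft2 K g (k - p))))"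
      unfolding sum_distrib_left
    proof (intro sum_mono mult_right_mono)
      fix p
      show "freq_norm K k \<le> freq_norm K p + freq_norm K (k - p)"
        using freq_norm_triangle[of K p "k - p"] by simp
    qed simp
    also have "\<dots> = ?s k + ?t k"
      unfolding sum.distrib[symmetric] by (intro sum.cong refl) (simp add: algebra_simps)
    finally have "2 * pi * (freq_norm K k * cmod (dft2 K ?h k)) \<le> 2 * pi * (?s k + ?t k)"
      by (intro mult_left_mono) auto
    then have "cmod (dft2 K (D ?h) k) \<le> 2 * pi * (?s k + ?t k)"
      using dft2_D_le[OF k, of ?h] D by (elim disjE) (hypsubst, erule order_trans[rotated], assumption)+
    then have "(cmod (dft2 K (D ?h) k))\<^sup>2 \<le> (2 * pi * (?s k + ?t k))\<^sup>2"
      by (intro power_mono) auto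
    also have "\<dots> = 4 * pi\<^sup>2 * (?s k + ?t k)\<^sup>2"
      by (simp add: power_mult_distrib)
    also have "\<dots> \<le> 4 * pi\<^sup>2 * (2 * ((?s k)\<^sup>2 + (?t k)\<^sup>2))"
      using sum_squares_bound[of "?s k" "?t k"] by (intro mult_left_mono) (auto simp: power2_sum)
    also have "4 * pi\<^sup>2 * (2 * z) = 8 * pi\<^sup>2 * z" for z
      by simp
    finally show ?thesis .
  qed
  then show ?thesis
    unfolding parseval2 sum.distrib[symmetric] sum_distrib_left by (intro sum_mono)
qed

text \<open>Here \<open>f\<close> stands for a component of the velocity, which is one derivative smoother than \<open>w\<close>.
The sums \<open>Y\<close> and \<open>H\<close> are the squared \<open>H\<^sup>1\<close> and \<open>H\<^sup>1\<^sup>/\<^sup>2\<close> seminorms of \<open>w\<close> up to constants. In both products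
one factor is measured by \<open>H\<close>: either through the sum of its moduli or through \<open>conv_weighted\<close>.\<close>

lemma advection_estimates:
  fixes K f w
  defines "Y \<equiv> \<Sum>p\<in>freqs2 K. (freq_norm K p)\<^sup>2 * (cmod (dft2 K w p))\<^sup>2"
    and "H \<equiv> \<Sum>p\<in>freqs2 K. freq_norm K p * (cmod (dft2 K w p))\<^sup>2"
  assumes w0: "gavg K w = 0" and f0: "gavg K f = 0"
    and fw: "\<And>p. p \<in> freqs2 K \<Longrightarrow> 2 * pi * (freq_norm K p * cmod (dft2 K f p)) \<le> cmod (dft2 K w p)"
    and D: "D = DNx K \<or> D = DNy K"
  shows "(gnorm K (\<lambda>i j. f i j * D w i j))\<^sup>2 \<le> lattice_const * H * Y"
    and "(gnorm K (D (\<lambda>i j. f i j * w i j)))\<^sup>2 \<le> 6 * lattice_const * H * Y"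
proof -
  let ?Z = "freqs2 K" and ?a = "\<lambda>p. cmod (dft2 K f p)" and ?b = "\<lambda>p. cmod (dft2 K w p)"
  have Y0: "Y \<ge> 0" and H0: "H \<ge> 0"
    unfolding Y_def H_def by (auto intro!: sum_nonneg simp: freq_norm_nonneg)
  have lam0: "wrap2 K p = 0" if "freq_norm K p = 0" for p
    using that by (auto simp: freq_norm_def wrap2_def sum_power2_eq_zero_iff zero_prod_def)
  have b0: "?b p = 0" and a0: "?a p = 0" if "freq_norm K p = 0" for p
    using dft2_wrap2[of K w p] dft2_wrap2[of K f p] w0 f0 lam0[OF that] gavg_dft[of K w] gavg_dft[of K f]
    by auto
  have a_le: "?a p \<le> (1 / (2 * pi)) * (?b p / freq_norm K p)" if "p \<in> ?Z" for p
  proof (cases "freq_norm K p = 0")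
    case False
    then show ?thesis
      using fw[OF that] freq_norm_nonneg[of K p] by (simp add: pos_le_divide_eq mult_ac)
  qed (simp add: a0)
  \<comment> \<open>The moduli of \<open>f\<close> are summable because half a derivative of \<open>w\<close> and one smoothing derivative leave \<open>|p|\<^sup>-\<^sup>3\<close>.\<close>
  have "(\<Sum>p\<in>?Z. ?b p / freq_norm K p)\<^sup>2
      = (\<Sum>p\<in>?Z. (sqrt (freq_norm K p) * ?b p) * (1 / (freq_norm K p * sqrt (freq_norm K p))))\<^sup>2"
    by (intro arg_cong[of _ _ "\<lambda>x. x\<^sup>2"] sum.cong refl) simp
  also have "\<dots> \<le> (\<Sum>p\<in>?Z. (sqrt (freq_norm K p) * ?b p)\<^sup>2) * (\<Sum>p\<in>?Z. (1 / (freq_norm K p * sqrt (freq_norm K p)))\<^sup>2)"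
    by (rule Cauchy_Schwarz_ineq_sum)
  also have "\<dots> = H * (\<Sum>p\<in>?Z. 1 / freq_norm K p ^ 3)"
    unfolding H_def power_mult_distrib power_divide real_sqrt_pow2[OF freq_norm_nonneg]
    by (simp add: power2_eq_square power3_eq_cube mult.assoc)
  also have "\<dots> \<le> H * lattice_const"
    using H0 sum_inverse_freq_norm_cube by (intro mult_left_mono)
  finally have bl: "(\<Sum>p\<in>?Z. ?b p / freq_norm K p)\<^sup>2 \<le> H * lattice_const" .
  have "(\<Sum>p\<in>?Z. ?a p) \<le> (1 / (2 * pi)) * (\<Sum>p\<in>?Z. ?b p / freq_norm K p)"
    unfolding sum_distrib_left by (intro sum_mono a_le)
  then have "(\<Sum>p\<in>?Z. ?a p)\<^sup>2 \<le> ((1 / (2 * pi)) * (\<Sum>p\<in>?Z. ?b p / freq_norm K p))\<^sup>2"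
    by (intro power_mono sum_nonneg) auto
  also have "\<dots> \<le> (1 / (4 * pi\<^sup>2)) * (H * lattice_const)"
    unfolding power_mult_distrib using bl by (simp add: power_divide power_mult_distrib divide_right_mono)
  finally have wiener: "(\<Sum>p\<in>?Z. ?a p)\<^sup>2 \<le> (1 / (4 * pi\<^sup>2)) * (H * lattice_const)" .

  have "(gnorm K (D w))\<^sup>2 \<le> (vgnorm K (gradN K w))\<^sup>2"
    using D by (auto simp: vgnorm_sq gradN_def)
  then have Dw: "(gnorm K (D w))\<^sup>2 \<le> 4 * pi\<^sup>2 * Y"
    by (simp add: grad_parseval2 Y_def)
  have "gnorm K (\<lambda>i j. f i j * D w i j) \<le> (\<Sum>p\<in>?Z. ?a p) * gnorm K (D w)"
    by (intro gnorm_mult_le grid_sup_le_wiener sum_nonneg) auto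
  then have "(gnorm K (\<lambda>i j. f i j * D w i j))\<^sup>2 \<le> ((\<Sum>p\<in>?Z. ?a p) * gnorm K (D w))\<^sup>2"
    by (intro power_mono gnorm_nonneg)
  also have "\<dots> \<le> ((1 / (4 * pi\<^sup>2)) * (H * lattice_const)) * (4 * pi\<^sup>2 * Y)"
    unfolding power_mult_distrib using Dw wiener H0 lattice_const_pos by (intro mult_mono) auto
  finally show "(gnorm K (\<lambda>i j. f i j * D w i j))\<^sup>2 \<le> lattice_const * H * Y"
    by (simp add: mult_ac)

  have "(\<Sum>k\<in>?Z. (\<Sum>p\<in>?Z. ?a p * (freq_norm K (k - p) * ?b (k - p)))\<^sup>2)
      \<le> (\<Sum>p\<in>?Z. ?a p)\<^sup>2 * (\<Sum>p\<in>?Z. (freq_norm K p * ?b p)\<^sup>2)"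
    by (rule conv_l1_l2) (simp_all add: freq_norm_wrap2 dft2_wrap2)
  also have "\<dots> \<le> ((1 / (4 * pi\<^sup>2)) * (H * lattice_const)) * Y"
    using mult_right_mono[OF wiener Y0] by (simp only: power_mult_distrib Y_def)
  finally have s: "(\<Sum>k\<in>?Z. (\<Sum>p\<in>?Z. ?a p * (freq_norm K (k - p) * ?b (k - p)))\<^sup>2)
      \<le> ((1 / (4 * pi\<^sup>2)) * (H * lattice_const)) * Y" .
  have "(\<Sum>p\<in>?Z. freq_norm K p * ?a p * ?b (k - p)) \<le> (1 / (2 * pi)) * (\<Sum>p\<in>?Z. ?b p * ?b (k - p))" for k
    unfolding sum_distrib_left
  proof (intro sum_mono)
    fix p
    assume "p \<in> ?Z"
    then have "freq_norm K p * ?a p \<le> 1 / (2 * pi) * ?b p"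
      using fw[of p] by (simp add: pos_le_divide_eq mult.commute)
    then have "freq_norm K p * ?a p * ?b (k - p) \<le> 1 / (2 * pi) * ?b p * ?b (k - p)"
      by (rule mult_right_mono) simp
    then show "freq_norm K p * ?a p * ?b (k - p) \<le> 1 / (2 * pi) * (?b p * ?b (k - p))"
      by (simp only: mult.assoc)
  qed
  then have "(\<Sum>k\<in>?Z. (\<Sum>p\<in>?Z. freq_norm K p * ?a p * ?b (k - p))\<^sup>2)
      \<le> (\<Sum>k\<in>?Z. ((1 / (2 * pi)) * (\<Sum>p\<in>?Z. ?b p * ?b (k - p)))\<^sup>2)"
    by (intro sum_mono power_mono sum_nonneg) (auto simp: freq_norm_nonneg)
  also have "\<dots> = (1 / (4 * pi\<^sup>2)) * (\<Sum>k\<in>?Z. (\<Sum>p\<in>?Z. ?b p * ?b (k - p))\<^sup>2)"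
    unfolding power_mult_distrib sum_distrib_left[symmetric] by (simp add: power_divide power_mult_distrib)
  also have "\<dots> \<le> (1 / (4 * pi\<^sup>2)) * (2 * lattice_const * (Y * H))"
    unfolding Y_def H_def by (intro mult_left_mono conv_weighted) (simp_all add: dft2_wrap2 b0)
  finally have t: "(\<Sum>k\<in>?Z. (\<Sum>p\<in>?Z. freq_norm K p * ?a p * ?b (k - p))\<^sup>2)
      \<le> (1 / (4 * pi\<^sup>2)) * (2 * lattice_const * (Y * H))" .
  note gnorm_D_mult_le[OF D, of f w]
  also have "8 * pi\<^sup>2 *
      ((\<Sum>k\<in>?Z. (\<Sum>p\<in>?Z. ?a p * (freq_norm K (k - p) * ?b (k - p)))\<^sup>2) +
       (\<Sum>k\<in>?Z. (\<Sum>p\<in>?Z. freq_norm K p * ?a p * ?b (k - p))\<^sup>2)) \<le> 8 * pi\<^sup>2 *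
      (((1 / (4 * pi\<^sup>2)) * (H * lattice_const)) * Y + (1 / (4 * pi\<^sup>2)) * (2 * lattice_const * (Y * H)))"
    using s t by (intro mult_left_mono add_mono) auto
  finally show "(gnorm K (D (\<lambda>i j. f i j * w i j)))\<^sup>2 \<le> 6 * lattice_const * H * Y"
    by (simp add: field_simps)
qed

lemma kinematic_mean:
  assumes "kinematic K w \<psi> u"
  shows "gavg K w = 0" "gavg K (fst u) = 0" "gavg K (snd u) = 0"
proof -
  have "w = (\<lambda>i j. - lapN K \<psi> i j)" and u: "u = perp_gradN K \<psi>"
    using assms by (auto simp: kinematic_def)
  then have "complex_of_real (gavg K w) = 0" "complex_of_real (gavg K (fst u)) = 0"
    "complex_of_real (gavg K (snd u)) = 0"
    by (simp_all add: gavg_dft dft_uminus_grid dft_lapN perp_gradN_def dft_DNx dft_DNy)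
  then show "gavg K w = 0" "gavg K (fst u) = 0" "gavg K (snd u) = 0"
    by simp_all
qed

lemma kinematic_dft:
  assumes kin: "kinematic K w \<psi> u" and p: "p \<in> freqs2 K"
  shows "2 * pi * (freq_norm K p * cmod (dft2 K (fst u) p)) \<le> cmod (dft2 K w p)"
    and "2 * pi * (freq_norm K p * cmod (dft2 K (snd u) p)) \<le> cmod (dft2 K w p)"
proof -
  have w: "w = (\<lambda>i j. - lapN K \<psi> i j)" and u: "u = perp_gradN K \<psi>"
    using kin by (auto simp: kinematic_def)
  have "dft2 K w p = of_real (4 * pi\<^sup>2 * (freq_norm K p)\<^sup>2) * dft2 K \<psi> p"
    using p by (auto simp: w dft_uminus_grid dft_lapN freq_norm_sq mem_Times_iff)
  then have cw: "cmod (dft2 K w p) = 2 * pi * (freq_norm K p * (2 * pi * (freq_norm K p * cmod (dft2 K \<psi> p))))"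
    by (simp only: norm_mult norm_of_real) (simp add: power2_eq_square mult_ac)
  have "cmod (dft2 K (fst u) p) \<le> 2 * pi * (freq_norm K p * cmod (dft2 K \<psi> p))"
    "cmod (dft2 K (snd u) p) \<le> 2 * pi * (freq_norm K p * cmod (dft2 K \<psi> p))"
    using dft2_D_le[OF p, of \<psi>] by (simp_all add: u perp_gradN_def dft_uminus_grid)
  then show "2 * pi * (freq_norm K p * cmod (dft2 K (fst u) p)) \<le> cmod (dft2 K w p)"
    "2 * pi * (freq_norm K p * cmod (dft2 K (snd u) p)) \<le> cmod (dft2 K w p)"
    unfolding cw by (intro mult_left_mono freq_norm_nonneg; simp)+
qed

text \<open>Both halves of the nonlinear term are bounded by \<open>advection_estimates\<close>, and removing the mean at most doubles the
first one. The half derivative in \<open>H\<close> is interpolated between \<open>W\<close> and \<open>Y\<close>, so that exactly three of the four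
factors carry a derivative.\<close>

theorem nonlinN_le:
  assumes kin: "kinematic K w \<psi> u"
  shows "(gnorm K (nonlinN K u w))\<^sup>2 \<le> 100 * lattice_const * (vgnorm K (gradN K w) ^ 3 * gnorm K w)"
proof -
  let ?Y = "\<Sum>p\<in>freqs2 K. (freq_norm K p)\<^sup>2 * (cmod (dft2 K w p))\<^sup>2"
  let ?H = "\<Sum>p\<in>freqs2 K. freq_norm K p * (cmod (dft2 K w p))\<^sup>2"
  define r where "r = sqrt (lattice_const * ?H * ?Y)"
  define y where "y = vgnorm K (gradN K w)"
  have Y0: "?Y \<ge> 0" and H0: "?H \<ge> 0"
    by (auto intro!: sum_nonneg simp: freq_norm_nonneg)
  have r0: "r \<ge> 0" and r2: "r\<^sup>2 = lattice_const * ?H * ?Y"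
    using Y0 H0 lattice_const_pos by (simp_all add: r_def)
  have small: "gnorm K g \<le> r" if "(gnorm K g)\<^sup>2 \<le> lattice_const * ?H * ?Y" for g
    by (rule power2_le_imp_le) (use that r0 in \<open>simp_all add: r2\<close>)
  have large: "gnorm K g \<le> 3 * r" if "(gnorm K g)\<^sup>2 \<le> 6 * lattice_const * ?H * ?Y" for g
  proof (rule power2_le_imp_le)
    show "(gnorm K g)\<^sup>2 \<le> (3 * r)\<^sup>2"
      using that r2 zero_le_power2[of r] by (simp add: power_mult_distrib)
  qed (use r0 in simp)
  note m = kinematic_mean[OF kin] and d = kinematic_dft[OF kin]
  have adv: "gnorm K (advN K u w) \<le> 2 * r"
    using small[OF advection_estimates(1)[OF m(1,2) d(1), of "DNx K"]]
      small[OF advection_estimates(1)[OF m(1,3) d(2), of "DNy K"]]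
      gnorm_add_le[of K "\<lambda>i j. fst u i j * DNx K w i j" "\<lambda>i j. snd u i j * DNy K w i j"]
    by (simp add: advN_def)
  have dv: "gnorm K (divN K (\<lambda>i j. fst u i j * w i j, \<lambda>i j. snd u i j * w i j)) \<le> 6 * r"
    using large[OF advection_estimates(2)[OF m(1,2) d(1), of "DNx K"]]
      large[OF advection_estimates(2)[OF m(1,3) d(2), of "DNy K"]]
      gnorm_add_le[of K "DNx K (\<lambda>i j. fst u i j * w i j)" "DNy K (\<lambda>i j. snd u i j * w i j)"]
    by (simp add: divN_def)
  have av: "gnorm K (\<lambda>i j. gavg K (advN K u w)) \<le> 2 * r"
  proof -
    have "gnorm K (\<lambda>i j. gavg K (advN K u w)) = \<bar>gavg K (advN K u w)\<bar>"
      by (simp add: gnorm_def ginner_gavg gavg_const)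
    then show ?thesis
      using gavg_le_gnorm[of K "advN K u w"] adv by simp
  qed
  have "gnorm K (nonlinN K u w) \<le> 10 * r"
    using adv dv av gnorm_add_le[of K "advN K u w" "divN K (\<lambda>i j. fst u i j * w i j, \<lambda>i j. snd u i j * w i j)"]
      gnorm_diff_le[of K "\<lambda>i j. advN K u w i j + divN K (\<lambda>i j. fst u i j * w i j, \<lambda>i j. snd u i j * w i j) i j"
        "\<lambda>i j. gavg K (advN K u w)"]
    by (simp add: nonlinN_def)
  then have "(gnorm K (nonlinN K u w))\<^sup>2 \<le> (10 * r)\<^sup>2"
    by (intro power_mono gnorm_nonneg)
  then have N: "(gnorm K (nonlinN K u w))\<^sup>2 \<le> 100 * lattice_const * (?H * ?Y)"
    by (simp add: power_mult_distrib r2)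
  have y2: "y\<^sup>2 = 4 * pi\<^sup>2 * ?Y" and y0: "y \<ge> 0"
    by (simp_all add: y_def grad_parseval2 vgnorm_nonneg)
  have pi1: "1 \<le> 4 * pi\<^sup>2"
    using pi_gt3 power_mono[of 3 pi 2] by simp
  have Yy: "?Y \<le> y\<^sup>2"
    unfolding y2 using mult_right_mono[OF pi1 Y0] by simp
  have "?H\<^sup>2 = (\<Sum>p\<in>freqs2 K. (freq_norm K p * cmod (dft2 K w p)) * cmod (dft2 K w p))\<^sup>2"
    by (simp add: power2_eq_square mult.assoc)
  also have "\<dots> \<le> (\<Sum>p\<in>freqs2 K. (freq_norm K p * cmod (dft2 K w p))\<^sup>2) * (\<Sum>p\<in>freqs2 K. (cmod (dft2 K w p))\<^sup>2)"
    by (rule Cauchy_Schwarz_ineq_sum)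
  also have "\<dots> = ?Y * (gnorm K w)\<^sup>2"
    by (simp only: parseval2 power_mult_distrib)
  also have "\<dots> \<le> (y * gnorm K w)\<^sup>2"
    unfolding power_mult_distrib using Yy by (intro mult_right_mono) auto
  finally have "?H \<le> y * gnorm K w"
    by (rule power2_le_imp_le) (use y0 gnorm_nonneg in auto)
  then have "?H * ?Y \<le> (y * gnorm K w) * y\<^sup>2"
    using Yy Y0 y0 gnorm_nonneg by (intro mult_mono) auto
  also have "\<dots> = y ^ 3 * gnorm K w"
    by (simp add: power2_eq_square power3_eq_cube)
  finally have "100 * lattice_const * (?H * ?Y) \<le> 100 * lattice_const * (y ^ 3 * gnorm K w)"
    using lattice_const_pos by (intro mult_left_mono) auto
  then show ?thesis
    using N by (simp add: y_def)
qed

text \<open>Summation by parts moves the derivative in the divergence part onto \<open>w\<close> and reproduces the advective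
part with the opposite sign; the subtracted average is invisible to a mean-free \<open>w\<close>.\<close>

lemma nonlinN_orthogonal:
  assumes "gavg K w = 0"
  shows "ginner K (nonlinN K u w) w = 0"
proof -
  let ?a = "\<lambda>i j. fst u i j * w i j" and ?b = "\<lambda>i j. snd u i j * w i j"
  have "ginner K (nonlinN K u w) w = ginner K (advN K u w) w
      + (ginner K (DNx K ?a) w + ginner K (DNy K ?b) w) - gavg K (advN K u w) * gavg K w"
    by (simp add: ginner_gavg nonlinN_def divN_def distrib_right left_diff_distrib gavg_linear)
  also have "ginner K (advN K u w) w = ginner K ?a (DNx K w) + ginner K ?b (DNy K w)"
    unfolding ginner_gavg advN_def gavg_add[symmetric] by (simp add: algebra_simps)
  also have "ginner K (DNx K ?a) w + ginner K (DNy K ?b) w = - \<dots>"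
    by (simp add: ginner_DNx ginner_DNy)
  finally show ?thesis
    by (simp add: assms)
qed

section \<open>One step of the scheme: the vorticity\<close>

lemma ginner_add_right: "ginner K h (\<lambda>i j. f i j + g i j) = ginner K h f + ginner K h g"
  by (simp add: ginner_gavg distrib_left gavg_linear)

lemma ginner_diff_left: "ginner K (\<lambda>i j. f i j - g i j) h = ginner K f h - ginner K g h"
  by (simp add: ginner_gavg left_diff_distrib gavg_linear)

lemma ginner_diff_right: "ginner K h (\<lambda>i j. f i j - g i j) = ginner K h f - ginner K h g"
  by (simp add: ginner_gavg right_diff_distrib gavg_linear)

lemma ginner_cmult_left: "ginner K (\<lambda>i j. c * f i j) h = c * ginner K f h"
  by (simp add: ginner_gavg gavg_linear mult.assoc)

lemma ginner_cmult_right: "ginner K h (\<lambda>i j. c * f i j) = c * ginner K h f"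
  by (simp add: ginner_gavg gavg_linear mult.left_commute)

lemmas ginner_linear = ginner_add_left ginner_add_right ginner_diff_left ginner_diff_right
  ginner_cmult_left ginner_cmult_right

lemma gnorm_le_grad:
  assumes "gavg K f = 0"
  shows "6 * gnorm K f \<le> vgnorm K (gradN K f)"
proof (rule power2_le_imp_le)
  have "36 \<le> 4 * pi\<^sup>2"
    using pi_gt3 power_mono[of 3 pi 2] by simp
  then have "36 * (gnorm K f)\<^sup>2 \<le> 4 * pi\<^sup>2 * (gnorm K f)\<^sup>2"
    by (rule mult_right_mono) simp
  then show "(6 * gnorm K f)\<^sup>2 \<le> (vgnorm K (gradN K f))\<^sup>2"
    using gnorm_poincare[OF assms] by (simp add: power_mult_distrib)
qed (rule vgnorm_nonneg)

lemma gnorm_sq_le_grad: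
  assumes "gavg K f = 0"
  shows "(gnorm K f)\<^sup>2 \<le> (vgnorm K (gradN K f))\<^sup>2"
  using gnorm_le_grad[OF assms] gnorm_nonneg[of K f] by (intro power_mono) auto

lemma grad_sq_le_lap: "(vgnorm K (gradN K f))\<^sup>2 \<le> (gnorm K (lapN K f))\<^sup>2"
proof -
  have "1 \<le> 4 * pi\<^sup>2"
    using pi_gt3 power_mono[of 3 pi 2] by simp
  then have "1 * (vgnorm K (gradN K f))\<^sup>2 \<le> 4 * pi\<^sup>2 * (vgnorm K (gradN K f))\<^sup>2"
    by (rule mult_right_mono) simp
  then show ?thesis
    using grad_poincare[of K f] by simp
qed

definition bdf3 :: "grid \<Rightarrow> grid \<Rightarrow> grid \<Rightarrow> grid \<Rightarrow> grid" where
  "bdf3 f3 f2 f1 f0 = (\<lambda>i j. 11/6 * f3 i j - 3 * f2 i j + 3/2 * f1 i j - 1/3 * f0 i j)"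

definition stencil_energy :: "(nat \<Rightarrow> real) \<Rightarrow> nat \<Rightarrow> grid \<Rightarrow> grid \<Rightarrow> grid \<Rightarrow> real" where
  "stencil_energy \<alpha> K f2 f1 f0 =
     (gnorm K (\<lambda>i j. \<alpha> 1 * f2 i j))\<^sup>2
   + (gnorm K (\<lambda>i j. \<alpha> 2 * f2 i j + \<alpha> 3 * f1 i j))\<^sup>2
   + (gnorm K (\<lambda>i j. \<alpha> 4 * f2 i j + \<alpha> 5 * f1 i j + \<alpha> 6 * f0 i j))\<^sup>2"

text \<open>The stencil identity without its last square, which is nonnegative.\<close>

lemma stencil_energy_step:
  assumes "stencil_constants \<alpha>" "is_grid K f3" "is_grid K f2" "is_grid K f1" "is_grid K f0"
  shows "stencil_energy \<alpha> K f3 f2 f1 \<le> stencil_energy \<alpha> K f2 f1 f0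
    + ginner K (bdf3 f3 f2 f1 f0) (\<lambda>i j. 2 * f3 i j - f2 i j)"
proof -
  have "ginner K (bdf3 f3 f2 f1 f0) (\<lambda>i j. 2 * f3 i j - f2 i j)
      = stencil_energy \<alpha> K f3 f2 f1 - stencil_energy \<alpha> K f2 f1 f0
        + (gnorm K (\<lambda>i j. \<alpha> 7 * f3 i j + \<alpha> 8 * f2 i j + \<alpha> 9 * f1 i j + \<alpha> 10 * f0 i j))\<^sup>2"
    using assms unfolding stencil_constants_def bdf3_def stencil_energy_def by fastforce
  then show ?thesis
    by simp
qed

text \<open>The factor 3 is the number of terms in the longest of the three squares of the stencil energy.\<close>

definition stencil_bound :: "(nat \<Rightarrow> real) \<Rightarrow> real" where
  "stencil_bound \<alpha> = 3 * ((\<alpha> 1)\<^sup>2 + (\<alpha> 2)\<^sup>2 + (\<alpha> 3)\<^sup>2 + (\<alpha> 4)\<^sup>2 + (\<alpha> 5)\<^sup>2 + (\<alpha> 6)\<^sup>2)"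

lemma stencil_bound_nonneg: "0 \<le> stencil_bound \<alpha>"
  by (simp add: stencil_bound_def)

lemma sq_sum2_le: "(x + y)\<^sup>2 \<le> 2 * x\<^sup>2 + 2 * y\<^sup>2" for x y :: real
  using sum_squares_bound[of x y] by (simp add: power2_sum)

lemma sq_sum3_le: "(x + y + z)\<^sup>2 \<le> 3 * x\<^sup>2 + 3 * y\<^sup>2 + 3 * z\<^sup>2" for x y z :: real
proof -
  have "3 * x\<^sup>2 + 3 * y\<^sup>2 + 3 * z\<^sup>2 - (x + y + z)\<^sup>2 = (x - y)\<^sup>2 + (y - z)\<^sup>2 + (x - z)\<^sup>2"
    by (simp add: power2_eq_square algebra_simps)
  moreover have "\<dots> \<ge> 0"
    by simp
  ultimately show ?thesis
    by linarith
qed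

lemma stencil_energy_le:
  "stencil_energy \<alpha> K f2 f1 f0 \<le> stencil_bound \<alpha> * ((gnorm K f2)\<^sup>2 + (gnorm K f1)\<^sup>2 + (gnorm K f0)\<^sup>2)"
proof -
  have "stencil_energy \<alpha> K f2 f1 f0 = gavg K (\<lambda>i j. (\<alpha> 1 * f2 i j)\<^sup>2 + (\<alpha> 2 * f2 i j + \<alpha> 3 * f1 i j)\<^sup>2
      + (\<alpha> 4 * f2 i j + \<alpha> 5 * f1 i j + \<alpha> 6 * f0 i j)\<^sup>2)"
    by (simp add: stencil_energy_def gnorm_sq gavg_linear)
  also have "\<dots> \<le> gavg K (\<lambda>i j. stencil_bound \<alpha> * ((f2 i j)\<^sup>2 + (f1 i j)\<^sup>2 + (f0 i j)\<^sup>2))"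
  proof (rule gavg_mono)
    fix i j
    let ?a = "f2 i j" and ?b = "f1 i j" and ?c = "f0 i j"
    have "(\<alpha> 1 * ?a)\<^sup>2 + (\<alpha> 2 * ?a + \<alpha> 3 * ?b)\<^sup>2 + (\<alpha> 4 * ?a + \<alpha> 5 * ?b + \<alpha> 6 * ?c)\<^sup>2
        \<le> (\<alpha> 1)\<^sup>2 * ?a\<^sup>2 + (2 * ((\<alpha> 2)\<^sup>2 * ?a\<^sup>2) + 2 * ((\<alpha> 3)\<^sup>2 * ?b\<^sup>2))
          + (3 * ((\<alpha> 4)\<^sup>2 * ?a\<^sup>2) + 3 * ((\<alpha> 5)\<^sup>2 * ?b\<^sup>2) + 3 * ((\<alpha> 6)\<^sup>2 * ?c\<^sup>2))"
      unfolding power_mult_distrib[symmetric] by (intro add_mono order_refl sq_sum2_le sq_sum3_le)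
    also have "\<dots> = stencil_bound \<alpha> * (?a\<^sup>2 + ?b\<^sup>2 + ?c\<^sup>2) -
        (2 * ((\<alpha> 1)\<^sup>2 * ?a\<^sup>2) + (\<alpha> 2)\<^sup>2 * ?a\<^sup>2 + (\<alpha> 3)\<^sup>2 * ?b\<^sup>2
          + 3 * (((\<alpha> 1)\<^sup>2 + (\<alpha> 2)\<^sup>2 + (\<alpha> 4)\<^sup>2 + (\<alpha> 6)\<^sup>2) * ?b\<^sup>2) + 3 * ((\<alpha> 3)\<^sup>2 * ?a\<^sup>2) + 3 * ((\<alpha> 5)\<^sup>2 * ?a\<^sup>2)
          + 3 * ((\<alpha> 6)\<^sup>2 * ?a\<^sup>2) + 3 * (((\<alpha> 1)\<^sup>2 + (\<alpha> 2)\<^sup>2 + (\<alpha> 3)\<^sup>2 + (\<alpha> 4)\<^sup>2 + (\<alpha> 5)\<^sup>2) * ?c\<^sup>2))"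
      by (simp add: stencil_bound_def algebra_simps)
    also have "\<dots> \<le> stencil_bound \<alpha> * (?a\<^sup>2 + ?b\<^sup>2 + ?c\<^sup>2)"
      unfolding diff_le_eq le_add_same_cancel1 by (intro add_nonneg_nonneg mult_nonneg_nonneg) simp_all
    finally show "(\<alpha> 1 * ?a)\<^sup>2 + (\<alpha> 2 * ?a + \<alpha> 3 * ?b)\<^sup>2 + (\<alpha> 4 * ?a + \<alpha> 5 * ?b + \<alpha> 6 * ?c)\<^sup>2
      \<le> stencil_bound \<alpha> * (?a\<^sup>2 + ?b\<^sup>2 + ?c\<^sup>2)" .
  qed
  also have "\<dots> = stencil_bound \<alpha> * ((gnorm K f2)\<^sup>2 + (gnorm K f1)\<^sup>2 + (gnorm K f0)\<^sup>2)"
    by (simp add: gnorm_sq gavg_linear)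
  finally show ?thesis .
qed

lemma stencil_energy_ge: "(\<alpha> 1)\<^sup>2 * (gnorm K f2)\<^sup>2 \<le> stencil_energy \<alpha> K f2 f1 f0"
  by (simp add: stencil_energy_def gnorm_cmult power_mult_distrib)

text \<open>The increment test. With the successive increments \<open>x\<close>, \<open>y\<close>, \<open>z\<close> the stencil is \<open>11/6 x - 7/6 y + 1/3 z\<close>, and the
coefficient of \<open>x\<^sup>2\<close> exceeds the sum of the two negative ones by \<open>1/3\<close>: this surplus is the dissipation of increments.\<close>

lemma bdf3_difference_test:
  "13/12 * (gnorm K (\<lambda>i j. f3 i j - f2 i j))\<^sup>2 - 7/12 * (gnorm K (\<lambda>i j. f2 i j - f1 i j))\<^sup>2
    - 1/6 * (gnorm K (\<lambda>i j. f1 i j - f0 i j))\<^sup>2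
    \<le> ginner K (bdf3 f3 f2 f1 f0) (\<lambda>i j. f3 i j - f2 i j)"
proof -
  have "13/12 * (a - b)\<^sup>2 - 7/12 * (b - c)\<^sup>2 - 1/6 * (c - d)\<^sup>2
      \<le> (11/6 * a - 3 * b + 3/2 * c - 1/3 * d) * (a - b)" for a b c d :: real
  proof -
    have "(11/6 * a - 3 * b + 3/2 * c - 1/3 * d) * (a - b)
        = 13/12 * (a - b)\<^sup>2 - 7/12 * (b - c)\<^sup>2 - 1/6 * (c - d)\<^sup>2
          + (7/12 * ((a - b) - (b - c))\<^sup>2 + 1/6 * ((a - b) + (c - d))\<^sup>2)"
      by (simp add: power2_eq_square field_simps)
    then show ?thesis
      by simp
  qed
  then have "gavg K (\<lambda>i j. 13/12 * (f3 i j - f2 i j)\<^sup>2 - 7/12 * (f2 i j - f1 i j)\<^sup>2 - 1/6 * (f1 i j - f0 i j)\<^sup>2)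
      \<le> ginner K (bdf3 f3 f2 f1 f0) (\<lambda>i j. f3 i j - f2 i j)"
    unfolding ginner_gavg bdf3_def by (intro gavg_mono)
  then show ?thesis
    by (simp only: gnorm_sq gavg_linear)
qed

lemma ginner_extrapolated_self:
  "2 * (gnorm K f)\<^sup>2 - (gnorm K g)\<^sup>2 \<le> ginner K f (\<lambda>i j. 3 * f i j - 2 * g i j)"
  "3/2 * (gnorm K f)\<^sup>2 - 1/2 * (gnorm K g)\<^sup>2 \<le> ginner K f (\<lambda>i j. 2 * f i j - g i j)"
proof -
  have p: "2 * a\<^sup>2 - b\<^sup>2 \<le> a * (3 * a - 2 * b)" "3/2 * a\<^sup>2 - 1/2 * b\<^sup>2 \<le> a * (2 * a - b)" for a b :: real
    using zero_le_power2[of "a - b"] by (simp_all add: power2_eq_square algebra_simps)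
  have "gavg K (\<lambda>i j. 2 * (f i j)\<^sup>2 - (g i j)\<^sup>2) \<le> ginner K f (\<lambda>i j. 3 * f i j - 2 * g i j)"
    "gavg K (\<lambda>i j. 3/2 * (f i j)\<^sup>2 - 1/2 * (g i j)\<^sup>2) \<le> ginner K f (\<lambda>i j. 2 * f i j - g i j)"
    unfolding ginner_gavg by (intro gavg_mono p)+
  then show "2 * (gnorm K f)\<^sup>2 - (gnorm K g)\<^sup>2 \<le> ginner K f (\<lambda>i j. 3 * f i j - 2 * g i j)"
    "3/2 * (gnorm K f)\<^sup>2 - 1/2 * (gnorm K g)\<^sup>2 \<le> ginner K f (\<lambda>i j. 2 * f i j - g i j)"
    by (simp_all only: gnorm_sq gavg_linear)
qed

lemma young:
  fixes x y s :: real
  assumes "s > 0"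
  shows "x * y \<le> s * x\<^sup>2 + y\<^sup>2 / (4 * s)"
proof -
  have "s * x\<^sup>2 + y\<^sup>2 / (4 * s) - x * y = (2 * s * x - y)\<^sup>2 / (4 * s)"
    using assms by (simp add: power2_eq_square field_simps)
  moreover have "\<dots> \<ge> 0"
    using assms by simp
  ultimately show ?thesis
    by linarith
qed

text \<open>One explicit nonlinear term, with \<open>n\<close> its norm, \<open>c\<close> its extrapolation coefficient and \<open>\<delta>\<close> the norm of the increments
it is tested with. The number 1350 makes the coefficient \<open>9/2 dt A / \<nu>\<close> of \<open>\<delta>\<^sup>2\<close> equal to at most \<open>1/300\<close>.\<close>

lemma advection_absorbed:
  assumes "\<nu> > 0" "dt > 0" "A > 0" "n\<^sup>2 \<le> A * y\<^sup>2" "1350 * (dt * A) \<le> \<nu>" "\<bar>g\<bar> \<le> n * \<delta>" "\<bar>c\<bar> \<le> 3/2" "n * \<delta> \<ge> 0"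
  shows "dt * (c * g) \<le> 1/8 * (\<nu> * dt * y\<^sup>2) + \<delta>\<^sup>2 / (300::real)"
proof -
  have "c * g \<le> \<bar>c\<bar> * \<bar>g\<bar>"
    by (metis abs_ge_self abs_mult)
  also have "\<dots> \<le> 3/2 * (n * \<delta>)"
    using assms by (intro mult_mono) auto
  also have "\<dots> = n * (3/2 * \<delta>)"
    by simp
  also have "\<dots> \<le> \<nu> / (8 * A) * n\<^sup>2 + (3/2 * \<delta>)\<^sup>2 / (4 * (\<nu> / (8 * A)))"
    using assms by (intro young) auto
  also have "\<dots> \<le> \<nu> / (8 * A) * (A * y\<^sup>2) + (3/2 * \<delta>)\<^sup>2 / (4 * (\<nu> / (8 * A)))"
    using assms by (intro add_right_mono mult_left_mono) auto
  also have "\<dots> = 1/8 * (\<nu> * y\<^sup>2) + 9/2 * (A / \<nu>) * \<delta>\<^sup>2"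
    using assms by (simp add: power_mult_distrib power_divide field_simps)
  finally have "dt * (c * g) \<le> dt * (1/8 * (\<nu> * y\<^sup>2) + 9/2 * (A / \<nu>) * \<delta>\<^sup>2)"
    using assms by (intro mult_left_mono) auto
  also have "\<dots> = 1/8 * (\<nu> * dt * y\<^sup>2) + 9/2 * (dt * A / \<nu>) * \<delta>\<^sup>2"
    by (simp add: field_simps)
  also have "9/2 * (dt * A / \<nu>) * \<delta>\<^sup>2 \<le> 9/2 * (1/1350) * \<delta>\<^sup>2"
    using assms by (intro mult_right_mono mult_left_mono) (auto simp: field_simps)
  finally show ?thesis
    by simp
qed

lemma F_init_energy:
  "F_init \<alpha> K \<nu> dt w0 w1 w2 = stencil_energy \<alpha> K w0 w1 w2
   + 7/4 * (\<nu> * dt * (vgnorm K (gradN K w0))\<^sup>2)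
   + 15/32 * (\<nu> * dt * (vgnorm K (gradN K w1))\<^sup>2)
   + 13/64 * (\<nu> * dt * (vgnorm K (gradN K w2))\<^sup>2)
   + 7/8 * (gnorm K (\<lambda>i j. w0 i j - w1 i j))\<^sup>2
   + 5/24 * (gnorm K (\<lambda>i j. w1 i j - w2 i j))\<^sup>2"
  by (simp add: F_init_def stencil_energy_def)

definition scheme_step ::
  "nat \<Rightarrow> real \<Rightarrow> real \<Rightarrow> grid \<Rightarrow> grid \<Rightarrow> grid \<Rightarrow> grid \<Rightarrow> grid \<Rightarrow> grid \<Rightarrow> grid \<Rightarrow> grid \<Rightarrow> bool" where
  "scheme_step K \<nu> dt w3 w2 w1 w0 n2 n1 n0 g \<longleftrightarrow>
     (\<forall>i j. bdf3 w3 w2 w1 w0 i j / dt + 3/2 * n2 i j - 3/2 * n1 i j + 1/2 * n0 i j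
        = \<nu> * lapN K w3 i j + g i j)"

lemma scheme_step_tested:
  assumes "scheme_step K \<nu> dt w3 w2 w1 w0 n2 n1 n0 g" "dt > 0"
  shows "ginner K (bdf3 w3 w2 w1 w0) v = dt * (\<nu> * ginner K (lapN K w3) v + ginner K g v)
    + dt * (-3/2 * ginner K n2 v) + dt * (3/2 * ginner K n1 v) + dt * (-1/2 * ginner K n0 v)"
proof -
  have "bdf3 w3 w2 w1 w0 i j = dt * (\<nu> * lapN K w3 i j + g i j)
      + dt * (-3/2 * n2 i j) + dt * (3/2 * n1 i j) + dt * (-1/2 * n0 i j)" for i j
  proof -
    have "bdf3 w3 w2 w1 w0 i j / dt = \<nu> * lapN K w3 i j + g i j - 3/2 * n2 i j + 3/2 * n1 i j - 1/2 * n0 i j"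
      using assms(1)[unfolded scheme_step_def, rule_format, of i j] by linarith
    then show ?thesis
      using assms(2) by (simp add: nonzero_divide_eq_eq) (simp add: algebra_simps)
  qed
  then have "bdf3 w3 w2 w1 w0 = (\<lambda>i j. dt * (\<nu> * lapN K w3 i j + g i j)
      + dt * (-3/2 * n2 i j) + dt * (3/2 * n1 i j) + dt * (-1/2 * n0 i j))"
    by (intro ext) auto
  then show ?thesis
    by (simp only: ginner_linear)
qed

text \<open>The weights of \<open>F_init\<close> leave room for all error terms. With \<open>Y\<^sub>3, \<dots>, Y\<^sub>0\<close> the squared gradient norms of
\<open>w3, \<dots>, w0\<close> and the factor \<open>\<nu> dt\<close> left out, viscosity gives \<open>2 Y\<^sub>3 - Y\<^sub>2\<close>, while the force
costs \<open>(Y\<^sub>3 + Y\<^sub>2)/8\<close> and the nonlinear terms cost \<open>(Y\<^sub>2 + Y\<^sub>1 + Y\<^sub>0)/8\<close>. Against the weights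
\<open>7/4\<close>, \<open>15/32\<close>, \<open>13/64\<close> this leaves at least \<open>1/64\<close> of each of \<open>Y\<^sub>3\<close>, \<open>Y\<^sub>2\<close>, \<open>Y\<^sub>1\<close>. The squared increments
cost at most \<open>54/300\<close>, \<open>5/300\<close> and \<open>3/300\<close>, which the weights \<open>7/8\<close> and \<open>5/24\<close> allow.\<close>

lemma vorticity_step:
  fixes w3 w2 w1 w0 n2 n1 n0 g :: grid
  assumes st: "stencil_constants \<alpha>" and pos: "\<nu> > 0" "dt > 0" "A > 0"
    and grid: "is_grid K w3" "is_grid K w2" "is_grid K w1" "is_grid K w0"
    and mean: "gavg K w3 = 0" "gavg K w2 = 0"
    and step: "scheme_step K \<nu> dt w3 w2 w1 w0 n2 n1 n0 g"
    and orth: "ginner K n2 w2 = 0" "ginner K n1 w1 = 0" "ginner K n0 w0 = 0"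
    and n: "(gnorm K n2)\<^sup>2 \<le> A * (vgnorm K (gradN K w2))\<^sup>2"
      "(gnorm K n1)\<^sup>2 \<le> A * (vgnorm K (gradN K w1))\<^sup>2"
      "(gnorm K n0)\<^sup>2 \<le> A * (vgnorm K (gradN K w0))\<^sup>2"
    and dtA: "1350 * (dt * A) \<le> \<nu>"
    and g: "gnorm K g \<le> \<phi>"
  shows "F_init \<alpha> K \<nu> dt w3 w2 w1
    + 1/64 * (\<nu> * dt * ((vgnorm K (gradN K w3))\<^sup>2 + (vgnorm K (gradN K w2))\<^sup>2 + (vgnorm K (gradN K w1))\<^sup>2))
    \<le> F_init \<alpha> K \<nu> dt w2 w1 w0 + dt * (\<phi>\<^sup>2 / \<nu>)"
proof -
  let ?V = "\<lambda>i j. 3 * w3 i j - 2 * w2 i j"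
  let ?y = "\<lambda>w. vgnorm K (gradN K w)"
  define Y where "Y = (\<lambda>w. \<nu> * dt * (vgnorm K (gradN K w))\<^sup>2)"
  define D where "D = (\<lambda>v w. (gnorm K (\<lambda>i j. v i j - w i j))\<^sup>2)"
  have D0: "D v w \<ge> 0" for v w
    by (simp add: D_def)
  have Y0: "Y w \<ge> 0" for w
    using pos by (simp add: Y_def)
  have time: "stencil_energy \<alpha> K w3 w2 w1 - stencil_energy \<alpha> K w2 w1 w0
      + 13/12 * D w3 w2 - 7/12 * D w2 w1 - 1/6 * D w1 w0 \<le> ginner K (bdf3 w3 w2 w1 w0) ?V"
  proof -
    have "ginner K (bdf3 w3 w2 w1 w0) ?V = ginner K (bdf3 w3 w2 w1 w0) (\<lambda>i j. 2 * w3 i j - w2 i j)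
        + ginner K (bdf3 w3 w2 w1 w0) (\<lambda>i j. w3 i j - w2 i j)"
      by (simp add: ginner_linear)
    then show ?thesis
      using stencil_energy_step[OF st grid] bdf3_difference_test[of K w3 w2 w1 w0] by (simp add: D_def)
  qed
  have visc: "dt * (\<nu> * ginner K (lapN K w3) ?V) \<le> - 2 * Y w3 + Y w2"
  proof -
    have "DNx K ?V = (\<lambda>i j. 3 * DNx K w3 i j - 2 * DNx K w2 i j)"
      "DNy K ?V = (\<lambda>i j. 3 * DNy K w3 i j - 2 * DNy K w2 i j)"
      by (intro ext; simp add: DN_linear)+
    then have "ginner K (lapN K w3) ?V \<le> - 2 * (?y w3)\<^sup>2 + (?y w2)\<^sup>2"
      using ginner_extrapolated_self(1)[of K "DNx K w3" "DNx K w2"]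
        ginner_extrapolated_self(1)[of K "DNy K w3" "DNy K w2"]
      by (simp add: ginner_lapN vgnorm_sq gradN_def)
    then have "(dt * \<nu>) * ginner K (lapN K w3) ?V \<le> (dt * \<nu>) * (- 2 * (?y w3)\<^sup>2 + (?y w2)\<^sup>2)"
      using pos by (intro mult_left_mono) auto
    then show ?thesis
      by (simp add: Y_def algebra_simps)
  qed
  have force: "dt * ginner K g ?V \<le> 1/8 * Y w3 + 1/8 * Y w2 + dt * (\<phi>\<^sup>2 / \<nu>)"
  proof -
    have "gnorm K ?V \<le> 3 * gnorm K w3 + 2 * gnorm K w2"
      using gnorm_diff_le[of K "\<lambda>i j. 3 * w3 i j" "\<lambda>i j. 2 * w2 i j"] by (simp add: gnorm_cmult)
    also have "\<dots> \<le> 1/2 * (?y w3 + ?y w2)"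
      using gnorm_le_grad[OF mean(1)] gnorm_le_grad[OF mean(2)] gnorm_nonneg[of K w2] by simp
    finally have V: "gnorm K ?V \<le> 1/2 * (?y w3 + ?y w2)" .
    have "ginner K g ?V \<le> gnorm K g * gnorm K ?V"
      using ginner_le[of K g ?V] by simp
    also have "\<dots> \<le> \<phi> * (1/2 * (?y w3 + ?y w2))"
      using g V gnorm_nonneg[of K g] gnorm_nonneg[of K ?V] by (intro mult_mono) auto
    also have "\<dots> = ?y w3 * (\<phi> / 2) + ?y w2 * (\<phi> / 2)"
      by (simp add: algebra_simps)
    also have "\<dots> \<le> (\<nu> / 8 * (?y w3)\<^sup>2 + (\<phi> / 2)\<^sup>2 / (4 * (\<nu> / 8))) + (\<nu> / 8 * (?y w2)\<^sup>2 + (\<phi> / 2)\<^sup>2 / (4 * (\<nu> / 8)))"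
      using pos by (intro add_mono young) auto
    also have "\<dots> = 1/8 * (\<nu> * (?y w3)\<^sup>2) + 1/8 * (\<nu> * (?y w2)\<^sup>2) + \<phi>\<^sup>2 / \<nu>"
      by (simp add: power_divide)
    finally have "dt * ginner K g ?V \<le> dt * (1/8 * (\<nu> * (?y w3)\<^sup>2) + 1/8 * (\<nu> * (?y w2)\<^sup>2) + \<phi>\<^sup>2 / \<nu>)"
      using pos by (intro mult_left_mono) auto
    then show ?thesis
      by (simp add: Y_def algebra_simps)
  qed
  \<comment> \<open>Orthogonality replaces the test function by its difference to the time level of the nonlinear term.\<close>
  have adv: "dt * (c * ginner K n ?V) \<le> 1/8 * Y w + (gnorm K (\<lambda>i j. ?V i j - w i j))\<^sup>2 / 300"
    if "ginner K n w = 0" "(gnorm K n)\<^sup>2 \<le> A * (?y w)\<^sup>2" "\<bar>c\<bar> \<le> 3/2" for c n w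
  proof -
    have "ginner K n ?V = ginner K n (\<lambda>i j. ?V i j - w i j)"
      using that(1) by (simp only: ginner_diff_right diff_0_right)
    then have "\<bar>ginner K n ?V\<bar> \<le> gnorm K n * gnorm K (\<lambda>i j. ?V i j - w i j)"
      using ginner_le[of K n "\<lambda>i j. ?V i j - w i j"] by (simp only:)
    from advection_absorbed[OF pos that(2) dtA this that(3)] show ?thesis
      by (simp add: Y_def gnorm_nonneg)
  qed
  have d2: "(gnorm K (\<lambda>i j. ?V i j - w2 i j))\<^sup>2 = 9 * D w3 w2"
  proof -
    have eq: "(\<lambda>i j. ?V i j - w2 i j) = (\<lambda>i j. 3 * (w3 i j - w2 i j))"
      by (intro ext) simp
    show ?thesis
      unfolding eq gnorm_cmult D_def power_mult_distrib by simp
  qed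
  have d1: "(gnorm K (\<lambda>i j. ?V i j - w1 i j))\<^sup>2 \<le> 18 * D w3 w2 + 2 * D w2 w1"
  proof -
    have "gavg K (\<lambda>i j. (?V i j - w1 i j)\<^sup>2) \<le> gavg K (\<lambda>i j. 18 * (w3 i j - w2 i j)\<^sup>2 + 2 * (w2 i j - w1 i j)\<^sup>2)"
    proof (rule gavg_mono)
      fix i j
      have "?V i j - w1 i j = 3 * (w3 i j - w2 i j) + (w2 i j - w1 i j)"
        by simp
      then show "(?V i j - w1 i j)\<^sup>2 \<le> 18 * (w3 i j - w2 i j)\<^sup>2 + 2 * (w2 i j - w1 i j)\<^sup>2"
        using sq_sum2_le[of "3 * (w3 i j - w2 i j)" "w2 i j - w1 i j"]
        by (simp only: power_mult_distrib) simp
    qed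
    then show ?thesis
      by (simp only: D_def gnorm_sq gavg_linear)
  qed
  have d0: "(gnorm K (\<lambda>i j. ?V i j - w0 i j))\<^sup>2 \<le> 27 * D w3 w2 + 3 * D w2 w1 + 3 * D w1 w0"
  proof -
    have "gavg K (\<lambda>i j. (?V i j - w0 i j)\<^sup>2) \<le> gavg K (\<lambda>i j. 27 * (w3 i j - w2 i j)\<^sup>2
        + 3 * (w2 i j - w1 i j)\<^sup>2 + 3 * (w1 i j - w0 i j)\<^sup>2)"
    proof (rule gavg_mono)
      fix i j
      have "?V i j - w0 i j = 3 * (w3 i j - w2 i j) + (w2 i j - w1 i j) + (w1 i j - w0 i j)"
        by simp
      then show "(?V i j - w0 i j)\<^sup>2 \<le> 27 * (w3 i j - w2 i j)\<^sup>2 + 3 * (w2 i j - w1 i j)\<^sup>2 + 3 * (w1 i j - w0 i j)\<^sup>2"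
        using sq_sum3_le[of "3 * (w3 i j - w2 i j)" "w2 i j - w1 i j" "w1 i j - w0 i j"]
        by (simp only: power_mult_distrib) simp
    qed
    then show ?thesis
      by (simp only: D_def gnorm_sq gavg_linear)
  qed
  have c: "\<bar>-3/2\<bar> \<le> (3/2 :: real)" "\<bar>3/2\<bar> \<le> (3/2 :: real)" "\<bar>-1/2\<bar> \<le> (3/2 :: real)"
    by simp_all
  let ?s = "\<lambda>w. (gnorm K (\<lambda>i j. ?V i j - w i j))\<^sup>2"
  have "ginner K (bdf3 w3 w2 w1 w0) ?V \<le> (- 2 * Y w3 + Y w2) + (1/8 * Y w3 + 1/8 * Y w2 + dt * (\<phi>\<^sup>2 / \<nu>))
     + (1/8 * Y w2 + ?s w2 / 300) + (1/8 * Y w1 + ?s w1 / 300) + (1/8 * Y w0 + ?s w0 / 300)"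
    unfolding scheme_step_tested[OF step pos(2), of ?V] distrib_left[of dt]
    by (intro add_mono visc force adv[OF orth(1) n(1) c(1)] adv[OF orth(2) n(2) c(2)] adv[OF orth(3) n(3) c(3)])
  also have "\<dots> \<le> (- 2 * Y w3 + Y w2) + (1/8 * Y w3 + 1/8 * Y w2 + dt * (\<phi>\<^sup>2 / \<nu>))
     + (1/8 * Y w2 + 3/100 * D w3 w2)
     + (1/8 * Y w1 + (6/100 * D w3 w2 + 2/300 * D w2 w1))
     + (1/8 * Y w0 + (9/100 * D w3 w2 + 1/100 * D w2 w1 + 1/100 * D w1 w0))"
    using d2 d1 d0 by (intro add_mono order_refl; linarith)
  finally have "ginner K (bdf3 w3 w2 w1 w0) ?V \<le> \<dots>" .
  moreover have fold: "\<nu> * dt * (vgnorm K (gradN K w))\<^sup>2 = Y w" "(gnorm K (\<lambda>i j. v i j - w i j))\<^sup>2 = D v w" for v w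
    by (simp_all add: Y_def D_def)
  ultimately show ?thesis
    unfolding F_init_energy distrib_left fold
    using time D0[of w3 w2] D0[of w2 w1] D0[of w1 w0] Y0[of w3] Y0[of w2] Y0[of w1] Y0[of w0]
    by linarith
qed

section \<open>One step of the scheme: the gradient\<close>

text \<open>The part of \<open>G_init\<close> that the gradient estimate propagates: its weights \<open>1\<close>, \<open>1/3\<close>, \<open>1/6\<close> lie below those of \<open>G_init\<close>,
and it carries no increments, because the nonlinear term is not treated by orthogonality here.\<close>

definition grad_energy :: "(nat \<Rightarrow> real) \<Rightarrow> nat \<Rightarrow> real \<Rightarrow> real \<Rightarrow> grid \<Rightarrow> grid \<Rightarrow> grid \<Rightarrow> real" where
  "grad_energy \<alpha> K \<nu> dt w0 w1 w2 =
     stencil_energy \<alpha> K (DNx K w0) (DNx K w1) (DNx K w2)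
   + stencil_energy \<alpha> K (DNy K w0) (DNy K w1) (DNy K w2)
   + \<nu> * dt * (gnorm K (lapN K w0))\<^sup>2 + 1/3 * (\<nu> * dt * (gnorm K (lapN K w1))\<^sup>2)
   + 1/6 * (\<nu> * dt * (gnorm K (lapN K w2))\<^sup>2)"

lemma grad_energy_le_G_init:
  assumes "\<nu> > 0" "dt > 0"
  shows "grad_energy \<alpha> K \<nu> dt w0 w1 w2 \<le> G_init \<alpha> K \<nu> dt w0 w1 w2"
proof -
  define Z where "Z w = \<nu> * dt * (gnorm K (lapN K w))\<^sup>2" for w
  have Z0: "Z w \<ge> 0" for w
    using assms by (simp add: Z_def)
  have D: "DNx K (\<lambda>i j. \<alpha> 2 * w0 i j + \<alpha> 3 * w1 i j) = (\<lambda>i j. \<alpha> 2 * DNx K w0 i j + \<alpha> 3 * DNx K w1 i j)"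
    "DNy K (\<lambda>i j. \<alpha> 2 * w0 i j + \<alpha> 3 * w1 i j) = (\<lambda>i j. \<alpha> 2 * DNy K w0 i j + \<alpha> 3 * DNy K w1 i j)"
    "DNx K (\<lambda>i j. \<alpha> 4 * w0 i j + \<alpha> 5 * w1 i j + \<alpha> 6 * w2 i j) =
      (\<lambda>i j. \<alpha> 4 * DNx K w0 i j + \<alpha> 5 * DNx K w1 i j + \<alpha> 6 * DNx K w2 i j)"
    "DNy K (\<lambda>i j. \<alpha> 4 * w0 i j + \<alpha> 5 * w1 i j + \<alpha> 6 * w2 i j) =
      (\<lambda>i j. \<alpha> 4 * DNy K w0 i j + \<alpha> 5 * DNy K w1 i j + \<alpha> 6 * DNy K w2 i j)"
    by (intro ext; simp only: DN_linear)+
  have "G_init \<alpha> K \<nu> dt w0 w1 w2 = stencil_energy \<alpha> K (DNx K w0) (DNx K w1) (DNx K w2)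
      + stencil_energy \<alpha> K (DNy K w0) (DNy K w1) (DNy K w2)
      + 37/24 * Z w0 + 17/48 * Z w1 + 17/96 * Z w2
      + 5/6 * (vgnorm K (gradN K (\<lambda>i j. w0 i j - w1 i j)))\<^sup>2
      + 1/6 * (vgnorm K (gradN K (\<lambda>i j. w1 i j - w2 i j)))\<^sup>2"
    unfolding G_init_def stencil_energy_def gradN_def[of K "\<lambda>i j. \<alpha> 2 * w0 i j + \<alpha> 3 * w1 i j"]
      gradN_def[of K "\<lambda>i j. \<alpha> 4 * w0 i j + \<alpha> 5 * w1 i j + \<alpha> 6 * w2 i j"] D
    by (simp add: vgnorm_sq[of K "(_, _)"] Z_def)
  then show ?thesis
    using Z0[of w0] Z0[of w1] Z0[of w2] zero_le_power2[of "vgnorm K (gradN K (\<lambda>i j. w0 i j - w1 i j))"]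
      zero_le_power2[of "vgnorm K (gradN K (\<lambda>i j. w1 i j - w2 i j))"]
    unfolding grad_energy_def Z_def[symmetric] by linarith
qed

lemma is_grid_DN: "is_grid K (DNx K f)" "is_grid K (DNy K f)"
proof -
  have "fmode k l (grid_pt K (i + mesh_N K) j) = fmode k l (grid_pt K i j)"
    "fmode k l (grid_pt K i (j + mesh_N K)) = fmode k l (grid_pt K i j)" for k l i j
  proof -
    have h: "of_int (mesh_N K) * mesh_h K = 1"
      using mesh_N_pos[of K] by (simp add: mesh_h_def)
    have "fmode k l (grid_pt K (i + mesh_N K) j) = fmode k l (grid_pt K i j) * cis (2 * pi * of_int (k * 1))"
      "fmode k l (grid_pt K i (j + mesh_N K)) = fmode k l (grid_pt K i j) * cis (2 * pi * of_int (l * 1))"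
      unfolding fmode_def cis_mult grid_pt_def
      by (intro arg_cong[of _ _ cis]; simp add: distrib_right h; simp add: algebra_simps)+
    then show "fmode k l (grid_pt K (i + mesh_N K) j) = fmode k l (grid_pt K i j)"
      "fmode k l (grid_pt K i (j + mesh_N K)) = fmode k l (grid_pt K i j)"
      by (simp_all only: cis_multiple_2pi Ints_of_int mult_1_right)
  qed
  then show "is_grid K (DNx K f)" "is_grid K (DNy K f)"
    by (simp_all add: is_grid_def DNx_def DNy_def trigsum_def)
qed

text \<open>With \<open>Z\<^sub>3, \<dots>, Z\<^sub>0\<close> the squared norms of the Laplacians and the factor \<open>\<nu> dt\<close> left out, viscosity gives
\<open>3/2 Z\<^sub>3 - 1/2 Z\<^sub>2\<close>. The right-hand side costs \<open>(Z\<^sub>3 + 2 Z\<^sub>2 + Z\<^sub>1 + Z\<^sub>0)/16\<close>; the fraction \<open>1/2880\<close> is chosen for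
this, as \<open>20 \<cdot> 9 / 2880 = 1/16\<close>. Against the weights \<open>1\<close>, \<open>1/3\<close>, \<open>1/6\<close> at least \<open>1/24\<close> of each of
\<open>Z\<^sub>3\<close>, \<open>Z\<^sub>2\<close>, \<open>Z\<^sub>1\<close> remains.\<close>

lemma gradient_step:
  fixes w3 w2 w1 w0 n2 n1 n0 g :: grid
  assumes st: "stencil_constants \<alpha>" and pos: "\<nu> > 0" "dt > 0"
    and step: "scheme_step K \<nu> dt w3 w2 w1 w0 n2 n1 n0 g"
    and n: "(gnorm K n2)\<^sup>2 \<le> \<nu>\<^sup>2 / 2880 * (gnorm K (lapN K w2))\<^sup>2 + \<Gamma>"
      "(gnorm K n1)\<^sup>2 \<le> \<nu>\<^sup>2 / 2880 * (gnorm K (lapN K w1))\<^sup>2 + \<Gamma>"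
      "(gnorm K n0)\<^sup>2 \<le> \<nu>\<^sup>2 / 2880 * (gnorm K (lapN K w0))\<^sup>2 + \<Gamma>"
    and g: "gnorm K g \<le> \<phi>"
  shows "grad_energy \<alpha> K \<nu> dt w3 w2 w1
    + 1/24 * (\<nu> * dt * ((gnorm K (lapN K w3))\<^sup>2 + (gnorm K (lapN K w2))\<^sup>2 + (gnorm K (lapN K w1))\<^sup>2))
    \<le> grad_energy \<alpha> K \<nu> dt w2 w1 w0 + dt * ((540 * \<Gamma> + 80 * \<phi>\<^sup>2) / \<nu>)"
proof -
  let ?V = "\<lambda>i j. 2 * w3 i j - w2 i j"
  let ?z = "\<lambda>w. gnorm K (lapN K w)"
  define Z where "Z w = \<nu> * dt * (gnorm K (lapN K w))\<^sup>2" for w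
  have Z0: "Z w \<ge> 0" for w
    using pos by (simp add: Z_def)
  let ?E = "\<lambda>w v u. stencil_energy \<alpha> K (DNx K w) (DNx K v) (DNx K u) + stencil_energy \<alpha> K (DNy K w) (DNy K v) (DNy K u)"
  have DV: "DNx K ?V = (\<lambda>i j. 2 * DNx K w3 i j - DNx K w2 i j)"
    "DNy K ?V = (\<lambda>i j. 2 * DNy K w3 i j - DNy K w2 i j)"
    by (intro ext; simp only: DN_linear)+
  have lapV: "lapN K ?V = (\<lambda>i j. 2 * lapN K w3 i j - lapN K w2 i j)"
    by (intro ext) (simp add: lapN_def DV DN_linear algebra_simps)
  have time: "?E w3 w2 w1 - ?E w2 w1 w0 \<le> - ginner K (bdf3 w3 w2 w1 w0) (lapN K ?V)"
  proof -
    have "DNx K (bdf3 w3 w2 w1 w0) = bdf3 (DNx K w3) (DNx K w2) (DNx K w1) (DNx K w0)"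
      "DNy K (bdf3 w3 w2 w1 w0) = bdf3 (DNy K w3) (DNy K w2) (DNy K w1) (DNy K w0)"
      unfolding bdf3_def by (intro ext; simp only: DN_linear)+
    then have "- ginner K (bdf3 w3 w2 w1 w0) (lapN K ?V) =
        ginner K (bdf3 (DNx K w3) (DNx K w2) (DNx K w1) (DNx K w0)) (DNx K ?V)
      + ginner K (bdf3 (DNy K w3) (DNy K w2) (DNy K w1) (DNy K w0)) (DNy K ?V)"
      by (simp add: ginner_commute[of K "bdf3 w3 w2 w1 w0"] ginner_lapN ginner_commute[of K "DNx K ?V"]
          ginner_commute[of K "DNy K ?V"])
    then show ?thesis
      using stencil_energy_step[OF st is_grid_DN(1) is_grid_DN(1) is_grid_DN(1) is_grid_DN(1), of K w3 w2 w1 w0]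
        stencil_energy_step[OF st is_grid_DN(2) is_grid_DN(2) is_grid_DN(2) is_grid_DN(2), of K w3 w2 w1 w0]
      unfolding DV by linarith
  qed
  have visc: "3/2 * Z w3 - 1/2 * Z w2 \<le> dt * (\<nu> * ginner K (lapN K w3) (lapN K ?V))"
  proof -
    have "(dt * \<nu>) * (3/2 * (?z w3)\<^sup>2 - 1/2 * (?z w2)\<^sup>2) \<le> (dt * \<nu>) * ginner K (lapN K w3) (lapN K ?V)"
      unfolding lapV using pos by (intro mult_left_mono ginner_extrapolated_self(2)) auto
    then show ?thesis
      by (simp add: Z_def algebra_simps)
  qed
  define X where "X = \<phi> + 3/2 * gnorm K n2 + 3/2 * gnorm K n1 + 1/2 * gnorm K n0"
  have V: "gnorm K (lapN K ?V) \<le> 2 * ?z w3 + ?z w2"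
    using gnorm_diff_le[of K "\<lambda>i j. 2 * lapN K w3 i j" "lapN K w2"] by (simp add: lapV gnorm_cmult)
  have X2: "X\<^sup>2 \<le> \<nu>\<^sup>2 / 320 * ((?z w2)\<^sup>2 + (?z w1)\<^sup>2 + (?z w0)\<^sup>2) + 27 * \<Gamma> + 4 * \<phi>\<^sup>2"
  proof -
    have "X\<^sup>2 \<le> 2 * (\<phi> + 3/2 * gnorm K n2)\<^sup>2 + 2 * (3/2 * gnorm K n1 + 1/2 * gnorm K n0)\<^sup>2"
      unfolding X_def using sq_sum2_le[of "\<phi> + 3/2 * gnorm K n2"] by (simp only: add.assoc)
    also have "\<dots> \<le> 2 * (2 * \<phi>\<^sup>2 + 2 * (3/2 * gnorm K n2)\<^sup>2) + 2 * (2 * (3/2 * gnorm K n1)\<^sup>2 + 2 * (1/2 * gnorm K n0)\<^sup>2)"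
      by (intro add_mono mult_left_mono sq_sum2_le) auto
    also have "\<dots> = 4 * \<phi>\<^sup>2 + 9 * (gnorm K n2)\<^sup>2 + 9 * (gnorm K n1)\<^sup>2 + (gnorm K n0)\<^sup>2"
      by (simp add: power_mult_distrib power_divide)
    also have "\<dots> \<le> 4 * \<phi>\<^sup>2 + 9 * (gnorm K n2)\<^sup>2 + 9 * (gnorm K n1)\<^sup>2 + 9 * (gnorm K n0)\<^sup>2"
      by simp
    also have "\<dots> \<le> 4 * \<phi>\<^sup>2 + 9 * (\<nu>\<^sup>2 / 2880 * (?z w2)\<^sup>2 + \<Gamma>) + 9 * (\<nu>\<^sup>2 / 2880 * (?z w1)\<^sup>2 + \<Gamma>)
        + 9 * (\<nu>\<^sup>2 / 2880 * (?z w0)\<^sup>2 + \<Gamma>)"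
      by (intro add_mono mult_left_mono n) auto
    also have "\<dots> = \<nu>\<^sup>2 / 320 * ((?z w2)\<^sup>2 + (?z w1)\<^sup>2 + (?z w0)\<^sup>2) + 27 * \<Gamma> + 4 * \<phi>\<^sup>2"
      by (simp add: algebra_simps)
    finally show ?thesis .
  qed
  have rest: "- (ginner K g (lapN K ?V) - 3/2 * ginner K n2 (lapN K ?V) + 3/2 * ginner K n1 (lapN K ?V)
      - 1/2 * ginner K n0 (lapN K ?V))
      \<le> \<nu> / 16 * (?z w3)\<^sup>2 + \<nu> / 16 * (?z w2)\<^sup>2 + 20 * (X\<^sup>2 / \<nu>)"
  proof -
    let ?v = "gnorm K (lapN K ?V)"
    have "\<bar>ginner K g (lapN K ?V)\<bar> \<le> \<phi> * ?v"
      using ginner_le[of K g "lapN K ?V"] mult_right_mono[OF g gnorm_nonneg[of K "lapN K ?V"]] by linarith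
    then have "- (ginner K g (lapN K ?V) - 3/2 * ginner K n2 (lapN K ?V) + 3/2 * ginner K n1 (lapN K ?V)
        - 1/2 * ginner K n0 (lapN K ?V)) \<le> X * ?v"
      using ginner_le[of K n2 "lapN K ?V"] ginner_le[of K n1 "lapN K ?V"] ginner_le[of K n0 "lapN K ?V"]
      unfolding X_def distrib_right mult.assoc by linarith
    also have "\<dots> \<le> X * (2 * ?z w3 + ?z w2)"
    proof (intro mult_left_mono V)
      show "0 \<le> X"
        unfolding X_def using g gnorm_nonneg[of K g] gnorm_nonneg[of K n2] gnorm_nonneg[of K n1]
          gnorm_nonneg[of K n0] by linarith
    qed
    also have "\<dots> = ?z w3 * (2 * X) + ?z w2 * X"
      by (simp add: algebra_simps)
    also have "\<dots> \<le> (\<nu> / 16 * (?z w3)\<^sup>2 + (2 * X)\<^sup>2 / (4 * (\<nu> / 16))) + (\<nu> / 16 * (?z w2)\<^sup>2 + X\<^sup>2 / (4 * (\<nu> / 16)))"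
      using pos by (intro add_mono young) auto
    also have "\<dots> = \<nu> / 16 * (?z w3)\<^sup>2 + \<nu> / 16 * (?z w2)\<^sup>2 + 20 * (X\<^sup>2 / \<nu>)"
      by (simp add: power_mult_distrib)
    finally show ?thesis .
  qed
  have "20 * (X\<^sup>2 / \<nu>) \<le> 20 * ((\<nu>\<^sup>2 / 320 * ((?z w2)\<^sup>2 + (?z w1)\<^sup>2 + (?z w0)\<^sup>2) + 27 * \<Gamma> + 4 * \<phi>\<^sup>2) / \<nu>)"
    using pos X2 by (intro mult_left_mono divide_right_mono) auto
  also have "\<dots> = \<nu> / 16 * (?z w2)\<^sup>2 + \<nu> / 16 * (?z w1)\<^sup>2 + \<nu> / 16 * (?z w0)\<^sup>2 + (540 * \<Gamma> + 80 * \<phi>\<^sup>2) / \<nu>"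
    using pos by (simp add: power2_eq_square field_simps)
  finally have "- (ginner K g (lapN K ?V) - 3/2 * ginner K n2 (lapN K ?V) + 3/2 * ginner K n1 (lapN K ?V)
      - 1/2 * ginner K n0 (lapN K ?V))
      \<le> \<nu> / 16 * (?z w3)\<^sup>2 + \<nu> / 16 * (?z w2)\<^sup>2
        + (\<nu> / 16 * (?z w2)\<^sup>2 + \<nu> / 16 * (?z w1)\<^sup>2 + \<nu> / 16 * (?z w0)\<^sup>2 + (540 * \<Gamma> + 80 * \<phi>\<^sup>2) / \<nu>)"
    using rest by linarith
  then have "dt * - (ginner K g (lapN K ?V) - 3/2 * ginner K n2 (lapN K ?V) + 3/2 * ginner K n1 (lapN K ?V)
      - 1/2 * ginner K n0 (lapN K ?V))
      \<le> dt * (\<nu> / 16 * (?z w3)\<^sup>2 + \<nu> / 16 * (?z w2)\<^sup>2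
        + (\<nu> / 16 * (?z w2)\<^sup>2 + \<nu> / 16 * (?z w1)\<^sup>2 + \<nu> / 16 * (?z w0)\<^sup>2 + (540 * \<Gamma> + 80 * \<phi>\<^sup>2) / \<nu>))"
    using pos by (intro mult_left_mono) auto
  then have R: "dt * - (ginner K g (lapN K ?V) - 3/2 * ginner K n2 (lapN K ?V) + 3/2 * ginner K n1 (lapN K ?V)
      - 1/2 * ginner K n0 (lapN K ?V))
      \<le> 1/16 * Z w3 + 1/8 * Z w2 + 1/16 * Z w1 + 1/16 * Z w0 + dt * ((540 * \<Gamma> + 80 * \<phi>\<^sup>2) / \<nu>)"
    unfolding Z_def by (simp add: distrib_left mult_ac)
  have "- ginner K (bdf3 w3 w2 w1 w0) (lapN K ?V) = - (dt * (\<nu> * ginner K (lapN K w3) (lapN K ?V)))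
    + dt * - (ginner K g (lapN K ?V) - 3/2 * ginner K n2 (lapN K ?V) + 3/2 * ginner K n1 (lapN K ?V)
      - 1/2 * ginner K n0 (lapN K ?V))"
    unfolding scheme_step_tested[OF step pos(2)] by (simp add: algebra_simps)
  then show ?thesis
    using time visc R Z0[of w3] Z0[of w2] Z0[of w1] Z0[of w0]
    unfolding grad_energy_def distrib_left Z_def[symmetric] by linarith
qed

section \<open>Energies, dissipation and decay\<close>

text \<open>By the Poincare inequality the gradients dominate the whole energy. The remainder of the gradients in
\<open>vorticity_step\<close> is therefore a fixed fraction of the energy, which is what turns monotonicity into decay. The same
holds one derivative higher in \<open>grad_energy_le\<close>.\<close>

lemma F_init_le:
  assumes "0 < \<nu> * dt" "\<nu> * dt \<le> 1"
    and "gavg K w0 = 0" "gavg K w1 = 0" "gavg K w2 = 0"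
  shows "F_init \<alpha> K \<nu> dt w0 w1 w2 \<le> (stencil_bound \<alpha> + 6) *
    ((vgnorm K (gradN K w0))\<^sup>2 + (vgnorm K (gradN K w1))\<^sup>2 + (vgnorm K (gradN K w2))\<^sup>2)"
proof -
  let ?W = "\<lambda>w. (gnorm K w)\<^sup>2" and ?Y = "\<lambda>w. (vgnorm K (gradN K w))\<^sup>2"
  have W: "?W w0 \<le> ?Y w0" "?W w1 \<le> ?Y w1" "?W w2 \<le> ?Y w2"
    by (intro gnorm_sq_le_grad assms)+
  have d: "(gnorm K (\<lambda>i j. v i j - w i j))\<^sup>2 \<le> 2 * ?W v + 2 * ?W w" for v w
  proof -
    have "gavg K (\<lambda>i j. (v i j - w i j)\<^sup>2) \<le> gavg K (\<lambda>i j. 2 * (v i j)\<^sup>2 + 2 * (w i j)\<^sup>2)"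
      using sq_sum2_le[of _ "- _"] by (intro gavg_mono) simp
    then show ?thesis
      by (simp only: gnorm_sq gavg_linear)
  qed
  have Y1: "\<nu> * dt * ?Y w \<le> ?Y w" for w
    using mult_right_mono[OF assms(2), of "?Y w"] by simp
  have "stencil_energy \<alpha> K w0 w1 w2 \<le> stencil_bound \<alpha> * (?Y w0 + ?Y w1 + ?Y w2)"
    using stencil_energy_le[of \<alpha> K w0 w1 w2] mult_left_mono[OF _ stencil_bound_nonneg[of \<alpha>],
      of "?W w0 + ?W w1 + ?W w2" "?Y w0 + ?Y w1 + ?Y w2"] W by linarith
  then show ?thesis
    using d[of w0 w1] d[of w1 w2] Y1[of w0] Y1[of w1] Y1[of w2] W
      zero_le_power2[of "gnorm K w0"] zero_le_power2[of "gnorm K w1"] zero_le_power2[of "gnorm K w2"]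
    unfolding F_init_energy distrib_right[of "stencil_bound \<alpha>"] distrib_left
    by linarith
qed

lemma grad_energy_le:
  assumes "0 < \<nu> * dt" "\<nu> * dt \<le> 1"
  shows "grad_energy \<alpha> K \<nu> dt w0 w1 w2 \<le> (stencil_bound \<alpha> + 6) *
    ((gnorm K (lapN K w0))\<^sup>2 + (gnorm K (lapN K w1))\<^sup>2 + (gnorm K (lapN K w2))\<^sup>2)"
proof -
  let ?Z = "\<lambda>w. (gnorm K (lapN K w))\<^sup>2" and ?Y = "\<lambda>w. (vgnorm K (gradN K w))\<^sup>2"
  have Z1: "\<nu> * dt * ?Z w \<le> ?Z w" for w
    using mult_right_mono[OF assms(2), of "?Z w"] by simp
  have "stencil_energy \<alpha> K (DNx K w0) (DNx K w1) (DNx K w2) + stencil_energy \<alpha> K (DNy K w0) (DNy K w1) (DNy K w2)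
      \<le> stencil_bound \<alpha> * (?Y w0 + ?Y w1 + ?Y w2)"
    using stencil_energy_le[of \<alpha> K "DNx K w0" "DNx K w1" "DNx K w2"]
      stencil_energy_le[of \<alpha> K "DNy K w0" "DNy K w1" "DNy K w2"]
    by (simp add: vgnorm_sq gradN_def algebra_simps)
  moreover have "stencil_bound \<alpha> * (?Y w0 + ?Y w1 + ?Y w2) \<le> stencil_bound \<alpha> * (?Z w0 + ?Z w1 + ?Z w2)"
    by (intro mult_left_mono add_mono grad_sq_le_lap stencil_bound_nonneg)
  ultimately show ?thesis
    using Z1[of w0] Z1[of w1] Z1[of w2]
      zero_le_power2[of "gnorm K (lapN K w0)"] zero_le_power2[of "gnorm K (lapN K w1)"]
      zero_le_power2[of "gnorm K (lapN K w2)"]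
    unfolding grad_energy_def distrib_right[of "stencil_bound \<alpha>"] distrib_left
    by linarith
qed

lemma F_init_ge:
  assumes "\<nu> > 0" "dt > 0"
  shows "(\<alpha> 1)\<^sup>2 * (gnorm K w0)\<^sup>2 \<le> F_init \<alpha> K \<nu> dt w0 w1 w2"
  using stencil_energy_ge[of \<alpha> K w0 w1 w2] assms unfolding F_init_energy
  by (simp add: add_increasing2)

lemma grad_energy_ge:
  assumes "\<nu> > 0" "dt > 0"
  shows "(\<alpha> 1)\<^sup>2 * (vgnorm K (gradN K w0))\<^sup>2 \<le> grad_energy \<alpha> K \<nu> dt w0 w1 w2"
proof -
  have Z: "0 \<le> \<nu> * dt * (gnorm K (lapN K w))\<^sup>2" for w
    using assms by simp
  show ?thesis
    using stencil_energy_ge[of \<alpha> K "DNx K w0" "DNx K w1" "DNx K w2"]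
      stencil_energy_ge[of \<alpha> K "DNy K w0" "DNy K w1" "DNy K w2"] Z[of w0] Z[of w1] Z[of w2]
    unfolding grad_energy_def vgnorm_sq gradN_def fst_conv snd_conv distrib_left
    by linarith
qed

lemma geometric_decay:
  fixes x :: "nat \<Rightarrow> real"
  assumes b: "b > 0" and c: "c \<ge> 0" and step: "\<And>n. n < m \<Longrightarrow> (1 + b) * x (Suc n) \<le> x n + b * c"
  shows "n \<le> m \<Longrightarrow> x n \<le> (1 + b) powr (- real n) * x 0 + c"
proof (induction n)
  case 0
  then show ?case
    using b c by simp
next
  case (Suc n)
  have "(1 + b) * x (Suc n) \<le> ((1 + b) powr (- real n) * x 0 + c) + b * c"
    using step[of n] Suc by simp
  also have "\<dots> = (1 + b) * ((1 + b) powr (- real (Suc n)) * x 0 + c)"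
  proof -
    have "(1 + b) powr (- real n) = (1 + b) powr (1 + - real (Suc n))"
      by simp
    also have "\<dots> = (1 + b) * (1 + b) powr (- real (Suc n))"
      unfolding powr_add using b by simp
    finally show ?thesis
      by (simp only: distrib_left mult.assoc) (simp add: algebra_simps)
  qed
  finally show ?case
    using b by simp
qed

lemma nonlinN_le_quadratic:
  assumes "kinematic K w \<psi> u" "vgnorm K (gradN K w) \<le> M"
  shows "(gnorm K (nonlinN K u w))\<^sup>2 \<le> 100 * lattice_const * M\<^sup>2 * (vgnorm K (gradN K w))\<^sup>2"
proof -
  define y where "y = vgnorm K (gradN K w)"
  have y: "0 \<le> y" "y \<le> M"
    using assms vgnorm_nonneg by (auto simp: y_def)
  have "gnorm K w \<le> y"
    using gnorm_le_grad[OF kinematic_mean(1)[OF assms(1)]] gnorm_nonneg[of K w] by (simp add: y_def)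
  then have "y ^ 3 * gnorm K w \<le> y ^ 3 * y"
    using y by (intro mult_left_mono) auto
  also have "\<dots> = y\<^sup>2 * y\<^sup>2"
    by (simp add: power2_eq_square power3_eq_cube)
  also have "\<dots> \<le> M\<^sup>2 * y\<^sup>2"
    using y by (intro mult_right_mono power_mono) auto
  finally have "100 * lattice_const * (y ^ 3 * gnorm K w) \<le> 100 * lattice_const * (M\<^sup>2 * y\<^sup>2)"
    using lattice_const_pos by (intro mult_left_mono) auto
  then show ?thesis
    using nonlinN_le[OF assms(1)] by (simp add: y_def mult.assoc)
qed

text \<open>The constant left by Young's inequality \<open>b y\<^sup>3 \<le> e y\<^sup>4 + b\<^sup>4 / e\<^sup>3\<close>, with \<open>b = 100 C L\<close> for the lattice
constant \<open>C\<close> and with \<open>e = \<nu>\<^sup>2 / (2880 L\<^sup>2)\<close>.\<close>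

definition sublinear_const :: "real \<Rightarrow> real \<Rightarrow> real" where
  "sublinear_const \<nu> L = (100 * lattice_const * L) ^ 4 / (\<nu>\<^sup>2 / (2880 * L\<^sup>2)) ^ 3"

text \<open>If the vorticity is bounded by \<open>L\<close>, then \<open>Y\<^sup>3 L\<close> is of lower order than \<open>Y\<^sup>4 \<le> L\<^sup>2 Z\<^sup>2\<close>.\<close>

lemma nonlinN_le_sublinear:
  assumes kin: "kinematic K w \<psi> u" and L: "gnorm K w \<le> L" "L > 0" and \<nu>: "\<nu> > 0"
  shows "(gnorm K (nonlinN K u w))\<^sup>2 \<le> \<nu>\<^sup>2 / 2880 * (gnorm K (lapN K w))\<^sup>2 + sublinear_const \<nu> L"
proof -
  define y where "y = vgnorm K (gradN K w)"
  define z where "z = gnorm K (lapN K w)"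
  define B where "B = 100 * lattice_const * L"
  define e where "e = \<nu>\<^sup>2 / (2880 * L\<^sup>2)"
  have e: "e > 0" and B: "B > 0" and y: "y \<ge> 0" and z: "z \<ge> 0"
    using L \<nu> lattice_const_pos vgnorm_nonneg gnorm_nonneg by (simp_all add: e_def B_def y_def z_def)
  have cubic: "B * y ^ 3 \<le> e * y ^ 4 + B ^ 4 / e ^ 3"
  proof (cases "B \<le> e * y")
    case True
    then have "B * y ^ 3 \<le> e * y * y ^ 3"
      using y by (intro mult_right_mono) auto
    then show ?thesis
      using B e by (simp add: power3_eq_cube power4_eq_xxxx mult.assoc add_increasing2)
  next
    case False
    then have "y \<le> B / e"
      using e by (simp add: field_simps)
    then have "B * y ^ 3 \<le> B * (B / e) ^ 3"
      using y B by (intro mult_left_mono power_mono) auto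
    also have "\<dots> = B ^ 4 / e ^ 3"
      by (simp add: power_divide power3_eq_cube power4_eq_xxxx)
    finally show ?thesis
      using e by (simp add: add_increasing)
  qed
  have "y\<^sup>2 \<le> L * z"
    using grad_interpolation[of K w] mult_right_mono[OF L(1) z] by (simp add: y_def z_def)
  then have "(y\<^sup>2)\<^sup>2 \<le> (L * z)\<^sup>2"
    by (intro power_mono) auto
  then have "e * y ^ 4 \<le> e * (L\<^sup>2 * z\<^sup>2)"
    using e by (intro mult_left_mono) (simp_all add: power_mult_distrib)
  also have "\<dots> = \<nu>\<^sup>2 / 2880 * z\<^sup>2"
    using L by (simp add: e_def)
  finally have "B * y ^ 3 \<le> \<nu>\<^sup>2 / 2880 * z\<^sup>2 + sublinear_const \<nu> L"
    using cubic by (simp add: sublinear_const_def B_def e_def)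
  moreover have "100 * lattice_const * (y ^ 3 * gnorm K w) \<le> 100 * lattice_const * (y ^ 3 * L)"
    using L y lattice_const_pos by (intro mult_left_mono) auto
  moreover have "(gnorm K (nonlinN K u w))\<^sup>2 \<le> 100 * lattice_const * (y ^ 3 * gnorm K w)"
    using nonlinN_le[OF kin] by (simp add: y_def)
  ultimately show ?thesis
    by (simp add: B_def z_def mult_ac)
qed

section \<open>Fourier series on the periodic square\<close>

abbreviation OmM :: "(real \<times> real) measure" where
  "OmM \<equiv> lebesgue_on Om"

lemma Om_cbox: "Om = cbox (0, 0) (1, 1)"
  by (auto simp: Om_def cbox_Pair_eq)

lemma Om_sets: "Om \<in> sets lebesgue"
  by (simp add: Om_cbox)

lemma integrable_Om:
  fixes g :: "real \<times> real \<Rightarrow> 'b::euclidean_space"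
  assumes "continuous_on UNIV g"
  shows "integrable OmM g"
  unfolding Om_cbox by (rule continuous_imp_integrable) (rule continuous_on_subset[OF assms], simp)

lemma integral_Om_const: "(LINT p|OmM. c) = (c::complex)"
proof -
  have "(LINT p|OmM. c) = integral Om (\<lambda>p. c)"
    by (intro lebesgue_integral_eq_integral integrable_Om Om_sets continuous_on_const)
  also have "\<dots> = c"
    by (simp add: Om_cbox content_Pair flip: cbox_Pair_eq)
  finally show ?thesis .
qed

lemma integral_Om_iterated:
  fixes g :: "real \<times> real \<Rightarrow> complex"
  assumes "continuous_on UNIV g"
  shows "(LINT p|OmM. g p) = integral {0..1} (\<lambda>x. integral {0..1} (\<lambda>y. g (x, y)))"
    and "(LINT p|OmM. g p) = integral {0..1} (\<lambda>y. integral {0..1} (\<lambda>x. g (x, y)))"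
proof -
  have c: "continuous_on (cbox (0, 0) (1, 1)) g"
    by (rule continuous_on_subset[OF assms]) simp
  have "(LINT p|OmM. g p) = integral Om g"
    by (intro lebesgue_integral_eq_integral integrable_Om Om_sets assms)
  also have "\<dots> = integral {0..1} (\<lambda>x. integral {0..1} (\<lambda>y. g (x, y)))"
    using integral_prod_continuous[OF c] by (simp add: Om_cbox)
  finally show 1: "(LINT p|OmM. g p) = integral {0..1} (\<lambda>x. integral {0..1} (\<lambda>y. g (x, y)))" .
  have "continuous_on (cbox (0, 0) (1, 1)) (\<lambda>(x, y). g (x, y))"
    using c by simp
  from integral_swap_continuous[OF this] 1
  show "(LINT p|OmM. g p) = integral {0..1} (\<lambda>y. integral {0..1} (\<lambda>x. g (x, y)))"
    by simp
qed

text \<open>The divergence theorem on the torus. Orthogonality of the modes and integration by parts against test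
functions are both instances.\<close>

lemma integral_Om_derivative:
  fixes g g' :: "real \<times> real \<Rightarrow> complex"
  assumes c: "continuous_on UNIV g'"
  shows "(\<And>x y. ((\<lambda>s. g (s, y)) has_vector_derivative g' (x, y)) (at x)) \<Longrightarrow>
      (\<And>y. g (1, y) = g (0, y)) \<Longrightarrow> (LINT p|OmM. g' p) = 0"
    and "(\<And>x y. ((\<lambda>s. g (x, s)) has_vector_derivative g' (x, y)) (at y)) \<Longrightarrow>
      (\<And>x. g (x, 1) = g (x, 0)) \<Longrightarrow> (LINT p|OmM. g' p) = 0"
proof -
  assume d: "\<And>x y. ((\<lambda>s. g (s, y)) has_vector_derivative g' (x, y)) (at x)"
    and p: "\<And>y. g (1, y) = g (0, y)"
  have "((\<lambda>x. g' (x, y)) has_integral (g (1, y) - g (0, y))) {0..1}" for y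
    by (rule fundamental_theorem_of_calculus[where f = "\<lambda>s. g (s, y)"])
      (auto intro: has_vector_derivative_at_within d)
  then have "integral {0..1} (\<lambda>x. g' (x, y)) = 0" for y
    using p by (simp add: integral_unique)
  then show "(LINT p|OmM. g' p) = 0"
    by (simp add: integral_Om_iterated(2)[OF c])
next
  assume d: "\<And>x y. ((\<lambda>s. g (x, s)) has_vector_derivative g' (x, y)) (at y)"
    and p: "\<And>x. g (x, 1) = g (x, 0)"
  have "((\<lambda>y. g' (x, y)) has_integral (g (x, 1) - g (x, 0))) {0..1}" for x
    by (rule fundamental_theorem_of_calculus[where f = "\<lambda>s. g (x, s)"])
      (auto intro: has_vector_derivative_at_within d)
  then have "integral {0..1} (\<lambda>y. g' (x, y)) = 0" for x
    using p by (simp add: integral_unique)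
  then show "(LINT p|OmM. g' p) = 0"
    by (simp add: integral_Om_iterated(1)[OF c])
qed

lemma fmode_exp: "fmode k l p = exp (2 * pi * \<i> * (of_int k * of_real (fst p) + of_int l * of_real (snd p)))"
  by (simp add: fmode_def cis_conv_exp algebra_simps)

lemma continuous_fmode: "continuous_on A (fmode k l)"
  unfolding fmode_exp[abs_def] by (intro continuous_intros)

lemma fmode_derivative:
  "((\<lambda>s. fmode k l (s, y)) has_vector_derivative 2 * pi * \<i> * of_int k * fmode k l (x, y)) (at x)"
  "((\<lambda>s. fmode k l (x, s)) has_vector_derivative 2 * pi * \<i> * of_int l * fmode k l (x, y)) (at y)"
  unfolding fmode_exp fst_conv snd_conv
  by (rule has_vector_derivative_real_field, auto intro!: derivative_eq_intros simp: algebra_simps)+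

lemma fmode_periodic: "fmode k l (x + 1, y) = fmode k l (x, y)" "fmode k l (x, y + 1) = fmode k l (x, y)"
proof -
  have "fmode k l (x + 1, y) = fmode k l (x, y) * cis (2 * pi * of_int k)"
    "fmode k l (x, y + 1) = fmode k l (x, y) * cis (2 * pi * of_int l)"
    unfolding fmode_def cis_mult by (intro arg_cong[of _ _ cis]; simp add: algebra_simps)+
  then show "fmode k l (x + 1, y) = fmode k l (x, y)" "fmode k l (x, y + 1) = fmode k l (x, y)"
    by (simp_all only: cis_multiple_2pi Ints_of_int mult_1_right)
qed

lemma fmode_integral: "(LINT p|OmM. fmode k l p) = (if k = 0 \<and> l = 0 then 1 else 0)"
proof -
  have "2 * pi * \<i> * of_int k * (LINT p|OmM. fmode k l p) = 0"
    unfolding Bochner_Integration.integral_mult_right_zero[symmetric]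
    by (rule integral_Om_derivative(1)[OF _ fmode_derivative(1)])
      (use fmode_periodic(1)[of k l 0] in \<open>auto intro!: continuous_intros continuous_fmode\<close>)
  moreover have "2 * pi * \<i> * of_int l * (LINT p|OmM. fmode k l p) = 0"
    unfolding Bochner_Integration.integral_mult_right_zero[symmetric]
    by (rule integral_Om_derivative(2)[OF _ fmode_derivative(2)])
      (use fmode_periodic(2)[of k l _ 0] in \<open>auto intro!: continuous_intros continuous_fmode\<close>)
  moreover have "(LINT p|OmM. fmode 0 0 p) = 1"
    by (rule trans[OF _ integral_Om_const]) (simp add: fmode_def)
  ultimately show ?thesis
    by auto
qed

lemma fmode_mult_cnj: "fmode k l p * cnj (fmode k' l' p) = fmode (k - k') (l - l') p"
  unfolding fmode_def cis_cnj cis_mult by (intro arg_cong[of _ _ cis]) (simp add: algebra_simps)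

lemma continuous_trigsum: "continuous_on A (trigsum K c)"
  unfolding trigsum_def[abs_def] by (intro continuous_intros continuous_fmode)

lemma trigsum_orthogonal:
  assumes "k \<in> freqs K" "l \<in> freqs K"
  shows "(LINT p|OmM. trigsum K c p * cnj (fmode k l p)) = c k l"
proof -
  have "(LINT p|OmM. trigsum K c p * cnj (fmode k l p))
      = (LINT p|OmM. (\<Sum>m\<in>freqs K. \<Sum>n\<in>freqs K. c m n * fmode (m - k) (n - l) p))"
    unfolding trigsum_def by (simp add: sum_distrib_right mult.assoc fmode_mult_cnj)
  also have "\<dots> = (\<Sum>m\<in>freqs K. \<Sum>n\<in>freqs K. c m n * (LINT p|OmM. fmode (m - k) (n - l) p))"
    by (subst Bochner_Integration.integral_sum;
        (subst Bochner_Integration.integral_sum)?;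
        (intro integrable_Om continuous_intros continuous_fmode)?) simp
  also have "\<dots> = (\<Sum>m\<in>freqs K. \<Sum>n\<in>freqs K. if m = k then if n = l then c k l else 0 else 0)"
    unfolding fmode_integral by (intro sum.cong refl) auto
  also have "\<dots> = (\<Sum>m\<in>freqs K. if m = k then (\<Sum>n\<in>freqs K. if n = l then c k l else 0) else 0)"
    by (intro sum.cong refl) auto
  also have "\<dots> = c k l"
    using assms by (simp only: sum.delta finite_atLeastAtMost_int if_True)
  finally show ?thesis .
qed

lemma in_L2_integrable_mult:
  fixes e :: "real \<times> real \<Rightarrow> complex"
  assumes f: "in_L2 f" and e: "continuous_on UNIV e" "\<And>p. cmod (e p) \<le> 1"
  shows "integrable OmM (\<lambda>p. of_real (f p) * e p)"
proof (rule Bochner_Integration.integrable_bound)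
  show "integrable OmM (\<lambda>p. 1 + (f p)\<^sup>2)"
    using f integrable_Om[of "\<lambda>p. 1 :: real"] by (intro Bochner_Integration.integrable_add) (auto simp: in_L2_def)
  have "e \<in> borel_measurable OmM"
    using integrable_Om[OF e(1)] by auto
  then show "(\<lambda>p. of_real (f p) * e p) \<in> borel_measurable OmM"
    using f by (auto simp: in_L2_def)
  have "cmod (of_real (f p) * e p) \<le> norm (1 + (f p)\<^sup>2)" for p
  proof -
    have "cmod (of_real (f p) * e p) \<le> \<bar>f p\<bar> * 1"
      unfolding norm_mult norm_of_real by (intro mult_left_mono e) auto
    moreover have "2 * \<bar>f p\<bar> \<le> 1 + \<bar>f p\<bar>\<^sup>2"
      using sum_squares_bound[of 1 "\<bar>f p\<bar>"] by simp
    ultimately show ?thesis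
      by (simp del: norm_mult)
  qed
  then show "AE p in OmM. cmod (of_real (f p) * e p) \<le> norm (1 + (f p)\<^sup>2)"
    by simp
qed

lemma norm_fmode: "cmod (fmode k l p) = 1"
  by (simp add: fmode_def)

lemma in_L2_integrable_fmode: "in_L2 f \<Longrightarrow> integrable OmM (\<lambda>p. of_real (f p) * fmode k l p)"
  by (intro in_L2_integrable_mult continuous_fmode) (simp_all add: norm_fmode)

lemma in_L2_continuous:
  assumes "continuous_on UNIV f"
  shows "in_L2 f"
  unfolding in_L2_def using integrable_Om[OF assms] assms
  by (auto intro!: integrable_Om continuous_intros)

lemma L2norm_sq: "(L2norm f)\<^sup>2 = (LINT p|OmM. (f p)\<^sup>2)"
  by (simp add: L2norm_def)

lemma trigsum_real_parseval:
  assumes c: "\<And>k l. c (- k) (- l) = cnj (c k l)"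
  shows "(LINT p|OmM. (Re (trigsum K c p))\<^sup>2) = (\<Sum>k\<in>freqs K. \<Sum>l\<in>freqs K. (cmod (c k l))\<^sup>2)"
proof -
  have "of_real ((Re (trigsum K c p))\<^sup>2) = (\<Sum>k\<in>freqs K. \<Sum>l\<in>freqs K. cnj (c k l) * (trigsum K c p * cnj (fmode k l p)))" for p
  proof -
    have "complex_of_real ((Re (trigsum K c p))\<^sup>2) = of_real (Re (trigsum K c p)) * cnj (of_real (Re (trigsum K c p)))"
      by (simp add: power2_eq_square)
    also have "\<dots> = trigsum K c p * cnj (trigsum K c p)"
      by (simp only: trigsum_real[of c, OF c])
    also have "\<dots> = trigsum K c p * (\<Sum>k\<in>freqs K. \<Sum>l\<in>freqs K. cnj (c k l) * cnj (fmode k l p))"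
      by (simp add: trigsum_def[of K c p])
    also have "\<dots> = (\<Sum>k\<in>freqs K. \<Sum>l\<in>freqs K. cnj (c k l) * (trigsum K c p * cnj (fmode k l p)))"
      by (simp add: sum_distrib_left mult_ac)
    finally show ?thesis .
  qed
  then have "complex_of_real (LINT p|OmM. (Re (trigsum K c p))\<^sup>2)
      = (LINT p|OmM. (\<Sum>k\<in>freqs K. \<Sum>l\<in>freqs K. cnj (c k l) * (trigsum K c p * cnj (fmode k l p))))"
    by (simp only: integral_complex_of_real[symmetric])
  also have "\<dots> = (\<Sum>k\<in>freqs K. \<Sum>l\<in>freqs K. cnj (c k l) * (LINT p|OmM. trigsum K c p * cnj (fmode k l p)))"
    by (subst Bochner_Integration.integral_sum;
        (subst Bochner_Integration.integral_sum)?;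
        (intro integrable_Om continuous_intros continuous_fmode continuous_trigsum)?) simp
  also have "\<dots> = (\<Sum>k\<in>freqs K. \<Sum>l\<in>freqs K. of_real ((cmod (c k l))\<^sup>2))"
    by (intro sum.cong refl) (simp only: trigsum_orthogonal complex_norm_square mult.commute)
  also have "\<dots> = of_real (\<Sum>k\<in>freqs K. \<Sum>l\<in>freqs K. (cmod (c k l))\<^sup>2)"
    by simp
  finally show ?thesis
    by (simp only: of_real_eq_iff)
qed

lemma cnj_fourier_coeff: "cnj (fourier_coeff f k l) = (LINT p|OmM. of_real (f p) * fmode k l p)"
  unfolding fourier_coeff_uminus[symmetric] unfolding fourier_coeff_def by (simp add: fmode_uminus)

text \<open>Expand \<open>0 \<le> \<parallel>f - P f\<parallel>\<^sup>2\<close> for the Fourier projection \<open>P f\<close>: both the mixed term and \<open>\<parallel>P f\<parallel>\<^sup>2\<close> equal the sum on the left.\<close>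

theorem bessel:
  assumes f: "in_L2 f"
  shows "(\<Sum>k\<in>freqs K. \<Sum>l\<in>freqs K. (cmod (fourier_coeff f k l))\<^sup>2) \<le> (L2norm f)\<^sup>2"
proof -
  let ?c = "fourier_coeff f" and ?s = "fourier_proj K f"
  let ?B = "\<Sum>k\<in>freqs K. \<Sum>l\<in>freqs K. (cmod (?c k l))\<^sup>2"
  have eq: "complex_of_real (f p * ?s p) = (\<Sum>k\<in>freqs K. \<Sum>l\<in>freqs K. ?c k l * (of_real (f p) * fmode k l p))" for p
    unfolding of_real_mult fourier_proj_complex trigsum_def by (simp add: sum_distrib_left mult_ac)
  have int: "integrable OmM (\<lambda>p. complex_of_real (f p * ?s p))"
    unfolding eq by (intro Bochner_Integration.integrable_sum Bochner_Integration.integrable_mult_right in_L2_integrable_fmode f)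
  have int_fs: "integrable OmM (\<lambda>p. f p * ?s p)"
    using integrable_Re[OF int] by simp
  have "complex_of_real (LINT p|OmM. f p * ?s p)
      = (LINT p|OmM. (\<Sum>k\<in>freqs K. \<Sum>l\<in>freqs K. ?c k l * (of_real (f p) * fmode k l p)))"
    by (simp only: integral_complex_of_real[symmetric] eq)
  also have "\<dots> = (\<Sum>k\<in>freqs K. \<Sum>l\<in>freqs K. ?c k l * (LINT p|OmM. of_real (f p) * fmode k l p))"
    by (subst Bochner_Integration.integral_sum;
        (subst Bochner_Integration.integral_sum)?;
        (intro Bochner_Integration.integrable_sum Bochner_Integration.integrable_mult_right in_L2_integrable_fmode f)?) simp
  also have "\<dots> = of_real ?B"
    by (simp only: cnj_fourier_coeff[symmetric] of_real_sum complex_norm_square)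
  finally have fs: "(LINT p|OmM. f p * ?s p) = ?B"
    by (simp only: of_real_eq_iff)
  have cs: "continuous_on UNIV ?s"
    unfolding fourier_proj_def[abs_def] by (intro continuous_intros continuous_trigsum)
  have int_s: "integrable OmM (\<lambda>p. (?s p)\<^sup>2)"
    using in_L2_continuous[OF cs] by (simp add: in_L2_def)
  have ss: "(LINT p|OmM. (?s p)\<^sup>2) = ?B"
    unfolding fourier_proj_def by (rule trigsum_real_parseval) (rule fourier_coeff_uminus)
  have int_f: "integrable OmM (\<lambda>p. (f p)\<^sup>2)"
    using f by (simp add: in_L2_def)
  have "0 \<le> (LINT p|OmM. (f p - ?s p)\<^sup>2)"
    by (rule Bochner_Integration.integral_nonneg) simp
  also have "\<dots> = (LINT p|OmM. (f p)\<^sup>2 - 2 * (f p * ?s p) + (?s p)\<^sup>2)"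
    by (simp add: power2_diff mult.assoc algebra_simps)
  also have "\<dots> = (LINT p|OmM. (f p)\<^sup>2) - 2 * (LINT p|OmM. f p * ?s p) + (LINT p|OmM. (?s p)\<^sup>2)"
    using int_f int_fs int_s by simp
  finally show ?thesis
    by (simp add: fs ss L2norm_sq)
qed

lemma L2norm_ext: "L2norm (ext K w) = gnorm K w"
proof -
  have "(L2norm (ext K w))\<^sup>2 = (gnorm K w)\<^sup>2"
    unfolding L2norm_sq ext_def gnorm_parseval by (rule trigsum_real_parseval) (rule dft_uminus)
  then show ?thesis
    using gnorm_nonneg[of K w] by (simp add: L2norm_def power2_eq_iff_nonneg)
qed

lemma trigsum_derivative:
  "((\<lambda>s. trigsum K c (s, y)) has_vector_derivative trigsum K (\<lambda>k l. 2 * pi * \<i> * of_int k * c k l) (x, y)) (at x)"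
  "((\<lambda>s. trigsum K c (x, s)) has_vector_derivative trigsum K (\<lambda>k l. 2 * pi * \<i> * of_int l * c k l) (x, y)) (at y)"
  unfolding trigsum_def
  by (auto intro!: derivative_eq_intros fmode_derivative sum.cong simp: mult_ac)

lemma L2norm_grad_ext: "L2norm_grad (ext K w) = vgnorm K (gradN K w)"
proof -
  let ?x = "\<lambda>p. Re (trigsum K (\<lambda>k l. 2 * pi * \<i> * of_int k * dft K w k l) p)"
  let ?y = "\<lambda>p. Re (trigsum K (\<lambda>k l. 2 * pi * \<i> * of_int l * dft K w k l) p)"
  have "deriv (\<lambda>s. ext K w (s, y)) x = ?x (x, y)" "deriv (\<lambda>s. ext K w (x, s)) y = ?y (x, y)" for x y
    unfolding ext_def
    by (intro DERIV_imp_deriv; subst has_real_derivative_iff_has_vector_derivative;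
        intro bounded_linear.has_vector_derivative[OF bounded_linear_Re] trigsum_derivative)+
  then have "L2norm_grad (ext K w) = sqrt (LINT p|OmM. (?x p)\<^sup>2 + (?y p)\<^sup>2)"
    unfolding L2norm_grad_def by (simp add: case_prod_unfold)
  also have "(LINT p|OmM. (?x p)\<^sup>2 + (?y p)\<^sup>2) = (LINT p|OmM. (?x p)\<^sup>2) + (LINT p|OmM. (?y p)\<^sup>2)"
    by (intro Bochner_Integration.integral_add integrable_Om continuous_intros continuous_trigsum)
  also have "\<dots> = (vgnorm K (gradN K w))\<^sup>2"
    unfolding grad_parseval
    by (subst (1 2) trigsum_real_parseval) (simp_all add: dft_uminus norm_mult power_mult_distrib algebra_simps sum.distrib)
  finally show ?thesis
    by (simp add: vgnorm_nonneg)
qed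

lemma fourier_coeff_ext: "k \<in> freqs K \<Longrightarrow> l \<in> freqs K \<Longrightarrow> fourier_coeff (ext K w) k l = dft K w k l"
  unfolding fourier_coeff_def ext_complex by (rule trigsum_orthogonal)

lemma dft_fourier_proj:
  "k \<in> freqs K \<Longrightarrow> l \<in> freqs K \<Longrightarrow> dft K (restrict_grid K (fourier_proj K f)) k l = fourier_coeff f k l"
  by (rule dft_trigsum) (simp_all add: restrict_grid_def fourier_proj_complex)

lemma gnorm_fourier_proj_le:
  assumes "in_L2 f"
  shows "gnorm K (restrict_grid K (fourier_proj K f)) \<le> L2norm f"
proof (rule power2_le_imp_le)
  show "(gnorm K (restrict_grid K (fourier_proj K f)))\<^sup>2 \<le> (L2norm f)\<^sup>2"
    unfolding gnorm_parseval using bessel[OF assms, of K] by (simp add: dft_fourier_proj)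
qed (simp add: L2norm_def)

section \<open>Weak derivatives and Fourier coefficients\<close>

text \<open>The factor \<open>d\<close> serves to test with real and imaginary parts: \<open>d = 1\<close> and \<open>d = - \<i>\<close> suffice to recover a complex identity.\<close>

lemma mode_jet:
  "smooth_periodic_jet (\<lambda>a b p. Re (d * ((2 * pi * \<i> * of_int k) ^ a * (2 * pi * \<i> * of_int l) ^ b * fmode k l p)))"
  unfolding smooth_periodic_jet_def periodic_def
proof (intro conjI allI)
  fix a b x y
  show "((\<lambda>s. Re (d * ((2 * pi * \<i> * of_int k) ^ a * (2 * pi * \<i> * of_int l) ^ b * fmode k l (s, y)))) has_real_derivative
      Re (d * ((2 * pi * \<i> * of_int k) ^ Suc a * (2 * pi * \<i> * of_int l) ^ b * fmode k l (x, y)))) (at x)"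
    "((\<lambda>s. Re (d * ((2 * pi * \<i> * of_int k) ^ a * (2 * pi * \<i> * of_int l) ^ b * fmode k l (x, s)))) has_real_derivative
      Re (d * ((2 * pi * \<i> * of_int k) ^ a * (2 * pi * \<i> * of_int l) ^ Suc b * fmode k l (x, y)))) (at y)"
    unfolding has_real_derivative_iff_has_vector_derivative
    by (intro bounded_linear.has_vector_derivative[OF bounded_linear_Re];
        auto intro!: derivative_eq_intros fmode_derivative simp: mult_ac)+
qed (auto simp: fmode_periodic intro!: continuous_intros continuous_fmode)

lemma weak_deriv_in_L2: "weak_deriv a b f g \<Longrightarrow> in_L2 g"
  by (simp add: weak_deriv_def)

lemma fourier_coeff_weak_deriv:
  assumes f: "in_L2 f" and w: "weak_deriv a b f g"
  shows "fourier_coeff g k l = (2 * pi * \<i> * of_int k) ^ a * (2 * pi * \<i> * of_int l) ^ b * fourier_coeff f k l"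
proof -
  let ?m = "(2 * pi * \<i> * of_int (- k)) ^ a * (2 * pi * \<i> * of_int (- l)) ^ b"
  have g: "in_L2 g"
    using w by (simp add: weak_deriv_def)
  have test: "Re (d * (?m * fourier_coeff f k l)) = Re (d * ((-1) ^ (a + b) * fourier_coeff g k l))" for d
  proof -
    have R: "Re (d * (c * fourier_coeff h k l)) = (LINT p|OmM. h p * Re (d * (c * fmode (- k) (- l) p)))"
      if "in_L2 h" for c h
    proof -
      have "Re (d * (c * fourier_coeff h k l)) = Re (LINT p|OmM. d * (c * (of_real (h p) * fmode (- k) (- l) p)))"
        unfolding fourier_coeff_def fmode_uminus by simp
      also have "\<dots> = (LINT p|OmM. Re (d * (c * (of_real (h p) * fmode (- k) (- l) p))))"
        by (intro integral_Re[symmetric] Bochner_Integration.integrable_mult_right in_L2_integrable_fmode that)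
      also have "\<dots> = (LINT p|OmM. h p * Re (d * (c * fmode (- k) (- l) p)))"
        by (intro Bochner_Integration.integral_cong refl) (simp add: algebra_simps)
      finally show ?thesis .
    qed
    have "(LINT p|OmM. f p * Re (d * (?m * fmode (- k) (- l) p)))
        = (-1) ^ (a + b) * (LINT p|OmM. g p * Re (d * (1 * fmode (- k) (- l) p)))"
      using w mode_jet[of d "- k" "- l"] unfolding weak_deriv_def by fastforce
    then have "Re (d * (?m * fourier_coeff f k l)) = (-1) ^ (a + b) * Re (d * (1 * fourier_coeff g k l))"
      by (simp only: R[OF f] R[OF g])
    also have "\<dots> = Re (d * ((-1) ^ (a + b) * fourier_coeff g k l))"
      by (cases "even (a + b)") simp_all
    finally show ?thesis .
  qed
  have "?m * fourier_coeff f k l = (-1) ^ (a + b) * fourier_coeff g k l"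
    using test[of 1] test[of "- \<i>"] by (intro complex_eqI) simp_all
  then have "(-1) ^ (a + b) * (?m * fourier_coeff f k l) = fourier_coeff g k l"
    by (simp flip: mult.assoc power_add)
  moreover have "(-1) ^ (a + b) * ?m = (2 * pi * \<i> * of_int k) ^ a * (2 * pi * \<i> * of_int l) ^ b"
  proof -
    have sign: "(-1) ^ n * (2 * pi * \<i> * of_int (- m)) ^ n = (2 * pi * \<i> * of_int m) ^ n" for n m
      by (simp flip: power_mult_distrib)
    have "(-1) ^ (a + b) * ?m = ((-1) ^ a * (2 * pi * \<i> * of_int (- k)) ^ a) * ((-1) ^ b * (2 * pi * \<i> * of_int (- l)) ^ b)"
      by (simp only: power_add mult_ac)
    then show ?thesis
      by (simp only: sign)
  qed
  ultimately show ?thesis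
    by (simp flip: mult.assoc)
qed

text \<open>A jet requires periodicity of \<open>\<phi> 0 0\<close> only; a derivative of a periodic function is periodic by uniqueness of derivatives.\<close>

lemma jet_periodic:
  assumes j: "smooth_periodic_jet \<phi>"
  shows "periodic (\<phi> a b)"
proof -
  have dx: "((\<lambda>s. \<phi> a b (s, y)) has_real_derivative \<phi> (Suc a) b (x, y)) (at x)"
    and dy: "((\<lambda>s. \<phi> a b (x, s)) has_real_derivative \<phi> a (Suc b) (x, y)) (at y)" for a b x y
    using j by (auto simp: smooth_periodic_jet_def)
  have x: "periodic (\<phi> (Suc a) b)" if p: "periodic (\<phi> a b)" for a b
    unfolding periodic_def
  proof (intro allI conjI)
    fix x y
    have "((\<lambda>s. \<phi> a b (s, y)) has_real_derivative \<phi> (Suc a) b (x + 1, y)) (at x)"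
      using dx[of a b y "x + 1"] p unfolding DERIV_shift by (simp add: periodic_def)
    from DERIV_unique[OF this dx] show "\<phi> (Suc a) b (x + 1, y) = \<phi> (Suc a) b (x, y)" .
    have "((\<lambda>s. \<phi> a b (s, y)) has_real_derivative \<phi> (Suc a) b (x, y + 1)) (at x)"
      using dx[of a b "y + 1" x] p by (simp add: periodic_def)
    from DERIV_unique[OF this dx] show "\<phi> (Suc a) b (x, y + 1) = \<phi> (Suc a) b (x, y)" .
  qed
  have y: "periodic (\<phi> a (Suc b))" if p: "periodic (\<phi> a b)" for a b
    unfolding periodic_def
  proof (intro allI conjI)
    fix x y
    have "((\<lambda>s. \<phi> a b (x, s)) has_real_derivative \<phi> a (Suc b) (x, y + 1)) (at y)"
      using dy[of a b x "y + 1"] p unfolding DERIV_shift by (simp add: periodic_def)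
    from DERIV_unique[OF this dy] show "\<phi> a (Suc b) (x, y + 1) = \<phi> a (Suc b) (x, y)" .
    have "((\<lambda>s. \<phi> a b (x, s)) has_real_derivative \<phi> a (Suc b) (x + 1, y)) (at y)"
      using dy[of a b "x + 1" y] p by (simp add: periodic_def)
    from DERIV_unique[OF this dy] show "\<phi> a (Suc b) (x + 1, y) = \<phi> a (Suc b) (x, y)" .
  qed
  have "periodic (\<phi> a 0)" for a
    by (induction a) (use j x in \<open>auto simp: smooth_periodic_jet_def\<close>)
  then show ?thesis
    by (induction b) (use y in auto)
qed

text \<open>Integration by parts, one derivative at a time; the boundary terms cancel by periodicity.\<close>

lemma fmode_jet_integral:
  assumes j: "smooth_periodic_jet \<phi>"
  shows "(LINT p|OmM. fmode k l p * of_real (\<phi> a b p)) =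
    (- (2 * pi * \<i> * of_int k)) ^ a * (- (2 * pi * \<i> * of_int l)) ^ b * (LINT p|OmM. fmode k l p * of_real (\<phi> 0 0 p))"
proof -
  have c: "continuous_on A (\<phi> a b)" for a b A
    using j continuous_on_subset[of UNIV] by (auto simp: smooth_periodic_jet_def)
  have int: "integrable OmM (\<lambda>p. fmode k l p * of_real (\<phi> a b p))" for a b
    by (intro integrable_Om continuous_intros continuous_fmode c)
  have p: "\<phi> a b (x + 1, y) = \<phi> a b (x, y)" "\<phi> a b (x, y + 1) = \<phi> a b (x, y)" for a b x y
    using jet_periodic[OF j] by (auto simp: periodic_def)
  have dx: "((\<lambda>s. complex_of_real (\<phi> a b (s, y))) has_vector_derivative of_real (\<phi> (Suc a) b (x, y))) (at x)"
    and dy: "((\<lambda>s. complex_of_real (\<phi> a b (x, s))) has_vector_derivative of_real (\<phi> a (Suc b) (x, y))) (at y)" for a b x y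
    by (intro bounded_linear.has_vector_derivative[OF bounded_linear_of_real],
        use j in \<open>simp add: smooth_periodic_jet_def has_real_derivative_iff_has_vector_derivative\<close>)+
  have x: "(LINT p|OmM. fmode k l p * of_real (\<phi> (Suc a) b p))
      = - (2 * pi * \<i> * of_int k) * (LINT p|OmM. fmode k l p * of_real (\<phi> a b p))" for a b
  proof -
    have "(LINT p|OmM. fmode k l p * of_real (\<phi> (Suc a) b p) + 2 * pi * \<i> * of_int k * (fmode k l p * of_real (\<phi> a b p))) = 0"
    proof (rule integral_Om_derivative(1)[where g = "\<lambda>p. fmode k l p * of_real (\<phi> a b p)"])
      fix x y
      show "((\<lambda>s. fmode k l (s, y) * of_real (\<phi> a b (s, y))) has_vector_derivative fmode k l (x, y) * of_real (\<phi> (Suc a) b (x, y))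
        + 2 * pi * \<i> * of_int k * (fmode k l (x, y) * of_real (\<phi> a b (x, y)))) (at x)"
        using has_vector_derivative_mult[OF fmode_derivative(1)[of k l y x] dx[of a b y x]] by (simp add: mult_ac)
      show "fmode k l (1, y) * of_real (\<phi> a b (1, y)) = fmode k l (0, y) * of_real (\<phi> a b (0, y))"
        using p(1)[of a b 0] fmode_periodic(1)[of k l 0] by simp
    qed (intro continuous_intros continuous_fmode c)
    then show ?thesis
      by (subst (asm) Bochner_Integration.integral_add)
        (simp_all add: int add_eq_0_iff2)
  qed
  have y: "(LINT p|OmM. fmode k l p * of_real (\<phi> a (Suc b) p))
      = - (2 * pi * \<i> * of_int l) * (LINT p|OmM. fmode k l p * of_real (\<phi> a b p))" for a b
  proof -
    have "(LINT p|OmM. fmode k l p * of_real (\<phi> a (Suc b) p) + 2 * pi * \<i> * of_int l * (fmode k l p * of_real (\<phi> a b p))) = 0"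
    proof (rule integral_Om_derivative(2)[where g = "\<lambda>p. fmode k l p * of_real (\<phi> a b p)"])
      fix x y
      show "((\<lambda>s. fmode k l (x, s) * of_real (\<phi> a b (x, s))) has_vector_derivative fmode k l (x, y) * of_real (\<phi> a (Suc b) (x, y))
        + 2 * pi * \<i> * of_int l * (fmode k l (x, y) * of_real (\<phi> a b (x, y)))) (at y)"
        using has_vector_derivative_mult[OF fmode_derivative(2)[of k l x y] dy[of a b x y]] by (simp add: mult_ac)
      show "fmode k l (x, 1) * of_real (\<phi> a b (x, 1)) = fmode k l (x, 0) * of_real (\<phi> a b (x, 0))"
        using p(2)[of a b x 0] fmode_periodic(2)[of k l x 0] by simp
    qed (intro continuous_intros continuous_fmode c)
    then show ?thesis
      by (subst (asm) Bochner_Integration.integral_add)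
        (simp_all add: int add_eq_0_iff2)
  qed
  have "(LINT p|OmM. fmode k l p * of_real (\<phi> a 0 p)) =
      (- (2 * pi * \<i> * of_int k)) ^ a * (LINT p|OmM. fmode k l p * of_real (\<phi> 0 0 p))"
    by (induction a) (simp_all add: x)
  then show ?thesis
    by (induction b) (simp_all add: y)
qed

text \<open>The existence of weak derivatives is what gives meaning to the choice in \<open>Hnorm\<close> for extensions of grid functions.\<close>

lemma weak_deriv_ext: "\<exists>g. weak_deriv a b (ext K w) g"
proof
  let ?d = "\<lambda>k l. (2 * pi * \<i> * of_int k) ^ a * (2 * pi * \<i> * of_int l) ^ b * dft K w k l"
  have herm: "?d (- k) (- l) = cnj (?d k l)" for k l
    by (simp add: dft_uminus)
  show "weak_deriv a b (ext K w) (\<lambda>p. Re (trigsum K ?d p))"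
    unfolding weak_deriv_def
  proof (intro conjI allI impI)
    show "in_L2 (\<lambda>p. Re (trigsum K ?d p))"
      by (intro in_L2_continuous continuous_intros continuous_trigsum)
    fix \<phi>
    assume j: "smooth_periodic_jet \<phi>"
    have c: "continuous_on A (\<phi> a b)" for a b A
      using j continuous_on_subset[of UNIV] by (auto simp: smooth_periodic_jet_def)
    have T: "(LINT p|OmM. trigsum K c p * of_real (\<phi> a b p))
        = (\<Sum>k\<in>freqs K. \<Sum>l\<in>freqs K. c k l * (LINT p|OmM. fmode k l p * of_real (\<phi> a b p)))" for c a b
    proof -
      have "(LINT p|OmM. trigsum K c p * of_real (\<phi> a b p))
          = (LINT p|OmM. (\<Sum>k\<in>freqs K. \<Sum>l\<in>freqs K. c k l * (fmode k l p * of_real (\<phi> a b p))))"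
        by (simp add: trigsum_def sum_distrib_right mult.assoc)
      also have "\<dots> = (\<Sum>k\<in>freqs K. \<Sum>l\<in>freqs K. c k l * (LINT p|OmM. fmode k l p * of_real (\<phi> a b p)))"
        by (subst Bochner_Integration.integral_sum;
            (subst Bochner_Integration.integral_sum)?;
            (intro integrable_Om continuous_intros continuous_fmode c)?) simp
      finally show ?thesis .
    qed
    have sign: "z * ((- x) ^ a * (- y) ^ b * i) = (-1) ^ (a + b) * (x ^ a * y ^ b * z * i)" for x y z i :: complex
      unfolding power_minus[of x a] power_minus[of y b] power_add by (simp only: mult_ac)
    have "complex_of_real (LINT p|OmM. ext K w p * \<phi> a b p) = (LINT p|OmM. trigsum K (dft K w) p * of_real (\<phi> a b p))"
      by (simp only: integral_complex_of_real[symmetric] of_real_mult ext_complex)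
    also have "\<dots> = (-1) ^ (a + b) * (LINT p|OmM. trigsum K ?d p * of_real (\<phi> 0 0 p))"
      unfolding T fmode_jet_integral[OF j, of _ _ a b] sum_distrib_left
      by (intro sum.cong refl sign)
    also have "\<dots> = of_real ((-1) ^ (a + b) * (LINT p|OmM. Re (trigsum K ?d p) * \<phi> 0 0 p))"
    proof -
      have "complex_of_real (Re (trigsum K ?d p) * \<phi> 0 0 p) = trigsum K ?d p * of_real (\<phi> 0 0 p)" for p
        unfolding of_real_mult[of "Re (trigsum K ?d p)"] trigsum_real[of ?d, OF herm] ..
      then have "(LINT p|OmM. trigsum K ?d p * of_real (\<phi> 0 0 p)) = of_real (LINT p|OmM. Re (trigsum K ?d p) * \<phi> 0 0 p)"
        by (simp only: integral_complex_of_real[symmetric])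
      then show ?thesis
        by (simp only: of_real_mult[of "(-1) ^ (a + b)"] of_real_power of_real_minus of_real_1)
    qed
    finally show "(LINT p|OmM. ext K w p * \<phi> a b p) = (-1) ^ (a + b) * (LINT p|OmM. Re (trigsum K ?d p) * \<phi> 0 0 p)"
      by (simp only: of_real_eq_iff)
  qed
qed

lemma in_L2_ext: "in_L2 (ext K w)"
  unfolding ext_def[abs_def] by (intro in_L2_continuous continuous_intros continuous_trigsum)

text \<open>Each of the derivatives in \<open>Hnorm 2 f\<close> has the Fourier coefficients expected of it, so Bessel's inequality bounds
the corresponding sum over the resolved frequencies. The orders \<open>(2, 0)\<close> and \<open>(0, 2)\<close> control the Laplacian through
\<open>(x + y)\<^sup>2 \<le> 2 x\<^sup>2 + 2 y\<^sup>2\<close>. The lemma serves the initial value, where \<open>w\<close> samples the Fourier projection of \<open>f\<close>, and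
extensions, where \<open>f\<close> is the extension of \<open>w\<close>.\<close>

theorem grid_norms_le_Hnorm:
  assumes f: "in_L2 f" and weak: "\<And>a b. a + b \<le> 2 \<Longrightarrow> \<exists>g. weak_deriv a b f g"
    and w: "\<And>k l. k \<in> freqs K \<Longrightarrow> l \<in> freqs K \<Longrightarrow> dft K w k l = fourier_coeff f k l"
  shows "gnorm K w \<le> Hnorm 2 f" "vgnorm K (gradN K w) \<le> Hnorm 2 f" "gnorm K (lapN K w) \<le> 2 * Hnorm 2 f"
proof -
  define T where "T a b = (L2norm (SOME g. weak_deriv a b f g))\<^sup>2" for a b
  have T0: "T a b \<ge> 0" for a b
    by (simp add: T_def)
  have mode: "(\<Sum>k\<in>freqs K. \<Sum>l\<in>freqs K. ((2 * pi * of_int k)\<^sup>2) ^ a * ((2 * pi * of_int l)\<^sup>2) ^ b * (cmod (dft K w k l))\<^sup>2)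
      \<le> T a b" if "a + b \<le> 2" for a b
  proof -
    have s: "weak_deriv a b f (SOME g. weak_deriv a b f g)"
      using weak[OF that] by (rule someI_ex)
    have m: "(cmod ((2 * pi * \<i> * of_int k) ^ n))\<^sup>2 = ((2 * pi * of_int k)\<^sup>2) ^ n" for k n
    proof -
      have "cmod (2 * pi * \<i> * of_int k) = \<bar>2 * pi * of_int k\<bar>"
        by (simp add: norm_mult abs_mult)
      then have "(cmod ((2 * pi * \<i> * of_int k) ^ n))\<^sup>2 = (\<bar>2 * pi * of_int k\<bar> ^ 2) ^ n"
        by (simp only: norm_power power_mult[symmetric] mult.commute)
      then show ?thesis
        by (simp only: power2_abs)
    qed
    have e: "(cmod (x ^ a * y ^ b * z))\<^sup>2 = (cmod (x ^ a))\<^sup>2 * (cmod (y ^ b))\<^sup>2 * (cmod z)\<^sup>2" for x y z :: complex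
      by (simp only: norm_mult power_mult_distrib)
    have "(\<Sum>k\<in>freqs K. \<Sum>l\<in>freqs K. ((2 * pi * of_int k)\<^sup>2) ^ a * ((2 * pi * of_int l)\<^sup>2) ^ b * (cmod (dft K w k l))\<^sup>2)
      = (\<Sum>k\<in>freqs K. \<Sum>l\<in>freqs K. (cmod (fourier_coeff (SOME g. weak_deriv a b f g) k l))\<^sup>2)"
      unfolding fourier_coeff_weak_deriv[OF f s] e m
      by (intro sum.cong refl) (simp only: w)
    then show ?thesis
      using bessel[OF weak_deriv_in_L2[OF s], of K] unfolding T_def by (simp only:)
  qed
  have "{(a, b). a + b \<le> (2::nat)} = {(0, 0), (0, 1), (0, 2), (1, 0), (1, 1), (2, 0)}"
    by auto
  then have "(Hnorm 2 f)\<^sup>2 = T 0 0 + T 0 1 + T 0 2 + T 1 0 + T 1 1 + T 2 0"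
    unfolding Hnorm_def T_def[symmetric] by (simp add: T0 add_nonneg_nonneg)
  then have H: "T 0 0 \<le> (Hnorm 2 f)\<^sup>2" "T 1 0 + T 0 1 \<le> (Hnorm 2 f)\<^sup>2" "T 2 0 + T 0 2 \<le> (Hnorm 2 f)\<^sup>2"
    using T0[of 0 0] T0[of 0 1] T0[of 0 2] T0[of 1 0] T0[of 1 1] T0[of 2 0] by linarith+
  have H0: "Hnorm 2 f \<ge> 0"
    by (auto simp: Hnorm_def intro!: sum_nonneg)
  show "gnorm K w \<le> Hnorm 2 f"
  proof (rule power2_le_imp_le)
    show "(gnorm K w)\<^sup>2 \<le> (Hnorm 2 f)\<^sup>2"
      unfolding gnorm_parseval using mode[of 0 0] H by simp
  qed (rule H0)
  show "vgnorm K (gradN K w) \<le> Hnorm 2 f"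
  proof (rule power2_le_imp_le)
    have "(vgnorm K (gradN K w))\<^sup>2 = (\<Sum>k\<in>freqs K. \<Sum>l\<in>freqs K. (2 * pi * of_int k)\<^sup>2 * (cmod (dft K w k l))\<^sup>2)
      + (\<Sum>k\<in>freqs K. \<Sum>l\<in>freqs K. (2 * pi * of_int l)\<^sup>2 * (cmod (dft K w k l))\<^sup>2)"
      unfolding grad_parseval sum.distrib[symmetric]
      by (intro sum.cong refl) (simp add: power_mult_distrib algebra_simps)
    also have "\<dots> \<le> (Hnorm 2 f)\<^sup>2"
      using mode[of 1 0] mode[of 0 1] H by simp
    finally show "(vgnorm K (gradN K w))\<^sup>2 \<le> (Hnorm 2 f)\<^sup>2" .
  qed (rule H0)
  show "gnorm K (lapN K w) \<le> 2 * Hnorm 2 f"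
  proof (rule power2_le_imp_le)
    have "(gnorm K (lapN K w))\<^sup>2 \<le> (\<Sum>k\<in>freqs K. \<Sum>l\<in>freqs K. 2 * (((2 * pi * of_int k)\<^sup>2)\<^sup>2 * (cmod (dft K w k l))\<^sup>2)
        + 2 * (((2 * pi * of_int l)\<^sup>2)\<^sup>2 * (cmod (dft K w k l))\<^sup>2))"
      unfolding lap_parseval
    proof (intro sum_mono)
      fix k l
      have "(4 * pi\<^sup>2 * ((of_int k)\<^sup>2 + (of_int l)\<^sup>2))\<^sup>2 = ((2 * pi * of_int k)\<^sup>2 + (2 * pi * of_int l)\<^sup>2)\<^sup>2"
        by (simp add: power_mult_distrib algebra_simps)
      also have "\<dots> \<le> 2 * ((2 * pi * of_int k)\<^sup>2)\<^sup>2 + 2 * ((2 * pi * of_int l)\<^sup>2)\<^sup>2"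
        by (rule sq_sum2_le)
      finally have "(4 * pi\<^sup>2 * ((of_int k)\<^sup>2 + (of_int l)\<^sup>2))\<^sup>2 * (cmod (dft K w k l))\<^sup>2
          \<le> (2 * ((2 * pi * of_int k)\<^sup>2)\<^sup>2 + 2 * ((2 * pi * of_int l)\<^sup>2)\<^sup>2) * (cmod (dft K w k l))\<^sup>2"
        by (rule mult_right_mono) simp
      then show "(4 * pi\<^sup>2 * ((of_int k)\<^sup>2 + (of_int l)\<^sup>2))\<^sup>2 * (cmod (dft K w k l))\<^sup>2
          \<le> 2 * (((2 * pi * of_int k)\<^sup>2)\<^sup>2 * (cmod (dft K w k l))\<^sup>2) + 2 * (((2 * pi * of_int l)\<^sup>2)\<^sup>2 * (cmod (dft K w k l))\<^sup>2)"
        by (simp only: distrib_right mult.assoc)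
    qed
    also have "\<dots> = 2 * (\<Sum>k\<in>freqs K. \<Sum>l\<in>freqs K. ((2 * pi * of_int k)\<^sup>2)\<^sup>2 * (cmod (dft K w k l))\<^sup>2)
      + 2 * (\<Sum>k\<in>freqs K. \<Sum>l\<in>freqs K. ((2 * pi * of_int l)\<^sup>2)\<^sup>2 * (cmod (dft K w k l))\<^sup>2)"
      by (simp only: sum.distrib sum_distrib_left)
    also have "\<dots> \<le> 2 * T 2 0 + 2 * T 0 2"
      using mode[of 2 0] mode[of 0 2] by (intro add_mono mult_left_mono) simp_all
    also have "\<dots> \<le> (2 * Hnorm 2 f)\<^sup>2"
      using H T0[of 2 0] T0[of 0 2] by (simp add: power_mult_distrib)
    finally show "(gnorm K (lapN K w))\<^sup>2 \<le> (2 * Hnorm 2 f)\<^sup>2" .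
  qed (use H0 in simp)
qed

section \<open>Uniform bounds for the scheme\<close>

text \<open>A step leaves the fraction \<open>1/64\<close> of the dissipation, and \<open>stencil_bound \<alpha> + 6\<close> compares energy and dissipation.\<close>

definition decay_rate :: "(nat \<Rightarrow> real) \<Rightarrow> real" where
  "decay_rate \<alpha> = 1 / (64 * (stencil_bound \<alpha> + 6))"

text \<open>The limits of the recursions for the two energies and the resulting bounds of the norms. Here \<open>h\<close> and
\<open>B\<close> bound the initial value and the two initial guesses in \<open>H\<^sup>2\<close>, and \<open>\<phi>\<close> bounds the force. The summands \<open>\<bar>h\<bar>\<close> and
\<open>\<bar>B\<bar>\<close> cover the data themselves, and \<open>\<bar>\<nu>\<bar>\<close> in the gradient bound makes the time step restriction imply
\<open>\<nu> dt \<le> 1\<close>.\<close>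

definition vort_const :: "(nat \<Rightarrow> real) \<Rightarrow> real \<Rightarrow> real \<Rightarrow> real" where
  "vort_const \<alpha> \<phi> \<nu> = \<phi>\<^sup>2 / (decay_rate \<alpha> * \<nu>\<^sup>2)"

definition vort_bound :: "(nat \<Rightarrow> real) \<Rightarrow> real \<Rightarrow> real \<Rightarrow> real \<Rightarrow> real \<Rightarrow> real" where
  "vort_bound \<alpha> h \<phi> \<nu> B =
     1 + \<bar>B\<bar> + sqrt ((stencil_bound \<alpha> + 6) * (h\<^sup>2 + B\<^sup>2 + B\<^sup>2) + vort_const \<alpha> \<phi> \<nu>) / \<bar>\<alpha> 1\<bar>"

definition grad_const :: "(nat \<Rightarrow> real) \<Rightarrow> real \<Rightarrow> real \<Rightarrow> real \<Rightarrow> real" where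
  "grad_const \<alpha> L \<phi> \<nu> = (540 * sublinear_const \<nu> L + 80 * \<phi>\<^sup>2) / (decay_rate \<alpha> * \<nu>\<^sup>2)"

definition grad_bound :: "(nat \<Rightarrow> real) \<Rightarrow> real \<Rightarrow> real \<Rightarrow> real \<Rightarrow> real \<Rightarrow> real" where
  "grad_bound \<alpha> h \<phi> \<nu> B = 1 + \<bar>\<nu>\<bar> + \<bar>h\<bar> + \<bar>B\<bar> +
     sqrt ((stencil_bound \<alpha> + 6) * ((2 * h)\<^sup>2 + (2 * B)\<^sup>2 + (2 * B)\<^sup>2)
       + grad_const \<alpha> (vort_bound \<alpha> h \<phi> \<nu> B) \<phi> \<nu>) / \<bar>\<alpha> 1\<bar>"

lemma decay_rate_pos: "decay_rate \<alpha> > 0"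
  using stencil_bound_nonneg[of \<alpha>] by (simp add: decay_rate_def)

lemma vort_const_nonneg: "vort_const \<alpha> \<phi> \<nu> \<ge> 0"
  using decay_rate_pos[of \<alpha>] by (simp add: vort_const_def)

lemma grad_const_nonneg: "grad_const \<alpha> L \<phi> \<nu> \<ge> 0"
proof -
  have "sublinear_const \<nu> L \<ge> 0"
    by (simp add: sublinear_const_def)
  then show ?thesis
    using decay_rate_pos[of \<alpha>] by (simp add: grad_const_def)
qed

lemma vort_bound_ge: "1 \<le> vort_bound \<alpha> h \<phi> \<nu> B" "\<bar>B\<bar> \<le> vort_bound \<alpha> h \<phi> \<nu> B"
  "sqrt ((stencil_bound \<alpha> + 6) * (h\<^sup>2 + B\<^sup>2 + B\<^sup>2) + vort_const \<alpha> \<phi> \<nu>) / \<bar>\<alpha> 1\<bar> \<le> vort_bound \<alpha> h \<phi> \<nu> B"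
proof -
  have "0 \<le> sqrt ((stencil_bound \<alpha> + 6) * (h\<^sup>2 + B\<^sup>2 + B\<^sup>2) + vort_const \<alpha> \<phi> \<nu>) / \<bar>\<alpha> 1\<bar>"
    using stencil_bound_nonneg[of \<alpha>] vort_const_nonneg[of \<alpha> \<phi> \<nu>] by simp
  then show "1 \<le> vort_bound \<alpha> h \<phi> \<nu> B" "\<bar>B\<bar> \<le> vort_bound \<alpha> h \<phi> \<nu> B"
    "sqrt ((stencil_bound \<alpha> + 6) * (h\<^sup>2 + B\<^sup>2 + B\<^sup>2) + vort_const \<alpha> \<phi> \<nu>) / \<bar>\<alpha> 1\<bar> \<le> vort_bound \<alpha> h \<phi> \<nu> B"
    unfolding vort_bound_def by linarith+
qed

lemma grad_bound_ge: "1 \<le> grad_bound \<alpha> h \<phi> \<nu> B" "\<bar>\<nu>\<bar> \<le> grad_bound \<alpha> h \<phi> \<nu> B"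
  "\<bar>h\<bar> \<le> grad_bound \<alpha> h \<phi> \<nu> B" "\<bar>B\<bar> \<le> grad_bound \<alpha> h \<phi> \<nu> B"
  "sqrt ((stencil_bound \<alpha> + 6) * ((2 * h)\<^sup>2 + (2 * B)\<^sup>2 + (2 * B)\<^sup>2)
    + grad_const \<alpha> (vort_bound \<alpha> h \<phi> \<nu> B) \<phi> \<nu>) / \<bar>\<alpha> 1\<bar> \<le> grad_bound \<alpha> h \<phi> \<nu> B"
proof -
  have "0 \<le> sqrt ((stencil_bound \<alpha> + 6) * ((2 * h)\<^sup>2 + (2 * B)\<^sup>2 + (2 * B)\<^sup>2)
      + grad_const \<alpha> (vort_bound \<alpha> h \<phi> \<nu> B) \<phi> \<nu>) / \<bar>\<alpha> 1\<bar>"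
    using stencil_bound_nonneg[of \<alpha>] grad_const_nonneg[of \<alpha>] by simp
  then show "1 \<le> grad_bound \<alpha> h \<phi> \<nu> B" "\<bar>\<nu>\<bar> \<le> grad_bound \<alpha> h \<phi> \<nu> B"
    "\<bar>h\<bar> \<le> grad_bound \<alpha> h \<phi> \<nu> B" "\<bar>B\<bar> \<le> grad_bound \<alpha> h \<phi> \<nu> B"
    "sqrt ((stencil_bound \<alpha> + 6) * ((2 * h)\<^sup>2 + (2 * B)\<^sup>2 + (2 * B)\<^sup>2)
    + grad_const \<alpha> (vort_bound \<alpha> h \<phi> \<nu> B) \<phi> \<nu>) / \<bar>\<alpha> 1\<bar> \<le> grad_bound \<alpha> h \<phi> \<nu> B"
    unfolding grad_bound_def by linarith+
qed

lemma decay_step: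
  assumes pos: "\<nu> > 0" "dt > 0"
    and E: "E' \<le> (stencil_bound \<alpha> + 6) * S" and step: "E' + 1/64 * (\<nu> * dt * S) \<le> E + dt * (r / \<nu>)"
  shows "(1 + decay_rate \<alpha> * \<nu> * dt) * E' \<le> E + decay_rate \<alpha> * \<nu> * dt * (r / (decay_rate \<alpha> * \<nu>\<^sup>2))"
proof -
  have "decay_rate \<alpha> * \<nu> * dt * E' \<le> decay_rate \<alpha> * \<nu> * dt * ((stencil_bound \<alpha> + 6) * S)"
    using pos decay_rate_pos[of \<alpha>] by (intro mult_left_mono E) auto
  also have "\<dots> = decay_rate \<alpha> * (stencil_bound \<alpha> + 6) * (\<nu> * dt * S)"
    by (simp only: mult_ac)
  also have "decay_rate \<alpha> * (stencil_bound \<alpha> + 6) = 1/64"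
    using stencil_bound_nonneg[of \<alpha>] by (simp add: decay_rate_def divide_simps)
  also have "decay_rate \<alpha> * \<nu> * dt * (r / (decay_rate \<alpha> * \<nu>\<^sup>2)) = dt * (r / \<nu>)"
    using decay_rate_pos[of \<alpha>] pos by (simp add: power2_eq_square)
  ultimately show ?thesis
    using step by (simp only: distrib_right mult_1)
qed

lemma norm_le_of_energy:
  assumes "a \<noteq> 0" "a\<^sup>2 * x\<^sup>2 \<le> E" "x \<ge> 0"
  shows "x \<le> sqrt E / \<bar>a\<bar>"
proof -
  have "(\<bar>a\<bar> * x)\<^sup>2 \<le> E"
    using assms by (simp add: power_mult_distrib)
  then have "\<bar>a\<bar> * x \<le> sqrt E"
    by (rule real_le_rsqrt)
  then show ?thesis
    using assms by (simp add: pos_le_divide_eq mult.commute)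
qed

lemma norm_le_of_decay:
  assumes "a \<noteq> 0" "a\<^sup>2 * x\<^sup>2 \<le> E" "x \<ge> 0" and E: "E \<le> (1 + b) powr (- real n) * E0 + c" "E0 \<le> E1"
    and "E1 \<ge> 0" "c \<ge> 0" "b \<ge> 0"
  shows "x \<le> inverse \<bar>a\<bar> * (1 + b) powr (- real n / 2) * sqrt E1 + sqrt c / \<bar>a\<bar>"
proof -
  have "x \<le> sqrt E / \<bar>a\<bar>"
    by (rule norm_le_of_energy) fact+
  have sqrt_E: "sqrt E \<le> (1 + b) powr (- real n / 2) * sqrt E1 + sqrt c"
  proof -
    have "E \<le> (1 + b) powr (- real n) * E1 + c"
      using E(1) mult_left_mono[OF E(2), of "(1 + b) powr (- real n)"] by simp
    then have "sqrt E \<le> sqrt ((1 + b) powr (- real n) * E1 + c)"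
      by simp
    also have "\<dots> \<le> sqrt ((1 + b) powr (- real n) * E1) + sqrt c"
      using assms by (intro sqrt_add_le_add_sqrt) auto
    also have "sqrt ((1 + b) powr (- real n) * E1) = (1 + b) powr (- real n / 2) * sqrt E1"
    proof -
      have "sqrt ((1 + b) powr (- real n)) = (1 + b) powr (- real n / 2)"
        using assms by (simp add: powr_half_sqrt[symmetric] powr_powr)
      then show ?thesis
        by (simp add: real_sqrt_mult)
    qed
    finally show ?thesis .
  qed
  note \<open>x \<le> sqrt E / \<bar>a\<bar>\<close>
  also have "sqrt E / \<bar>a\<bar> \<le> ((1 + b) powr (- real n / 2) * sqrt E1 + sqrt c) / \<bar>a\<bar>"
    by (rule divide_right_mono[OF sqrt_E]) simp
  finally show ?thesis
    unfolding divide_inverse[of _ "\<bar>a\<bar>"] distrib_right by (simp only: mult_ac)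
qed

text \<open>The force \<open>g n\<close> belongs to the step that starts at level \<open>n\<close> and ends at level \<open>n + 1\<close>.\<close>

locale bdf3_run =
  fixes \<alpha> :: "nat \<Rightarrow> real" and K :: nat and \<nu> dt \<phi> :: real
    and w \<psi> :: "int \<Rightarrow> grid" and u :: "int \<Rightarrow> grid \<times> grid" and g :: "int \<Rightarrow> grid"
  assumes stencil: "stencil_constants \<alpha>"
    and pos: "\<nu> > 0" "dt > 0" and visc_dt: "\<nu> * dt \<le> 1"
    and grid: "\<And>n. n \<ge> -2 \<Longrightarrow> is_grid K (w n)"
    and kin: "\<And>n. n \<ge> -2 \<Longrightarrow> kinematic K (w n) (\<psi> n) (u n)"
    and step: "\<And>n. n \<ge> 0 \<Longrightarrow> scheme_step K \<nu> dt (w (n + 1)) (w n) (w (n - 1)) (w (n - 2))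
      (nonlinN K (u n) (w n)) (nonlinN K (u (n - 1)) (w (n - 1))) (nonlinN K (u (n - 2)) (w (n - 2))) (g n)"
    and force: "\<And>n. n \<ge> 0 \<Longrightarrow> gnorm K (g n) \<le> \<phi>"
begin

abbreviation F :: "int \<Rightarrow> real" where
  "F n \<equiv> F_init \<alpha> K \<nu> dt (w n) (w (n - 1)) (w (n - 2))"

abbreviation G :: "int \<Rightarrow> real" where
  "G n \<equiv> grad_energy \<alpha> K \<nu> dt (w n) (w (n - 1)) (w (n - 2))"

abbreviation \<beta> :: real where
  "\<beta> \<equiv> decay_rate \<alpha> * \<nu> * dt"

lemma \<alpha>1: "\<alpha> 1 \<noteq> 0"
  using stencil by (simp add: stencil_constants_def)

lemma \<beta>_pos: "\<beta> > 0"
  using pos decay_rate_pos[of \<alpha>] by simp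

lemma mean0: "n \<ge> -2 \<Longrightarrow> gavg K (w n) = 0"
  using kinematic_mean(1)[OF kin] .

lemma F_step:
  assumes n: "n \<ge> 0" and M: "M > 0" "135000 * lattice_const * M\<^sup>2 * dt \<le> \<nu>"
    and grad: "\<And>l. l \<ge> -2 \<Longrightarrow> l \<le> n \<Longrightarrow> vgnorm K (gradN K (w l)) \<le> M"
  shows "(1 + \<beta>) * F (n + 1) \<le> F n + \<beta> * vort_const \<alpha> \<phi> \<nu>"
proof -
  have idx: "n + 1 - 1 = n" "n + 1 - 2 = n - 1"
    by simp_all
  note orth = nonlinN_orthogonal[OF mean0]
  note N = nonlinN_le_quadratic[OF kin grad]
  have "F (n + 1) + 1/64 * (\<nu> * dt * ((vgnorm K (gradN K (w (n + 1))))\<^sup>2 + (vgnorm K (gradN K (w n)))\<^sup>2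
      + (vgnorm K (gradN K (w (n - 1))))\<^sup>2)) \<le> F n + dt * (\<phi>\<^sup>2 / \<nu>)"
    unfolding idx
    using n M pos lattice_const_pos
    by (intro vorticity_step[OF stencil pos(1) pos(2) _ grid grid grid grid mean0 mean0 step orth orth orth N N N _ force])
      (auto simp: mult_ac)
  moreover have "F (n + 1) \<le> (stencil_bound \<alpha> + 6) * ((vgnorm K (gradN K (w (n + 1))))\<^sup>2 + (vgnorm K (gradN K (w n)))\<^sup>2
      + (vgnorm K (gradN K (w (n - 1))))\<^sup>2)"
    unfolding idx using n pos visc_dt by (intro F_init_le mean0) auto
  ultimately show ?thesis
    unfolding vort_const_def using decay_step[OF pos] by blast
qed

lemma G_step:
  assumes n: "n \<ge> 0" and L: "L > 0"
    and vort: "\<And>l. l \<ge> -2 \<Longrightarrow> l \<le> n \<Longrightarrow> gnorm K (w l) \<le> L"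
  shows "(1 + \<beta>) * G (n + 1) \<le> G n + \<beta> * grad_const \<alpha> L \<phi> \<nu>"
proof -
  have idx: "n + 1 - 1 = n" "n + 1 - 2 = n - 1"
    by simp_all
  note N = nonlinN_le_sublinear[OF kin vort L pos(1)]
  define S where "S = (gnorm K (lapN K (w (n + 1))))\<^sup>2 + (gnorm K (lapN K (w n)))\<^sup>2 + (gnorm K (lapN K (w (n - 1))))\<^sup>2"
  have "S \<ge> 0"
    by (simp add: S_def)
  have "G (n + 1) + 1/24 * (\<nu> * dt * S) \<le> G n + dt * ((540 * sublinear_const \<nu> L + 80 * \<phi>\<^sup>2) / \<nu>)"
    unfolding idx S_def using n by (intro gradient_step[OF stencil pos step N N N force]) auto
  moreover have "0 \<le> \<nu> * dt * S"
    using pos \<open>S \<ge> 0\<close> by simp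
  ultimately have "G (n + 1) + 1/64 * (\<nu> * dt * S) \<le> G n + dt * ((540 * sublinear_const \<nu> L + 80 * \<phi>\<^sup>2) / \<nu>)"
    by linarith
  moreover have "G (n + 1) \<le> (stencil_bound \<alpha> + 6) * S"
    unfolding idx S_def using pos visc_dt by (intro grad_energy_le) auto
  ultimately show ?thesis
    unfolding grad_const_def using decay_step[OF pos] by blast
qed

lemma F_decay:
  assumes M: "M > 0" "135000 * lattice_const * M\<^sup>2 * dt \<le> \<nu>"
    and grad: "\<And>l. l \<ge> -2 \<Longrightarrow> l < int m \<Longrightarrow> vgnorm K (gradN K (w l)) \<le> M" and n: "n \<le> m"
  shows "F (int n) \<le> (1 + \<beta>) powr (- real n) * F 0 + vort_const \<alpha> \<phi> \<nu>"
proof -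
  have "(1 + \<beta>) * F (int (Suc k)) \<le> F (int k) + \<beta> * vort_const \<alpha> \<phi> \<nu>" if "k < m" for k
    using F_step[of "int k" M, OF _ M grad] that by (simp add: add.commute)
  from geometric_decay[of \<beta> _ m "\<lambda>n. F (int n)", OF \<beta>_pos vort_const_nonneg this n] show ?thesis
    by simp
qed

lemma G_decay:
  assumes L: "L > 0" and vort: "\<And>l. l \<ge> -2 \<Longrightarrow> l < int m \<Longrightarrow> gnorm K (w l) \<le> L" and n: "n \<le> m"
  shows "G (int n) \<le> (1 + \<beta>) powr (- real n) * G 0 + grad_const \<alpha> L \<phi> \<nu>"
proof -
  have "(1 + \<beta>) * G (int (Suc k)) \<le> G (int k) + \<beta> * grad_const \<alpha> L \<phi> \<nu>" if "k < m" for k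
    using G_step[of "int k" L, OF _ L vort] that by (simp add: add.commute)
  from geometric_decay[of \<beta> _ m "\<lambda>n. G (int n)", OF \<beta>_pos grad_const_nonneg this n] show ?thesis
    by simp
qed

lemma F_ge: "(\<alpha> 1)\<^sup>2 * (gnorm K (w n))\<^sup>2 \<le> F n"
  by (rule F_init_ge[OF pos])

lemma G_ge: "(\<alpha> 1)\<^sup>2 * (vgnorm K (gradN K (w n)))\<^sup>2 \<le> G n"
  by (rule grad_energy_ge[OF pos])

lemma F_nonneg: "0 \<le> F n" and G_nonneg: "0 \<le> G n"
  by (rule order_trans[OF _ F_ge] order_trans[OF _ G_ge]; simp)+

lemma decay_factor_le: "E \<ge> 0 \<Longrightarrow> (1 + \<beta>) powr (- real n) * E \<le> E"
proof -
  assume "E \<ge> 0"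
  have "(1 + \<beta>) powr (- real n) \<le> (1 + \<beta>) powr 0"
    using \<beta>_pos by (intro powr_mono) auto
  then have "(1 + \<beta>) powr (- real n) \<le> 1"
    using \<beta>_pos by simp
  from mult_right_mono[OF this \<open>E \<ge> 0\<close>] show ?thesis
    by simp
qed

definition initial_bounds :: "real \<Rightarrow> real \<Rightarrow> bool" where
  "initial_bounds h B \<longleftrightarrow>
     gnorm K (w 0) \<le> h \<and> vgnorm K (gradN K (w 0)) \<le> h \<and> gnorm K (lapN K (w 0)) \<le> 2 * h \<and>
     gnorm K (w (-1)) \<le> B \<and> vgnorm K (gradN K (w (-1))) \<le> B \<and> gnorm K (lapN K (w (-1))) \<le> 2 * B \<and>
     gnorm K (w (-2)) \<le> B \<and> vgnorm K (gradN K (w (-2))) \<le> B \<and> gnorm K (lapN K (w (-2))) \<le> 2 * B"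

text \<open>The bound does not depend on the a priori bound \<open>M\<close> of the gradients, which only has to be compatible with the
time step.\<close>

lemma vorticity_bounded:
  assumes init: "initial_bounds h B" and M: "M > 0" "135000 * lattice_const * M\<^sup>2 * dt \<le> \<nu>"
    and grad: "\<And>l. l \<ge> -2 \<Longrightarrow> l < int m \<Longrightarrow> vgnorm K (gradN K (w l)) \<le> M"
    and n: "n \<ge> -2" "n \<le> int m"
  shows "gnorm K (w n) \<le> vort_bound \<alpha> h \<phi> \<nu> B"
proof (cases "n \<ge> 0")
  case True
  then obtain k where k: "n = int k"
    by (metis nonneg_int_cases)
  have "F 0 \<le> (stencil_bound \<alpha> + 6) * ((vgnorm K (gradN K (w 0)))\<^sup>2 + (vgnorm K (gradN K (w (0 - 1))))\<^sup>2
      + (vgnorm K (gradN K (w (0 - 2))))\<^sup>2)"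
    using pos visc_dt by (intro F_init_le mean0) auto
  also have "\<dots> \<le> (stencil_bound \<alpha> + 6) * (h\<^sup>2 + B\<^sup>2 + B\<^sup>2)"
    using init stencil_bound_nonneg[of \<alpha>] vgnorm_nonneg
    by (intro mult_left_mono add_mono power_mono) (auto simp: initial_bounds_def)
  finally have "F n \<le> (stencil_bound \<alpha> + 6) * (h\<^sup>2 + B\<^sup>2 + B\<^sup>2) + vort_const \<alpha> \<phi> \<nu>"
    using F_decay[OF M grad, of m k] decay_factor_le[OF F_nonneg[of 0], of k] n k by simp
  then have "gnorm K (w n) \<le> sqrt ((stencil_bound \<alpha> + 6) * (h\<^sup>2 + B\<^sup>2 + B\<^sup>2) + vort_const \<alpha> \<phi> \<nu>) / \<bar>\<alpha> 1\<bar>"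
    by (intro norm_le_of_energy \<alpha>1 gnorm_nonneg order_trans[OF F_ge])
  then show ?thesis
    using vort_bound_ge(3) by (rule order_trans)
next
  case False
  then have "n = -1 \<or> n = -2"
    using n by linarith
  then have "gnorm K (w n) \<le> \<bar>B\<bar>"
    using init by (auto simp: initial_bounds_def)
  then show ?thesis
    using vort_bound_ge(2) by (rule order_trans)
qed

text \<open>Induction over the time steps. Gradient bounds up to level \<open>m\<close> give the vorticity bound up to level \<open>m\<close>, and the
latter is all that the gradient estimate needs to reach level \<open>m + 1\<close>.\<close>

theorem gradient_bounded:
  assumes init: "initial_bounds h B"
    and dt: "135000 * lattice_const * (grad_bound \<alpha> h \<phi> \<nu> B)\<^sup>2 * dt \<le> \<nu>"
    and n: "n \<ge> -2"
  shows "vgnorm K (gradN K (w n)) \<le> grad_bound \<alpha> h \<phi> \<nu> B"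
proof -
  let ?M = "grad_bound \<alpha> h \<phi> \<nu> B" and ?L = "vort_bound \<alpha> h \<phi> \<nu> B"
  have M: "?M > 0" and L: "?L > 0"
    using grad_bound_ge(1)[of \<alpha> h \<phi> \<nu> B] vort_bound_ge(1)[of \<alpha> h \<phi> \<nu> B] by linarith+
  have data: "vgnorm K (gradN K (w 0)) \<le> ?M" "vgnorm K (gradN K (w (-1))) \<le> ?M" "vgnorm K (gradN K (w (-2))) \<le> ?M"
    using init grad_bound_ge(3)[of h \<alpha> \<phi> \<nu> B] grad_bound_ge(4)[of B \<alpha> h \<phi> \<nu>]
    unfolding initial_bounds_def by linarith+
  have "\<forall>l. l \<ge> -2 \<and> l \<le> int m \<longrightarrow> vgnorm K (gradN K (w l)) \<le> ?M" for m
  proof (induction m)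
    case 0
    show ?case
    proof (intro allI impI)
      fix l :: int
      assume "l \<ge> -2 \<and> l \<le> int 0"
      then have "l = 0 \<or> l = -1 \<or> l = -2"
        by auto
      then show "vgnorm K (gradN K (w l)) \<le> ?M"
        using data by auto
    qed
  next
    case (Suc m)
    then have grad: "vgnorm K (gradN K (w l)) \<le> ?M" if "l \<ge> -2" "l < int (Suc m)" for l
      using that by auto
    have vort: "gnorm K (w l) \<le> ?L" if "l \<ge> -2" "l < int (Suc m)" for l
      using vorticity_bounded[OF init M dt grad, of "Suc m" l] that by simp
    have "G 0 \<le> (stencil_bound \<alpha> + 6) * ((gnorm K (lapN K (w 0)))\<^sup>2 + (gnorm K (lapN K (w (0 - 1))))\<^sup>2
        + (gnorm K (lapN K (w (0 - 2))))\<^sup>2)"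
      using pos visc_dt by (intro grad_energy_le) auto
    also have "\<dots> \<le> (stencil_bound \<alpha> + 6) * ((2 * h)\<^sup>2 + (2 * B)\<^sup>2 + (2 * B)\<^sup>2)"
      using init stencil_bound_nonneg[of \<alpha>] gnorm_nonneg
      by (intro mult_left_mono add_mono power_mono) (auto simp: initial_bounds_def)
    finally have "G (int (Suc m)) \<le> (stencil_bound \<alpha> + 6) * ((2 * h)\<^sup>2 + (2 * B)\<^sup>2 + (2 * B)\<^sup>2)
        + grad_const \<alpha> ?L \<phi> \<nu>"
      using G_decay[OF L vort, of "Suc m" "Suc m"] decay_factor_le[OF G_nonneg[of 0], of "Suc m"] by simp
    then have "vgnorm K (gradN K (w (int (Suc m)))) \<le> sqrt ((stencil_bound \<alpha> + 6) * ((2 * h)\<^sup>2 + (2 * B)\<^sup>2 + (2 * B)\<^sup>2)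
        + grad_const \<alpha> ?L \<phi> \<nu>) / \<bar>\<alpha> 1\<bar>"
      by (intro norm_le_of_energy \<alpha>1 vgnorm_nonneg order_trans[OF G_ge])
    then have "vgnorm K (gradN K (w (int (Suc m)))) \<le> ?M"
      using grad_bound_ge(5) by (rule order_trans)
    then show ?case
      using grad by (metis nless_le)
  qed
  from this[of "nat n"] show ?thesis
    using n by auto
qed

end

text \<open>The number \<open>135000 = 1350 \<cdot> 100\<close> combines the condition in \<open>vorticity_step\<close> with the constant in
\<open>nonlinN_le\<close>.\<close>

definition advection_const :: real where
  "advection_const = 1 + 135000 * lattice_const"

lemma advection_const_ge: "1 \<le> advection_const" "135000 * lattice_const \<le> advection_const"
  using lattice_const_pos by (simp_all add: advection_const_def)

text \<open>The locale is used with two bounds of the initial value: \<open>Hnorm 2 \<omega>\<^sub>0\<close> enters the restriction of the time step and so gives the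
gradient bound, whereas the norm of the extension of \<open>\<omega> 0\<close> gives the limit of the gradients in the conclusion.\<close>

theorem bdf3_uniform_bounds:
  assumes st: "stencil_constants \<alpha>" and \<nu>: "\<nu> > 0" and \<omega>\<^sub>0: "in_H 2 \<omega>\<^sub>0"
    and f: "in_Linf_L2 f" "\<forall>t>0. L2norm (f t) \<le> Linf_L2_norm f" and dt: "dt > 0"
    and sol: "bdf3_solution K \<nu> dt f \<omega>\<^sub>0 \<omega> \<psi> u"
    and B: "Hnorm 2 (ext K (\<omega> (-1))) \<le> B" "Hnorm 2 (ext K (\<omega> (-2))) \<le> B"
    and dt_le: "dt \<le> \<nu> / (advection_const * (grad_bound \<alpha> (Hnorm 2 \<omega>\<^sub>0) (Linf_L2_norm f) \<nu> B)\<^sup>2)"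
  shows "L2norm (ext K (\<omega> (int n)))
      \<le> inverse \<bar>\<alpha> 1\<bar> * (1 + decay_rate \<alpha> * \<nu> * dt) powr (- real n / 2)
          * sqrt (F_init \<alpha> K \<nu> dt (\<omega> 0) (\<omega> (-1)) (\<omega> (-2)))
        + sqrt (vort_const \<alpha> (Linf_L2_norm f) \<nu>) / \<bar>\<alpha> 1\<bar>"
    and "L2norm_grad (ext K (\<omega> (int n)))
      \<le> inverse \<bar>\<alpha> 1\<bar> * (1 + decay_rate \<alpha> * \<nu> * dt) powr (- real n / 2)
          * sqrt (G_init \<alpha> K \<nu> dt (\<omega> 0) (\<omega> (-1)) (\<omega> (-2)))
        + sqrt (grad_const \<alpha> (vort_bound \<alpha> (Hnorm 2 (ext K (\<omega> 0))) (Linf_L2_norm f) \<nu> B) (Linf_L2_norm f) \<nu>) / \<bar>\<alpha> 1\<bar>"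
proof -
  have \<alpha>1: "\<alpha> 1 \<noteq> 0"
    using st by (simp add: stencil_constants_def)
  define \<phi> where "\<phi> = Linf_L2_norm f"
  define M where "M = grad_bound \<alpha> (Hnorm 2 \<omega>\<^sub>0) \<phi> \<nu> B"
  have M: "M \<ge> 1" "M \<ge> \<nu>"
    using grad_bound_ge(1)[of \<alpha> "Hnorm 2 \<omega>\<^sub>0" \<phi> \<nu> B] grad_bound_ge(2)[of \<nu> \<alpha> "Hnorm 2 \<omega>\<^sub>0" \<phi> B]
    by (simp_all add: M_def)
  have CM: "advection_const * M\<^sup>2 * dt \<le> \<nu>"
    using dt_le advection_const_ge M by (simp add: M_def \<phi>_def pos_le_divide_eq mult_ac)
  have dtM: "135000 * lattice_const * M\<^sup>2 * dt \<le> \<nu>"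
  proof -
    have "135000 * lattice_const * (M\<^sup>2 * dt) \<le> advection_const * (M\<^sup>2 * dt)"
      using dt by (intro mult_right_mono advection_const_ge) auto
    then show ?thesis
      using CM by (simp only: mult.assoc)
  qed
  have visc_dt: "\<nu> * dt \<le> 1"
  proof -
    have "\<nu> * (\<nu> * dt) \<le> M\<^sup>2 * dt"
      unfolding power2_eq_square mult.assoc using M \<nu> dt by (intro mult_mono) auto
    also have "\<dots> \<le> advection_const * (M\<^sup>2 * dt)"
      using mult_right_mono[OF advection_const_ge(1), of "M\<^sup>2 * dt"] dt by simp
    finally have "\<nu> * (\<nu> * dt) \<le> \<nu> * 1"
      using CM by (simp add: mult.assoc)
    then show ?thesis
      using \<nu> by (rule mult_left_le_imp_le)
  qed
  interpret run: bdf3_run \<alpha> K \<nu> dt \<phi> \<omega> \<psi> u "\<lambda>n. restrict_grid K (fourier_proj K (f (of_int (n + 1) * dt)))"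
  proof
    show "gnorm K (restrict_grid K (fourier_proj K (f (of_int (n + 1) * dt)))) \<le> \<phi>" if "n \<ge> 0" for n
    proof -
      have "of_int (n + 1) * dt > 0"
        using that dt by simp
      then have "L2norm (f (of_int (n + 1) * dt)) \<le> \<phi>" "in_L2 (f (of_int (n + 1) * dt))"
        using f by (auto simp: in_Linf_L2_def \<phi>_def)
      then show ?thesis
        using gnorm_fourier_proj_le order_trans by blast
    qed
  qed (use sol st \<nu> dt visc_dt in \<open>auto simp: bdf3_solution_def bdf3_step_def scheme_step_def bdf3_def\<close>)
  have ext_le: "gnorm K v \<le> Hnorm 2 (ext K v)" "vgnorm K (gradN K v) \<le> Hnorm 2 (ext K v)"
    "gnorm K (lapN K v) \<le> 2 * Hnorm 2 (ext K v)" for v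
    by (rule grid_norms_le_Hnorm[OF in_L2_ext weak_deriv_ext]; simp add: fourier_coeff_ext)+
  have w0: "\<omega> 0 = restrict_grid K (fourier_proj K \<omega>\<^sub>0)"
    using sol by (simp add: bdf3_solution_def)
  have w0_le: "gnorm K (\<omega> 0) \<le> Hnorm 2 \<omega>\<^sub>0" "vgnorm K (gradN K (\<omega> 0)) \<le> Hnorm 2 \<omega>\<^sub>0"
    "gnorm K (lapN K (\<omega> 0)) \<le> 2 * Hnorm 2 \<omega>\<^sub>0"
    unfolding w0
    by (rule grid_norms_le_Hnorm; use \<omega>\<^sub>0 in \<open>simp add: in_H_def dft_fourier_proj\<close>)+
  have init: "run.initial_bounds (Hnorm 2 \<omega>\<^sub>0) B" "run.initial_bounds (Hnorm 2 (ext K (\<omega> 0))) B"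
    unfolding run.initial_bounds_def
    using w0_le ext_le[of "\<omega> 0"] ext_le[of "\<omega> (-1)"] ext_le[of "\<omega> (-2)"] B by auto
  have grad: "vgnorm K (gradN K (\<omega> l)) \<le> M" if "l \<ge> -2" for l
    unfolding M_def by (rule run.gradient_bounded[OF init(1) dtM[unfolded M_def] that])
  have M0: "M > 0"
    using M by simp
  show "L2norm (ext K (\<omega> (int n)))
      \<le> inverse \<bar>\<alpha> 1\<bar> * (1 + decay_rate \<alpha> * \<nu> * dt) powr (- real n / 2)
          * sqrt (F_init \<alpha> K \<nu> dt (\<omega> 0) (\<omega> (-1)) (\<omega> (-2)))
        + sqrt (vort_const \<alpha> (Linf_L2_norm f) \<nu>) / \<bar>\<alpha> 1\<bar>"
    unfolding L2norm_ext \<phi>_def[symmetric]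
    by (rule norm_le_of_decay[OF \<alpha>1 run.F_ge gnorm_nonneg run.F_decay[OF M0 dtM grad order_refl]])
      (use run.F_nonneg[of 0] run.\<beta>_pos in \<open>simp_all add: vort_const_nonneg\<close>)
  let ?L = "vort_bound \<alpha> (Hnorm 2 (ext K (\<omega> 0))) \<phi> \<nu> B"
  have L: "?L > 0"
    using vort_bound_ge(1)[of \<alpha> "Hnorm 2 (ext K (\<omega> 0))" \<phi> \<nu> B] by linarith
  have vort: "gnorm K (\<omega> l) \<le> ?L" if "l \<ge> -2" for l
    by (rule run.vorticity_bounded[OF init(2) M0 dtM grad that, of "nat l"]) auto
  have "0 \<le> G_init \<alpha> K \<nu> dt (\<omega> 0) (\<omega> (-1)) (\<omega> (-2))"
    using run.G_nonneg[of 0] grad_energy_le_G_init[OF \<nu> dt, of \<alpha> K "\<omega> 0" "\<omega> (-1)" "\<omega> (-2)"] by simp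
  then show "L2norm_grad (ext K (\<omega> (int n)))
      \<le> inverse \<bar>\<alpha> 1\<bar> * (1 + decay_rate \<alpha> * \<nu> * dt) powr (- real n / 2)
          * sqrt (G_init \<alpha> K \<nu> dt (\<omega> 0) (\<omega> (-1)) (\<omega> (-2)))
        + sqrt (grad_const \<alpha> (vort_bound \<alpha> (Hnorm 2 (ext K (\<omega> 0))) (Linf_L2_norm f) \<nu> B) (Linf_L2_norm f) \<nu>) / \<bar>\<alpha> 1\<bar>"
    unfolding L2norm_grad_ext \<phi>_def[symmetric]
    by (intro norm_le_of_decay[OF \<alpha>1 run.G_ge vgnorm_nonneg run.G_decay[OF L vort order_refl]])
      (use run.\<beta>_pos grad_energy_le_G_init[OF \<nu> dt, of \<alpha> K "\<omega> 0" "\<omega> (-1)" "\<omega> (-2)"] in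
        \<open>simp_all add: grad_const_nonneg\<close>)
qed

theorem theorem2p1:
  shows "\<exists>C\<^sub>w > (0::real). \<forall>\<alpha> :: nat \<Rightarrow> real. stencil_constants \<alpha> \<longrightarrow>
    (\<exists>\<alpha>\<^sub>0 > (0::real). \<exists>\<beta>\<^sub>0 > (0::real).
     \<exists>M\<^sub>0 R\<^sub>0 R\<^sub>1 :: real \<Rightarrow> real \<Rightarrow> real \<Rightarrow> real \<Rightarrow> real.
       (\<forall>a b c d. M\<^sub>0 a b c d > 0) \<and>
       (\<forall>(\<nu>::real) \<omega>\<^sub>0 f (B::real) (K::nat) (dt::real) \<omega> \<psi> u.
          \<nu> > 0 \<longrightarrow>
          in_H 2 \<omega>\<^sub>0 \<longrightarrow> mean \<omega>\<^sub>0 = 0 \<longrightarrow>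
          in_Linf_L2 f \<longrightarrow> (\<forall>t>0. L2norm (f t) \<le> Linf_L2_norm f) \<longrightarrow> (\<forall>t>0. mean (f t) = 0) \<longrightarrow>
          dt > 0 \<longrightarrow>
          bdf3_solution K \<nu> dt f \<omega>\<^sub>0 \<omega> \<psi> u \<longrightarrow>
          Hnorm 2 (ext K (\<omega> (-1))) \<le> B \<longrightarrow> Hnorm 2 (ext K (\<omega> (-2))) \<le> B \<longrightarrow>
          dt \<le> \<nu> / (C\<^sub>w * (M\<^sub>0 (Hnorm 2 \<omega>\<^sub>0) \<nu> (Linf_L2_norm f) B)\<^sup>2) \<longrightarrow>
          (\<forall>n::nat.
             L2norm (ext K (\<omega> (int n)))
               \<le> inverse \<alpha>\<^sub>0 * (1 + \<beta>\<^sub>0 * \<nu> * dt) powr (- real n / 2)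
                   * sqrt (F_init \<alpha> K \<nu> dt (\<omega> 0) (\<omega> (-1)) (\<omega> (-2)))
                 + R\<^sub>0 (Hnorm 2 (ext K (\<omega> 0))) (Linf_L2_norm f) \<nu> B \<and>
             L2norm_grad (ext K (\<omega> (int n)))
               \<le> inverse \<alpha>\<^sub>0 * (1 + \<beta>\<^sub>0 * \<nu> * dt) powr (- real n / 2)
                   * sqrt (G_init \<alpha> K \<nu> dt (\<omega> 0) (\<omega> (-1)) (\<omega> (-2)))
                 + R\<^sub>1 (Hnorm 2 (ext K (\<omega> 0))) (Linf_L2_norm f) \<nu> B)))"
proof (rule exI[of _ advection_const], intro conjI allI impI, goal_cases)
  case 1
  show ?case
    using advection_const_ge(1) by simp
next
  case st: (2 \<alpha>)
  then have \<alpha>1: "\<alpha> 1 \<noteq> 0"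
    by (simp add: stencil_constants_def)
  show ?case
  proof (rule exI[of _ "\<bar>\<alpha> 1\<bar>"], rule conjI, rule zero_less_abs_iff[THEN iffD2, OF \<alpha>1],
      rule exI[of _ "decay_rate \<alpha>"], rule conjI, rule decay_rate_pos,
      rule exI[of _ "\<lambda>h \<nu> \<phi> B. grad_bound \<alpha> h \<phi> \<nu> B"],
      rule exI[of _ "\<lambda>h \<phi> \<nu> B. sqrt (vort_const \<alpha> \<phi> \<nu>) / \<bar>\<alpha> 1\<bar>"],
      rule exI[of _ "\<lambda>h \<phi> \<nu> B. sqrt (grad_const \<alpha> (vort_bound \<alpha> h \<phi> \<nu> B) \<phi> \<nu>) / \<bar>\<alpha> 1\<bar>"],
      intro conjI allI impI, goal_cases)
    case (1 a b c d)
    show ?case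
      using grad_bound_ge(1)[of \<alpha> a c b d] by linarith
  next
    case sol: (2 \<nu> \<omega>\<^sub>0 f B K dt \<omega> \<psi> u n)
    show ?case
      by (rule bdf3_uniform_bounds(1)[OF st sol(1,2,4,5,7-11)])
  next
    case sol: (3 \<nu> \<omega>\<^sub>0 f B K dt \<omega> \<psi> u n)
    show ?case
      by (rule bdf3_uniform_bounds(2)[OF st sol(1,2,4,5,7-11)])
  qed
qed

end
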